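(* Let $\mathcal P$ and $\mathcal Q$ be regular $d$-polytopes, each with facets isomorphic to a regular $(d-1)$-polytope $\mathcal K$. Suppose the automorphism groups of $\mathcal P$ and $\mathcal Q$ are finite 2-groups or infinite 2-groups. Then the universal alternating semiregular $(d+1)$-polytope $\mathcal U$ with facets isomorphic to $\mathcal P$ and $\mathcal Q$ has an automorphism group which is an infinite 2-group.
   Context: **Infinite 2-groups.** A finitely generated infinite group $G$ is called an infinite 2-group if every element of $G$ of finite order has 2-power order. **Polytopes.** An (abstract) polytope of rank $d$ (a $d$-polytope) is a partially ordered set $\mathcal P$ with a strictly monotone rank function with values in $\{-1,0,\ldots,d\}$, having a unique least face $F_{-1}$ (rank $-1$) and a unique greatest face $F_d$ (rank $d$), such that: every flag (maximal totally ordered subset) has exactly $d+2$ faces, one of each rank; $\mathcal P$ is strongly flag-connected (any two flags $\Phi,\Psi$ are joined by a finite sequence of flags, each containing $\Phi\cap\Psi$, in which successive flags are adjacent, i.e. differ in exactly one face); and the diamond condition holds (if $F\le G$ have ranks $j-1$ and $j+1$, there are exactly two $j$-faces $H$ with $F\le H\le G$). $0$-faces are vertices, $(d-1)$-faces are facets; a facet $F$ is identified with the section $F/F_{-1}=\{H: F_{-1}\le H\le F\}$. $\Phi^j$ denotes the unique flag differing from the flag $\Phi$ exactly in its $j$-face. $\mathcal P$ is regular if its automorphism group $\Gamma(\mathcal P)$ is transitive on flags; then $\Gamma(\mathcal P)=\langle\rho_0,\ldots,\rho_{d-1}\rangle$, where the involution $\rho_i$ maps a fixed base flag $\Phi$ to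 $\Phi^i$, and the group of its facets is $\langle\rho_0,\ldots,\rho_{d-2}\rangle$. **Alternating semiregular polytopes.** A $(d+1)$-polytope $\mathcal S$ is semiregular if its facets are regular and $\Gamma(\mathcal S)$ is transitive on vertices. It is alternating semiregular if moreover its facets are of two kinds $\mathcal P$ and $\mathcal Q$ (both regular) which occur in alternating fashion around any $(d-2)$-face of $\mathcal S$. The case $\mathcal P\cong\mathcal Q$ is allowed, with the meaning that $\Gamma(\mathcal S)$ has a subgroup of index 2 with only two facet orbits such that the facet orbits occur in alternating fashion around any $(d-2)$-face. **Universal polytope.** It is known that for regular $d$-polytopes $\mathcal P,\mathcal Q$ with facets isomorphic to $\mathcal K$ there is a universal alternating semiregular $(d+1)$-polytope $\mathcal U$ with facets isomorphic to $\mathcal P$ and $\mathcal Q$; it is regular if and only if $\mathcal P\cong\mathcal Q$. Let $\Gamma=\Gamma(\mathcal P)\ast_{\Gamma(\mathcal K)}\Gamma(\mathcal Q)$ be the free product of $\Gamma(\mathcal P)$ and $\Gamma(\mathcal Q)$ amalgamated along their common subgroups $\Gamma(\mathcal K)$ (the facet subgroups, with corresponding distinguished generators identified). Then $\Gamma(\mathcal U)=\Gamma$ if $\mathcal P\not\cong\mathcal Q$, and $\Gamma(\mathcal U)=\Gamma\rtimes C_2$ if $\mathcal P\cong\mathcal Q$. *)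

theory Defs
  imports Complex_Main "HOL-Algebra.Order" "HOL-Algebra.Bij" "HOL-Algebra.Coset"
    "HOL-Algebra.Generated_Groups" "HOL-Algebra.Group_Action" "HOL-Algebra.Multiplicative_Group"
begin

section \<open>2-groups\<close>

definition finite_2_group :: "('a, 'b) monoid_scheme \<Rightarrow> bool" where
  "finite_2_group G \<longleftrightarrow> group G \<and> (\<exists>k. order G = 2 ^ k)"

definition finitely_generated_group :: "('a, 'b) monoid_scheme \<Rightarrow> bool" where
  "finitely_generated_group G \<longleftrightarrow>
     group G \<and> (\<exists>A. finite A \<and> A \<subseteq> carrier G \<and> generate G A = carrier G)"

text \<open>The library order \<^const>\<open>group.ord\<close> of an element of infinite order is \<open>0\<close>.\<close>

definition infinite_2_group :: "('a, 'b) monoid_scheme \<Rightarrow> bool" where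
  "infinite_2_group G \<longleftrightarrow>
     finitely_generated_group G \<and> infinite (carrier G) \<and>
     (\<forall>x\<in>carrier G. group.ord G x \<noteq> 0 \<longrightarrow> (\<exists>k. group.ord G x = 2 ^ k))"

section \<open>Abstract polytopes\<close>

record 'a ranked_order = "'a gorder" +
  rk :: "'a \<Rightarrow> int"

definition flag :: "'a ranked_order \<Rightarrow> 'a set \<Rightarrow> bool" where
  "flag P \<Phi> \<longleftrightarrow> pred_on.maxchain (carrier P) (le P) \<Phi>"

definition adjacent_flags :: "'a ranked_order \<Rightarrow> 'a set \<Rightarrow> 'a set \<Rightarrow> bool" where
  "adjacent_flags P \<Phi> \<Psi> \<longleftrightarrow>
     flag P \<Phi> \<and> flag P \<Psi> \<and> card (\<Phi> - \<Psi>) = 1 \<and> card (\<Psi> - \<Phi>) = 1"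

definition strongly_flag_connected :: "'a ranked_order \<Rightarrow> bool" where
  "strongly_flag_connected P \<longleftrightarrow>
     (\<forall>\<Phi> \<Psi>. flag P \<Phi> \<longrightarrow> flag P \<Psi> \<longrightarrow>
        (\<lambda>A B. adjacent_flags P A B \<and> \<Phi> \<inter> \<Psi> \<subseteq> A \<and> \<Phi> \<inter> \<Psi> \<subseteq> B)\<^sup>*\<^sup>* \<Phi> \<Psi>)"

definition diamond_condition :: "'a ranked_order \<Rightarrow> bool" where
  "diamond_condition P \<longleftrightarrow>
     (\<forall>F\<in>carrier P. \<forall>G\<in>carrier P. \<forall>j. F \<sqsubseteq>\<^bsub>P\<^esub> G \<longrightarrow> rk P F = j - 1 \<longrightarrow> rk P G = j + 1 \<longrightarrow>
        card {H \<in> carrier P. rk P H = j \<and> F \<sqsubseteq>\<^bsub>P\<^esub> H \<and> H \<sqsubseteq>\<^bsub>P\<^esub> G} = 2)"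

definition polytope :: "int \<Rightarrow> 'a ranked_order \<Rightarrow> bool" where
  "polytope d P \<longleftrightarrow>
     partial_order P \<and>
     rk P \<in> carrier P \<rightarrow> {-1..d} \<and>
     (\<forall>x\<in>carrier P. \<forall>y\<in>carrier P. x \<sqsubseteq>\<^bsub>P\<^esub> y \<and> x \<noteq> y \<longrightarrow> rk P x < rk P y) \<and>
     (\<exists>F. least P F (carrier P) \<and> rk P F = -1) \<and>
     (\<exists>F. greatest P F (carrier P) \<and> rk P F = d) \<and>
     (\<forall>\<Phi>. flag P \<Phi> \<longrightarrow> bij_betw (rk P) \<Phi> {-1..d}) \<and>
     strongly_flag_connected P \<and>
     diamond_condition P"

definition faces_of_rank :: "int \<Rightarrow> 'a ranked_order \<Rightarrow> 'a set" where
  "faces_of_rank j P = {F \<in> carrier P. rk P F = j}"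

text \<open>The section \<open>F / F\<^sub>-\<^sub>1\<close>.\<close>

definition lower_section :: "'a ranked_order \<Rightarrow> 'a \<Rightarrow> 'a ranked_order" where
  "lower_section P F = P\<lparr>carrier := \<lbrace>\<bottom>\<^bsub>P\<^esub>..F\<rbrace>\<^bsub>P\<^esub>\<rparr>"

text \<open>Order isomorphisms between polytopes automatically preserve ranks.\<close>

definition isomorphic :: "'a ranked_order \<Rightarrow> 'b ranked_order \<Rightarrow> bool" where
  "isomorphic P Q \<longleftrightarrow> (\<exists>f. order_emb P Q f \<and> bij_betw f (carrier P) (carrier Q))"

definition Aut :: "'a ranked_order \<Rightarrow> ('a \<Rightarrow> 'a) monoid" where
  "Aut P = (BijGroup (carrier P))\<lparr>carrier := {f \<in> Bij (carrier P). order_emb P P f}\<rparr>"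

definition regular_polytope :: "int \<Rightarrow> 'a ranked_order \<Rightarrow> bool" where
  "regular_polytope d P \<longleftrightarrow>
     polytope d P \<and>
     (\<forall>\<Phi> \<Psi>. flag P \<Phi> \<longrightarrow> flag P \<Psi> \<longrightarrow> (\<exists>f\<in>carrier (Aut P). f ` \<Phi> = \<Psi>))"

section \<open>Alternating semiregular polytopes\<close>

definition semiregular_polytope :: "int \<Rightarrow> 'a ranked_order \<Rightarrow> bool" where
  "semiregular_polytope n S \<longleftrightarrow>
     polytope n S \<and>
     (\<forall>G\<in>faces_of_rank (n - 1) S. regular_polytope (n - 1) (lower_section S G)) \<and>
     (\<forall>v\<in>faces_of_rank 0 S. \<forall>w\<in>faces_of_rank 0 S. \<exists>f\<in>carrier (Aut S). f v = w)"

text \<open>In an \<open>n\<close>-polytope the facets containing an \<open>(n-3)\<close>-face \<open>F\<close> form a cycle or a two-way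
  infinite path, in which consecutive facets \<open>G\<close>, \<open>H\<close> meet in an \<open>(n-2)\<close>-face \<open>R\<close> containing \<open>F\<close>.\<close>

definition facets_alternate :: "int \<Rightarrow> 'a ranked_order \<Rightarrow> 'a set \<Rightarrow> 'a set \<Rightarrow> bool" where
  "facets_alternate n S A B \<longleftrightarrow>
     (\<forall>F\<in>faces_of_rank (n - 3) S. \<forall>R\<in>faces_of_rank (n - 2) S.
      \<forall>G\<in>faces_of_rank (n - 1) S. \<forall>H\<in>faces_of_rank (n - 1) S.
        F \<sqsubseteq>\<^bsub>S\<^esub> R \<and> R \<sqsubseteq>\<^bsub>S\<^esub> G \<and> R \<sqsubseteq>\<^bsub>S\<^esub> H \<and> G \<noteq> H \<longrightarrow>
        (G \<in> A \<and> H \<in> B) \<or> (G \<in> B \<and> H \<in> A))"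

definition facets_of_kind :: "int \<Rightarrow> 'a ranked_order \<Rightarrow> 'p ranked_order \<Rightarrow> 'a set" where
  "facets_of_kind n S P = {G \<in> faces_of_rank (n - 1) S. isomorphic (lower_section S G) P}"

definition alternating_semiregular ::
    "int \<Rightarrow> 'p ranked_order \<Rightarrow> 'q ranked_order \<Rightarrow> 'a ranked_order \<Rightarrow> bool" where
  "alternating_semiregular n P Q S \<longleftrightarrow>
     semiregular_polytope n S \<and>
     faces_of_rank (n - 1) S = facets_of_kind n S P \<union> facets_of_kind n S Q \<and>
     (if isomorphic P Q
      then \<exists>N A B. subgroup N (Aut S) \<and> card (rcosets\<^bsub>Aut S\<^esub> N) = 2 \<and>
             orbits (Aut S\<lparr>carrier := N\<rparr>) (faces_of_rank (n - 1) S) (\<lambda>f. f) = {A, B} \<and> A \<noteq> B \<and>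
             facets_alternate n S A B
      else facets_alternate n S (facets_of_kind n S P) (facets_of_kind n S Q))"

section \<open>Universality\<close>

definition covering :: "'a ranked_order \<Rightarrow> 'b ranked_order \<Rightarrow> ('a \<Rightarrow> 'b) \<Rightarrow> bool" where
  "covering U S \<phi> \<longleftrightarrow>
     \<phi> ` carrier U = carrier S \<and>
     isotone U S \<phi> \<and>
     (\<forall>x\<in>carrier U. rk S (\<phi> x) = rk U x) \<and>
     (\<forall>\<Phi> \<Psi>. adjacent_flags U \<Phi> \<Psi> \<longrightarrow> adjacent_flags S (\<phi> ` \<Phi>) (\<phi> ` \<Psi>))"

text \<open>A universal alternating semiregular polytope covers every alternating semiregular polytope
  with the same two kinds of facets. A definition cannot quantify over the type of the faces of
  \<open>S\<close>; type \<^typ>\<open>nat\<close> represents all polytopes up to isomorphism, because a polytope of finite rank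
  is countable: its flags are connected by sequences of adjacent flags, and by the diamond
  condition each flag has only finitely many adjacent flags.\<close>

definition universal_alternating_semiregular ::
    "int \<Rightarrow> 'p ranked_order \<Rightarrow> 'q ranked_order \<Rightarrow> 'a ranked_order \<Rightarrow> bool" where
  "universal_alternating_semiregular n P Q U \<longleftrightarrow>
     alternating_semiregular n P Q U \<and>
     (\<forall>S :: nat ranked_order. alternating_semiregular n P Q S \<longrightarrow> (\<exists>\<phi>. covering U S \<phi>))"

end

theory Submission
  imports Defs "HOL-Computational_Algebra.Primes" "HOL-Library.Countable_Set"
begin

text \<open>
Everything is expressed through flags. In a polytope of rank \<open>n\<close> a word over the letters
\<open>0, ..., n - 1\<close> sends a flag to the flag reached by passing to \<open>i\<close>-adjacent flags, letter by letter.
Automorphisms commute with these moves, an automorphism is determined by the image of one flag, and a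
flag can be mapped to another one as soon as the same words (the relators) return to both of them
(\<open>aut_of_relators\<close>). For a regular polytope the relators do not depend on the flag; they encode its
automorphism group.

Call a polytope tree-like if the graph of its facets, joined along common ridges, is a tree. Suppose
that its facets are regular of two alternating kinds. A word that returns to its
starting flag traces a closed path in the tree, so it must at some point cross a ridge, walk inside one
facet to a flag with the same ridge, and cross back. Within that facet the walk can be replaced by one that keeps both
the facet and the ridge; such a walk commutes with the crossing, so the two crossings cancel.
By induction, the words that return to a flag are
determined by those that do so within facets (\<open>relators_transfer\<close>). This is the normal form theorem of
the amalgamated product \<open>\<Gamma>(P) *\<^bsub>\<Gamma>(K)\<^esub> \<Gamma>(Q)\<close> in terms of flags. Consequently any two flags lying
in facets of the same kind are equivalent under automorphisms.

This gives all three parts of the claim for a tree-like polytope. There are at most two orbits of flags,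
whence finite generation. A zigzag that alternately changes ridge and facet never returns, whence
infinity. An automorphism of finite order acts on a tree with a bounded orbit, so it fixes a facet or
reverses an edge; its square fixes a facet, and on this facet it satisfies the same relations as
an element of \<open>\<Gamma>(P)\<close> or \<open>\<Gamma>(Q)\<close>. Hence its order is a power of two
(\<open>infinite_2_group_Aut\<close>).

It remains to see that the universal polytope is tree-like. A tree-like alternating semiregular polytope
is constructed by gluing copies of \<open>P\<close> and \<open>Q\<close> along the nodes of a tree (\<open>treelike_alternating_ex\<close>), and the
universal polytope covers it. A covering can only enlarge the set of relators of a facet; as the two kinds
alternate in both polytopes, the relators must in fact agree. So the covering is injective
on the ridges of every facet, a path without backtracking has an image without backtracking, and
the universal polytope is tree-like as well (\<open>treelike_covering\<close>).
\<close>

section \<open>Flags and words of adjacencies\<close>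

definition chain_in :: "'a ranked_order \<Rightarrow> 'a set \<Rightarrow> bool" where
  "chain_in T C \<longleftrightarrow> C \<subseteq> carrier T \<and> (\<forall>x\<in>C. \<forall>y\<in>C. x \<sqsubseteq>\<^bsub>T\<^esub> y \<or> y \<sqsubseteq>\<^bsub>T\<^esub> x)"

text \<open>For a flag of a polytope of rank \<open>n\<close> the description is proper exactly for \<open>-1 \<le> k \<le> n\<close>.\<close>

definition face :: "'a ranked_order \<Rightarrow> 'a set \<Rightarrow> int \<Rightarrow> 'a" where
  "face T \<Phi> k = (THE x. x \<in> \<Phi> \<and> rk T x = k)"

text \<open>The \<open>i\<close>-adjacent flag: by the diamond condition the description of the new face is proper for
\<open>0 \<le> i < n\<close>.\<close>

definition flip :: "'a ranked_order \<Rightarrow> int \<Rightarrow> 'a set \<Rightarrow> 'a set" where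
  "flip T i \<Phi> = insert
     (THE H. H \<in> carrier T \<and> rk T H = i \<and> face T \<Phi> (i - 1) \<sqsubseteq>\<^bsub>T\<^esub> H \<and> H \<sqsubseteq>\<^bsub>T\<^esub> face T \<Phi> (i + 1) \<and>
        H \<noteq> face T \<Phi> i)
     (\<Phi> - {face T \<Phi> i})"

fun walk :: "'a ranked_order \<Rightarrow> 'a set \<Rightarrow> int list \<Rightarrow> 'a set" where
  "walk T \<Phi> [] = \<Phi>"
| "walk T \<Phi> (i # w) = walk T (flip T i \<Phi>) w"

lemma walk_append [simp]: "walk T \<Phi> (u @ v) = walk T (walk T \<Phi> u) v"
  by (induction u arbitrary: \<Phi>) auto

lemma flag_iff_maximal:
  assumes "partial_order T"
  shows "flag T \<Phi> \<longleftrightarrow> chain_in T \<Phi> \<and> (\<forall>S. chain_in T S \<longrightarrow> \<Phi> \<subseteq> S \<longrightarrow> S = \<Phi>)"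
proof -
  interpret partial_order T by fact
  have chain: "pred_on.chain (carrier T) (le T) C \<longleftrightarrow> chain_in T C" for C
    unfolding pred_on.chain_def chain_in_def by blast
  show ?thesis
    unfolding flag_def pred_on.maxchain_def chain by (auto simp: psubset_eq)
qed

lemma letters_below:
  fixes w :: "int list"
  assumes "set w \<subseteq> {0..<m}" "m - 1 \<notin> set w"
  shows "set w \<subseteq> {0..<m - 1}"
proof
  fix i assume "i \<in> set w"
  then have "i \<in> {0..<m}" "i \<noteq> m - 1" using assms by auto
  then show "i \<in> {0..<m - 1}" by simp
qed

text \<open>The part of the polytope axioms that is inherited by all lower sections without further work. It suffices
for the ranks to be determined by the order, see \<open>order_iso_rk\<close>.\<close>

locale graded_poset =
  fixes n :: int and T :: "'a ranked_order" (structure)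
  assumes po: "partial_order T"
    and rk_range: "x \<in> carrier T \<Longrightarrow> -1 \<le> rk T x \<and> rk T x \<le> n"
    and rk_less: "\<lbrakk>x \<in> carrier T; y \<in> carrier T; x \<sqsubseteq> y; x \<noteq> y\<rbrakk> \<Longrightarrow> rk T x < rk T y"
    and least_ex: "\<exists>F. least T F (carrier T) \<and> rk T F = -1"
    and greatest_ex: "\<exists>F. greatest T F (carrier T) \<and> rk T F = n"
    and flag_ranks: "flag T \<Phi> \<Longrightarrow> bij_betw (rk T) \<Phi> {-1..n}"

sublocale graded_poset \<subseteq> partial_order T
  by (rule po)

context graded_poset
begin

\<comment> \<open>As an introduction rule, antisymmetry would apply to every equation between faces.\<close>
declare le_antisym [rule del]

lemma rk_le: "\<lbrakk>x \<in> carrier T; y \<in> carrier T; x \<sqsubseteq> y\<rbrakk> \<Longrightarrow> rk T x \<le> rk T y"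
  using rk_less[of x y] by (cases "x = y") auto

lemma eq_of_rk: "\<lbrakk>x \<in> carrier T; y \<in> carrier T; x \<sqsubseteq> y; rk T y \<le> rk T x\<rbrakk> \<Longrightarrow> x = y"
  using rk_less[of x y] by auto

lemma chain_inj_rk: "chain_in T C \<Longrightarrow> inj_on (rk T) C"
  unfolding chain_in_def inj_on_def
  by (metis eq_of_rk order_refl subsetD)

lemma chain_finite:
  assumes "chain_in T C"
  shows "finite C" "card C \<le> card {-1..n}"
proof -
  have im: "rk T ` C \<subseteq> {-1..n}"
    using assms rk_range unfolding chain_in_def by fastforce
  show "finite C"
    using im chain_inj_rk[OF assms] finite_imageD finite_subset by blast
  show "card C \<le> card {-1..n}"
    using card_inj_on_le[OF chain_inj_rk[OF assms] im] by simp
qed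

lemma flag_chain: "flag T \<Phi> \<Longrightarrow> chain_in T \<Phi>"
  using flag_iff_maximal[OF po] by blast

lemma flag_carrier: "flag T \<Phi> \<Longrightarrow> x \<in> \<Phi> \<Longrightarrow> x \<in> carrier T"
  using flag_chain unfolding chain_in_def by blast

lemma flag_iff: "flag T \<Phi> \<longleftrightarrow> chain_in T \<Phi> \<and> {-1..n} \<subseteq> rk T ` \<Phi>"
proof
  assume "flag T \<Phi>"
  then show "chain_in T \<Phi> \<and> {-1..n} \<subseteq> rk T ` \<Phi>"
    using flag_chain flag_ranks by (auto simp: bij_betw_def)
next
  assume *: "chain_in T \<Phi> \<and> {-1..n} \<subseteq> rk T ` \<Phi>"
  have "S = \<Phi>" if S: "chain_in T S" "\<Phi> \<subseteq> S" for S
  proof (intro equalityI subsetI)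
    fix x assume "x \<in> S"
    then have "rk T x \<in> {-1..n}" using S rk_range unfolding chain_in_def by auto
    then obtain y where "y \<in> \<Phi>" "rk T y = rk T x" using * by fastforce
    then show "x \<in> \<Phi>"
      using chain_inj_rk[OF S(1)] \<open>x \<in> S\<close> S(2) by (metis inj_onD subsetD)
  qed (use S in auto)
  then show "flag T \<Phi>" using * flag_iff_maximal[OF po] by blast
qed

text \<open>Ranks are injective on a chain, so chains have bounded size and a largest extension is a flag.\<close>

lemma chain_extends:
  assumes "chain_in T C"
  obtains \<Phi> where "flag T \<Phi>" "C \<subseteq> \<Phi>"
proof -
  obtain D where D: "chain_in T D \<and> C \<subseteq> D"
      and max: "\<And>E. chain_in T E \<and> C \<subseteq> E \<Longrightarrow> card E \<le> card D"
    using ex_has_greatest_nat[of "\<lambda>D. chain_in T D \<and> C \<subseteq> D" C card "Suc (card {-1..n})"]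
      assms chain_finite(2) by (metis less_Suc_eq_le order_refl)
  have "S = D" if "chain_in T S" "D \<subseteq> S" for S
    using card_seteq[of S D] chain_finite(1)[OF that(1)] max[of S] that D by auto
  then show ?thesis
    using that D flag_iff_maximal[OF po] by blast
qed

lemma face_ex1:
  assumes "flag T \<Phi>" "-1 \<le> k" "k \<le> n"
  shows "\<exists>!x. x \<in> \<Phi> \<and> rk T x = k"
  using flag_ranks[OF assms(1)] assms(2,3) unfolding bij_betw_def inj_on_def
  by (smt (verit) atLeastAtMost_iff imageE)

lemma face_in: "\<lbrakk>flag T \<Phi>; -1 \<le> k; k \<le> n\<rbrakk> \<Longrightarrow> face T \<Phi> k \<in> \<Phi>"
  and rk_face [simp]: "\<lbrakk>flag T \<Phi>; -1 \<le> k; k \<le> n\<rbrakk> \<Longrightarrow> rk T (face T \<Phi> k) = k"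
  using theI'[OF face_ex1] unfolding face_def by blast+

lemma face_carrier: "\<lbrakk>flag T \<Phi>; -1 \<le> k; k \<le> n\<rbrakk> \<Longrightarrow> face T \<Phi> k \<in> carrier T"
  using face_in flag_carrier by blast

lemma face_eqI: "\<lbrakk>flag T \<Phi>; x \<in> \<Phi>; rk T x = k\<rbrakk> \<Longrightarrow> face T \<Phi> k = x"
  using face_ex1[of \<Phi> k] face_in[of \<Phi> k] rk_face[of \<Phi> k] rk_range[of x] flag_carrier[of \<Phi> x]
  by blast

lemma flag_eq_faces: "flag T \<Phi> \<Longrightarrow> \<Phi> = face T \<Phi> ` {-1..n}"
proof (intro equalityI subsetI)
  fix x assume "flag T \<Phi>" "x \<in> \<Phi>"
  then have "x = face T \<Phi> (rk T x)" "rk T x \<in> {-1..n}"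
    using face_eqI[of \<Phi> x] rk_range[of x] flag_carrier[of \<Phi> x] by auto
  then show "x \<in> face T \<Phi> ` {-1..n}" by (rule image_eqI)
qed (use face_in in auto)

lemma flag_eqI:
  assumes "flag T \<Phi>" "flag T \<Psi>" "\<And>k. -1 \<le> k \<Longrightarrow> k \<le> n \<Longrightarrow> face T \<Phi> k = face T \<Psi> k"
  shows "\<Phi> = \<Psi>"
  using flag_eq_faces[OF assms(1)] flag_eq_faces[OF assms(2)] assms(3)
  by (metis (no_types, lifting) atLeastAtMost_iff image_cong)

lemma face_le:
  assumes "flag T \<Phi>" "-1 \<le> k" "k \<le> l" "l \<le> n"
  shows "face T \<Phi> k \<sqsubseteq> face T \<Phi> l"
proof -
  have in': "face T \<Phi> k \<in> \<Phi>" "face T \<Phi> l \<in> \<Phi>" using assms face_in by auto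
  then have "face T \<Phi> k \<sqsubseteq> face T \<Phi> l \<or> face T \<Phi> l \<sqsubseteq> face T \<Phi> k"
    using flag_chain[OF assms(1)] unfolding chain_in_def by blast
  then show ?thesis
    using eq_of_rk[of "face T \<Phi> l" "face T \<Phi> k"] assms in' flag_carrier[OF assms(1)] by auto
qed

lemma flag_total:
  assumes "flag T \<Phi>" "x \<in> \<Phi>" "y \<in> \<Phi>" "rk T x \<le> rk T y"
  shows "x \<sqsubseteq> y"
proof -
  have "face T \<Phi> (rk T x) = x" "face T \<Phi> (rk T y) = y"
    using face_eqI[OF assms(1)] assms by auto
  moreover have "-1 \<le> rk T x" "rk T y \<le> n"
    using rk_range flag_carrier[OF assms(1)] assms by auto
  ultimately show ?thesis using face_le[OF assms(1), of "rk T x" "rk T y"] assms(4) by simp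
qed

lemma flag_ex: "x \<in> carrier T \<Longrightarrow> \<exists>\<Phi>. flag T \<Phi> \<and> x \<in> \<Phi>"
  by (rule chain_extends[of "{x}"]) (auto simp: chain_in_def)

lemma ex_flag: obtains \<Phi> where "flag T \<Phi>"
  using greatest_ex flag_ex unfolding greatest_def by blast

lemma flag_ex2: "\<lbrakk>x \<in> carrier T; y \<in> carrier T; x \<sqsubseteq> y\<rbrakk> \<Longrightarrow> \<exists>\<Phi>. flag T \<Phi> \<and> x \<in> \<Phi> \<and> y \<in> \<Phi>"
  by (rule chain_extends[of "{x,y}"]) (auto simp: chain_in_def)

lemma rank_top: "\<lbrakk>x \<in> carrier T; rk T x = n; y \<in> carrier T\<rbrakk> \<Longrightarrow> y \<sqsubseteq> x"
proof -
  assume *: "x \<in> carrier T" "rk T x = n" "y \<in> carrier T"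
  obtain F where F: "greatest T F (carrier T)" "rk T F = n" using greatest_ex by blast
  then have "x = F" using eq_of_rk[of x F] * unfolding greatest_def by simp
  then show ?thesis using F * unfolding greatest_def by blast
qed

lemma rank_bot: "\<lbrakk>x \<in> carrier T; rk T x = -1; y \<in> carrier T\<rbrakk> \<Longrightarrow> x \<sqsubseteq> y"
proof -
  assume *: "x \<in> carrier T" "rk T x = -1" "y \<in> carrier T"
  obtain F where F: "least T F (carrier T)" "rk T F = -1" using least_ex by blast
  then have "F = x" using eq_of_rk[of F x] * unfolding least_def by simp
  then show ?thesis using F * unfolding least_def by blast
qed

lemma rank_top_unique: "\<lbrakk>x \<in> carrier T; rk T x = n; y \<in> carrier T; rk T y = n\<rbrakk> \<Longrightarrow> x = y"
  by (simp add: le_antisym rank_top)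

lemma rank_bot_unique: "\<lbrakk>x \<in> carrier T; rk T x = -1; y \<in> carrier T; rk T y = -1\<rbrakk> \<Longrightarrow> x = y"
  by (simp add: le_antisym rank_bot)

end

locale abstract_polytope = graded_poset +
  assumes connected: "strongly_flag_connected T"
    and diamond: "diamond_condition T"

lemma polytope_iff: "polytope n T \<longleftrightarrow> abstract_polytope n T"
proof
  assume p: "polytope n T"
  show "abstract_polytope n T"
    using p unfolding polytope_def
    by (intro abstract_polytope.intro graded_poset.intro abstract_polytope_axioms.intro) (auto simp: Pi_iff)
next
  assume "abstract_polytope n T"
  then interpret abstract_polytope n T .
  show "polytope n T"
    unfolding polytope_def
    using po rk_range rk_less least_ex greatest_ex flag_ranks connected diamond by auto
qed

context abstract_polytope
begin

lemma flip_face: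
  assumes "flag T \<Phi>" "0 \<le> i" "i < n"
  obtains H where "H \<in> carrier T" "rk T H = i" "face T \<Phi> (i - 1) \<sqsubseteq> H" "H \<sqsubseteq> face T \<Phi> (i + 1)"
    "H \<noteq> face T \<Phi> i" "flip T i \<Phi> = insert H (\<Phi> - {face T \<Phi> i})"
    "\<And>H'. \<lbrakk>H' \<in> carrier T; rk T H' = i; face T \<Phi> (i - 1) \<sqsubseteq> H'; H' \<sqsubseteq> face T \<Phi> (i + 1)\<rbrakk>
        \<Longrightarrow> H' = H \<or> H' = face T \<Phi> i"
proof -
  let ?S = "{H \<in> carrier T. rk T H = i \<and> face T \<Phi> (i - 1) \<sqsubseteq> H \<and> H \<sqsubseteq> face T \<Phi> (i + 1)}"
  have "card ?S = 2"
    using diamond assms face_carrier[OF assms(1)] face_le[OF assms(1), of "i-1" "i+1"]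
    unfolding diamond_condition_def by auto
  moreover have "face T \<Phi> i \<in> ?S"
    using assms face_carrier[OF assms(1)] face_le[OF assms(1)] by auto
  ultimately obtain H where H: "H \<noteq> face T \<Phi> i" "?S = {face T \<Phi> i, H}"
    unfolding card_2_iff by (metis (no_types, lifting) doubleton_eq_iff empty_iff insert_iff)
  have "(THE H. H \<in> carrier T \<and> rk T H = i \<and> face T \<Phi> (i - 1) \<sqsubseteq> H \<and> H \<sqsubseteq> face T \<Phi> (i + 1) \<and>
        H \<noteq> face T \<Phi> i) = H"
    by (rule the_equality) (use H in blast)+
  then have "flip T i \<Phi> = insert H (\<Phi> - {face T \<Phi> i})"
    by (simp add: flip_def)
  then show ?thesis using H by (intro that[of H]) blast+
qed

lemma flag_flip [simp]:
  assumes "flag T \<Phi>" "0 \<le> i" "i < n"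
  shows "flag T (flip T i \<Phi>)"
proof -
  obtain H where H: "H \<in> carrier T" "rk T H = i" "face T \<Phi> (i - 1) \<sqsubseteq> H" "H \<sqsubseteq> face T \<Phi> (i + 1)"
    "H \<noteq> face T \<Phi> i" "flip T i \<Phi> = insert H (\<Phi> - {face T \<Phi> i})"
    using flip_face[OF assms] by metis
  have comp: "x \<sqsubseteq> H \<or> H \<sqsubseteq> x" if "x \<in> \<Phi> - {face T \<Phi> i}" for x
  proof -
    have x: "x \<in> carrier T" "x \<in> \<Phi>" using that flag_carrier assms by auto
    have "rk T x \<noteq> i" using that face_eqI[OF assms(1)] by auto
    then consider "rk T x \<le> i - 1" | "i + 1 \<le> rk T x" by linarith
    then show ?thesis
    proof cases
      case 1
      then have "x \<sqsubseteq> face T \<Phi> (i - 1)"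
        using flag_total[OF assms(1) x(2) face_in[OF assms(1), of "i-1"]] assms by auto
      then show ?thesis using le_trans[OF _ H(3)] x H face_carrier[OF assms(1), of "i-1"] assms by auto
    next
      case 2
      then have "face T \<Phi> (i + 1) \<sqsubseteq> x"
        using flag_total[OF assms(1) face_in[OF assms(1), of "i+1"] x(2)] assms by auto
      then show ?thesis using le_trans[OF H(4)] x H face_carrier[OF assms(1), of "i+1"] assms by auto
    qed
  qed
  have "chain_in T (flip T i \<Phi>)"
    using flag_chain[OF assms(1)] comp H(1) le_refl[OF H(1)] unfolding chain_in_def H(6) by blast
  moreover have "{-1..n} \<subseteq> rk T ` flip T i \<Phi>"
  proof
    fix k assume k: "k \<in> {-1..n}"
    show "k \<in> rk T ` flip T i \<Phi>"
    proof (cases "k = i")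
      case False
      have *: "face T \<Phi> k \<in> \<Phi>" "rk T (face T \<Phi> k) = k" "rk T (face T \<Phi> i) = i"
        using k face_in[OF assms(1), of k] rk_face[OF assms(1)] assms by simp_all
      with False have "face T \<Phi> k \<in> flip T i \<Phi>" unfolding H(6) by auto
      then show ?thesis using *(2) by (metis imageI)
    next
      case True
      then show ?thesis using H(2) unfolding H(6) by blast
    qed
  qed
  ultimately show ?thesis using flag_iff by blast
qed

lemma face_flip [simp]:
  assumes "flag T \<Phi>" "0 \<le> i" "i < n" "-1 \<le> k" "k \<le> n" "k \<noteq> i"
  shows "face T (flip T i \<Phi>) k = face T \<Phi> k"
proof (rule face_eqI)
  have "rk T (face T \<Phi> k) = k" "rk T (face T \<Phi> i) = i" "face T \<Phi> k \<in> \<Phi>"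
    using assms face_in[OF assms(1), of k] by simp_all
  then show "face T \<Phi> k \<in> flip T i \<Phi>"
    using assms(6) unfolding flip_def by auto
qed (simp_all add: assms(1-5))

lemma face_flip_neq:
  assumes "flag T \<Phi>" "0 \<le> i" "i < n"
  shows "face T (flip T i \<Phi>) i \<noteq> face T \<Phi> i"
proof -
  obtain H where H: "rk T H = i" "H \<noteq> face T \<Phi> i" "flip T i \<Phi> = insert H (\<Phi> - {face T \<Phi> i})"
    using flip_face[OF assms] by metis
  then have "face T (flip T i \<Phi>) i = H" by (intro face_eqI[OF flag_flip[OF assms]]) auto
  then show ?thesis using H(2) by simp
qed

lemma flip_unique:
  assumes "flag T \<Phi>" "flag T \<Psi>" "0 \<le> i" "i < n" "\<Psi> \<noteq> \<Phi>"
    "\<And>k. \<lbrakk>-1 \<le> k; k \<le> n; k \<noteq> i\<rbrakk> \<Longrightarrow> face T \<Psi> k = face T \<Phi> k"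
  shows "\<Psi> = flip T i \<Phi>"
proof -
  obtain H where H: "rk T H = i" "flip T i \<Phi> = insert H (\<Phi> - {face T \<Phi> i})"
    "\<And>H'. \<lbrakk>H' \<in> carrier T; rk T H' = i; face T \<Phi> (i - 1) \<sqsubseteq> H'; H' \<sqsubseteq> face T \<Phi> (i + 1)\<rbrakk>
        \<Longrightarrow> H' = H \<or> H' = face T \<Phi> i"
    using flip_face[OF assms(1,3,4)] by metis
  have neq: "face T \<Psi> i \<noteq> face T \<Phi> i"
    using flag_eqI[OF assms(2,1)] assms(5,6) by metis
  have "face T \<Phi> (i - 1) = face T \<Psi> (i - 1)" "face T \<Phi> (i + 1) = face T \<Psi> (i + 1)"
    using assms by auto
  then have "face T \<Psi> i = H"
    using H(3)[of "face T \<Psi> i"] neq assms face_carrier[OF assms(2), of i]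
      face_le[OF assms(2), of "i-1" i] face_le[OF assms(2), of i "i+1"] by auto
  moreover have "face T (flip T i \<Phi>) i = H"
    using face_eqI[OF flag_flip[OF assms(1,3,4)], of H] H(1,2) by blast
  ultimately have "face T \<Psi> k = face T (flip T i \<Phi>) k" if "-1 \<le> k" "k \<le> n" for k
    using that assms(1,3,4,6) by (cases "k = i") simp_all
  then show ?thesis by (rule flag_eqI[OF assms(2) flag_flip[OF assms(1,3,4)]])
qed

lemma flip_flip [simp]:
  assumes "flag T \<Phi>" "0 \<le> i" "i < n"
  shows "flip T i (flip T i \<Phi>) = \<Phi>"
proof -
  have neq: "\<Phi> \<noteq> flip T i \<Phi>" using face_flip_neq[OF assms] by auto
  have eq: "face T \<Phi> k = face T (flip T i \<Phi>) k" if "-1 \<le> k" "k \<le> n" "k \<noteq> i" for k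
    using face_flip[OF assms that] by (rule HOL.sym)
  show ?thesis
    by (rule flip_unique[OF flag_flip[OF assms] assms neq eq, symmetric])
qed

text \<open>The \<open>i\<close>-face of a flip only depends on the faces of rank \<open>i - 1\<close> and \<open>i + 1\<close>, which a flip of a
non-neighbouring rank \<open>j\<close> leaves alone.\<close>

lemma flip_commute:
  assumes "flag T \<Phi>" "0 \<le> i" "i < n" "0 \<le> j" "j < n" "i + 1 < j"
  shows "flip T i (flip T j \<Phi>) = flip T j (flip T i \<Phi>)"
proof -
  obtain H where H0: "flip T i \<Phi> = insert H (\<Phi> - {face T \<Phi> i})" and H: "rk T H = i"
    "\<And>H'. \<lbrakk>H' \<in> carrier T; rk T H' = i; face T \<Phi> (i - 1) \<sqsubseteq> H'; H' \<sqsubseteq> face T \<Phi> (i + 1)\<rbrakk>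
        \<Longrightarrow> H' = H \<or> H' = face T \<Phi> i"
    using flip_face[OF assms(1,2,3)] by metis
  have f1: "flag T (flip T j \<Phi>)" and f3: "flag T (flip T i \<Phi>)"
    using flag_flip assms(1-5) by auto
  then have f2: "flag T (flip T i (flip T j \<Phi>))"
    using flag_flip assms(2,3) by auto
  have same: "face T (flip T i (flip T j \<Phi>)) k = face T \<Phi> k"
    if "-1 \<le> k" "k \<le> n" "k \<noteq> i" "k \<noteq> j" for k
    using face_flip[OF f1 assms(2,3) that(1-3)] face_flip[OF assms(1,4,5) that(1,2,4)] by simp
  have old: "face T (flip T j \<Phi>) i = face T \<Phi> i"
    using face_flip[OF assms(1,4,5)] assms by simp
  let ?F = "face T (flip T i (flip T j \<Phi>)) i"
  have "?F \<in> carrier T" "rk T ?F = i"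
    using face_carrier[OF f2] rk_face[OF f2] assms(2,3) by auto
  moreover have "face T \<Phi> (i - 1) \<sqsubseteq> ?F"
    using same[of "i - 1"] face_le[OF f2, of "i - 1" i] assms(2-6) by simp
  moreover have "?F \<sqsubseteq> face T \<Phi> (i + 1)"
    using same[of "i + 1"] face_le[OF f2, of i "i + 1"] assms(2-6) by simp
  moreover have "?F \<noteq> face T \<Phi> i"
    using face_flip_neq[OF f1 assms(2,3)] old by simp
  ultimately have "?F = H" using H(2)[of ?F] by metis
  then have fi: "?F = face T (flip T i \<Phi>) i"
    using face_eqI[OF f3 _ H(1)] H0 by simp
  show ?thesis
  proof (rule flip_unique[OF f3 f2 assms(4,5)])
    show "flip T i (flip T j \<Phi>) \<noteq> flip T i \<Phi>"
      using flip_flip[OF assms(1-3)] flip_flip[OF f1 assms(2,3)] face_flip_neq[OF assms(1,4,5)]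
      by auto
    show "face T (flip T i (flip T j \<Phi>)) k = face T (flip T i \<Phi>) k" if "-1 \<le> k" "k \<le> n" "k \<noteq> j" for k
      using that fi same[of k] face_flip[OF assms(1-3), of k] by (cases "k = i") auto
  qed
qed

lemma adjacent_flip:
  assumes "flag T \<Phi>" "0 \<le> i" "i < n"
  shows "adjacent_flags T \<Phi> (flip T i \<Phi>)"
proof -
  obtain H where H: "rk T H = i" "H \<noteq> face T \<Phi> i" "flip T i \<Phi> = insert H (\<Phi> - {face T \<Phi> i})"
    using flip_face[OF assms] by metis
  have "H \<notin> \<Phi>" using H(2) face_eqI[OF assms(1) _ H(1)] by metis
  have "face T \<Phi> i \<in> \<Phi>" using face_in assms by auto
  have "\<Phi> - flip T i \<Phi> = {face T \<Phi> i}" "flip T i \<Phi> - \<Phi> = {H}"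
    using H \<open>H \<notin> \<Phi>\<close> \<open>face T \<Phi> i \<in> \<Phi>\<close> by auto
  then show ?thesis using assms unfolding adjacent_flags_def by simp
qed

lemma adjacent_imp_flip:
  assumes "adjacent_flags T \<Phi> \<Psi>"
  obtains i where "0 \<le> i" "i < n" "\<Psi> = flip T i \<Phi>" "face T \<Phi> i \<noteq> face T \<Psi> i"
proof -
  have fl: "flag T \<Phi>" "flag T \<Psi>" using assms unfolding adjacent_flags_def by auto
  obtain F where F: "\<Phi> - \<Psi> = {F}"
    using assms unfolding adjacent_flags_def by (auto simp: card_1_singleton_iff)
  define i where "i = rk T F"
  have Fi: "F \<in> \<Phi>" "F \<notin> \<Psi>" "F \<in> carrier T" "face T \<Phi> i = F" "-1 \<le> i" "i \<le> n"
    using F flag_carrier[OF fl(1)] face_eqI[OF fl(1)] rk_range[of F] by (auto simp: i_def)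
  have neq: "face T \<Phi> i \<noteq> face T \<Psi> i" using Fi face_in[OF fl(2), of i] by metis
  have "i \<noteq> -1" "i \<noteq> n"
    using neq Fi(5,6) rank_bot_unique[of "face T \<Phi> i" "face T \<Psi> i"]
      rank_top_unique[of "face T \<Phi> i" "face T \<Psi> i"] face_carrier[OF fl(1), of i]
      face_carrier[OF fl(2), of i] rk_face[OF fl(1), of i] rk_face[OF fl(2), of i] by metis+
  then have i: "0 \<le> i" "i < n" using Fi by auto
  have "face T \<Psi> k = face T \<Phi> k" if k: "-1 \<le> k" "k \<le> n" "k \<noteq> i" for k
  proof (rule face_eqI)
    show "face T \<Phi> k \<in> \<Psi>"
    proof (rule ccontr)
      assume "face T \<Phi> k \<notin> \<Psi>"
      then have "face T \<Phi> k = F" using F face_in[OF fl(1) k(1,2)] by auto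
      then show False using rk_face[OF fl(1) k(1,2)] k(3) i_def by simp
    qed
  qed (use fl k in auto)
  then have "\<Psi> = flip T i \<Phi>" using flip_unique[OF fl i] neq by auto
  then show ?thesis using that i neq by blast
qed

lemma flag_walk [simp]: "\<lbrakk>flag T \<Phi>; set w \<subseteq> {0..<n}\<rbrakk> \<Longrightarrow> flag T (walk T \<Phi> w)"
  by (induction w arbitrary: \<Phi>) auto

lemma face_walk:
  "\<lbrakk>flag T \<Phi>; set w \<subseteq> {0..<n}; k \<notin> set w; -1 \<le> k; k \<le> n\<rbrakk> \<Longrightarrow> face T (walk T \<Phi> w) k = face T \<Phi> k"
proof (induction w arbitrary: \<Phi>)
  case (Cons i w)
  then have i: "0 \<le> i" "i < n" "k \<noteq> i" by auto
  then show ?case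
    using Cons.IH[OF flag_flip[OF Cons.prems(1) i(1,2)]] face_flip[OF Cons.prems(1) i(1,2) Cons.prems(4,5) i(3)]
      Cons.prems by simp
qed simp

lemma walk_rev:
  "\<lbrakk>flag T \<Phi>; set w \<subseteq> {0..<n}\<rbrakk> \<Longrightarrow> walk T (walk T \<Phi> w) (rev w) = \<Phi>"
proof (induction w arbitrary: \<Phi>)
  case (Cons i w)
  then have i: "0 \<le> i" "i < n" by auto
  then show ?case
    using Cons.IH[OF flag_flip[OF Cons.prems(1) i]] Cons.prems by simp
qed simp

lemma walk_inj:
  assumes "flag T \<Phi>" "flag T \<Psi>" "set w \<subseteq> {0..<n}" "walk T \<Phi> w = walk T \<Psi> w"
  shows "\<Phi> = \<Psi>"
proof -
  have "\<Phi> = walk T (walk T \<Psi> w) (rev w)" using walk_rev[OF assms(1,3)] assms(4) by simp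
  also have "\<dots> = \<Psi>" by (rule walk_rev[OF assms(2,3)])
  finally show ?thesis .
qed

text \<open>Strong flag-connectivity in terms of words: ranks at which the two flags agree need not be touched.\<close>

lemma walk_connected:
  assumes "flag T \<Phi>" "flag T \<Psi>"
  obtains w where "set w \<subseteq> {0..<n}" "walk T \<Phi> w = \<Psi>" "\<forall>i\<in>set w. face T \<Phi> i \<noteq> face T \<Psi> i"
proof -
  define S where "S = \<Phi> \<inter> \<Psi>"
  define R where "R = (\<lambda>A B. adjacent_flags T A B \<and> S \<subseteq> A \<and> S \<subseteq> B)"
  have "R\<^sup>*\<^sup>* \<Phi> \<Psi>"
    using connected assms unfolding strongly_flag_connected_def R_def S_def by blast
  then have "\<exists>w. set w \<subseteq> {0..<n} \<and> walk T \<Phi> w = \<Psi> \<and> (\<forall>x\<in>S. rk T x \<notin> set w)"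
  proof (induction rule: rtranclp_induct)
    case base
    show ?case by (intro exI[of _ "[]"]) simp
  next
    case (step A B)
    from step.IH obtain w
      where w: "set w \<subseteq> {0..<n}" "walk T \<Phi> w = A" "\<forall>x\<in>S. rk T x \<notin> set w"
      by (elim exE conjE)
    have AB: "adjacent_flags T A B" "S \<subseteq> A" "S \<subseteq> B"
      using step(2) unfolding R_def by auto
    then have fl: "flag T A" "flag T B" unfolding adjacent_flags_def by auto
    obtain i where i: "0 \<le> i" "i < n" "B = flip T i A" "face T A i \<noteq> face T B i"
      by (rule adjacent_imp_flip[OF AB(1)])
    have "rk T x \<noteq> i" if "x \<in> S" for x
    proof
      assume "rk T x = i"
      then have "face T A i = x" "face T B i = x"
        using face_eqI[OF fl(1)] face_eqI[OF fl(2)] that AB by auto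
      then show False using i(4) by simp
    qed
    then have "\<forall>x\<in>S. rk T x \<notin> set (w @ [i])" using w(3) by auto
    moreover have "set (w @ [i]) \<subseteq> {0..<n}" "walk T \<Phi> (w @ [i]) = B" using w i by auto
    ultimately show ?case by blast
  qed
  then obtain w where w: "set w \<subseteq> {0..<n}" "walk T \<Phi> w = \<Psi>" "\<forall>x\<in>S. rk T x \<notin> set w"
    by (elim exE conjE)
  have "face T \<Phi> i \<noteq> face T \<Psi> i" if "i \<in> set w" for i
  proof
    assume eq: "face T \<Phi> i = face T \<Psi> i"
    have i: "-1 \<le> i" "i \<le> n" using that w(1) by auto
    then have "face T \<Phi> i \<in> S"
      using eq face_in[OF assms(1), of i] face_in[OF assms(2), of i] by (simp add: S_def)
    then have "rk T (face T \<Phi> i) \<notin> set w" using w(3) by blast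
    then show False using that rk_face[OF assms(1) i] by simp
  qed
  then show ?thesis by (intro that[OF w(1,2)] ballI)
qed

end

section \<open>Isomorphisms and morphisms of flags\<close>

definition order_iso :: "'a ranked_order \<Rightarrow> 'b ranked_order \<Rightarrow> ('a \<Rightarrow> 'b) \<Rightarrow> bool" where
  "order_iso T T' f \<longleftrightarrow> order_emb T T' f \<and> bij_betw f (carrier T) (carrier T')"

lemma isomorphic_iff: "isomorphic T T' \<longleftrightarrow> (\<exists>f. order_iso T T' f)"
  unfolding isomorphic_def order_iso_def ..

lemma order_isoD:
  assumes "order_iso T T' f"
  shows "bij_betw f (carrier T) (carrier T')" "inj_on f (carrier T)" "f ` carrier T = carrier T'"
    "x \<in> carrier T \<Longrightarrow> f x \<in> carrier T'"
    "\<lbrakk>x \<in> carrier T; y \<in> carrier T\<rbrakk> \<Longrightarrow> f x \<sqsubseteq>\<^bsub>T'\<^esub> f y \<longleftrightarrow> x \<sqsubseteq>\<^bsub>T\<^esub> y"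
    "weak_partial_order T" "weak_partial_order T'"
  using assms unfolding order_iso_def order_emb_def bij_betw_def by auto

lemma order_iso_inv:
  assumes "order_iso T T' f"
  shows "order_iso T' T (inv_into (carrier T) f)"
proof -
  note f = order_isoD[OF assms]
  have "inv_into (carrier T) f x \<sqsubseteq>\<^bsub>T\<^esub> inv_into (carrier T) f y \<longleftrightarrow> x \<sqsubseteq>\<^bsub>T'\<^esub> y"
    if "x \<in> carrier T'" "y \<in> carrier T'" for x y
    using that f(5)[of "inv_into (carrier T) f x" "inv_into (carrier T) f y"] f(3)
    by (simp add: inv_into_into f_inv_into_f)
  then show ?thesis
    unfolding order_iso_def order_emb_def using f(6,7) bij_betw_inv_into[OF f(1)] by blast
qed

lemma order_iso_trans:
  assumes "order_iso T T' f" "order_iso T' T'' g"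
  shows "order_iso T T'' (g \<circ> f)"
  using assms order_isoD(4)[OF assms(1)] bij_betw_trans[of f "carrier T" "carrier T'" g "carrier T''"]
  unfolding order_iso_def order_emb_def by auto

lemma isomorphic_sym: "isomorphic T T' \<Longrightarrow> isomorphic T' T"
  unfolding isomorphic_iff using order_iso_inv by blast

lemma isomorphic_trans: "\<lbrakk>isomorphic T T'; isomorphic T' T''\<rbrakk> \<Longrightarrow> isomorphic T T''"
  unfolding isomorphic_iff using order_iso_trans by blast

lemma order_iso_chain: "\<lbrakk>order_iso T T' f; chain_in T C\<rbrakk> \<Longrightarrow> chain_in T' (f ` C)"
  unfolding chain_in_def using order_isoD(4,5)[of T T' f] by (auto simp: subset_iff)

lemma order_iso_flag:
  assumes iso: "order_iso T T' f" and po: "partial_order T" "partial_order T'" and "flag T \<Phi>"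
  shows "flag T' (f ` \<Phi>)"
proof -
  let ?g = "inv_into (carrier T) f"
  have \<Phi>: "chain_in T \<Phi>" and max: "\<And>S. chain_in T S \<Longrightarrow> \<Phi> \<subseteq> S \<Longrightarrow> S = \<Phi>"
    using assms(4) flag_iff_maximal[OF po(1)] by auto
  have "S = f ` \<Phi>" if S: "chain_in T' S" "f ` \<Phi> \<subseteq> S" for S
  proof -
    have "\<Phi> \<subseteq> carrier T" "S \<subseteq> carrier T'"
      using \<Phi> S unfolding chain_in_def by auto
    then have "?g ` f ` \<Phi> = \<Phi>" "f ` ?g ` S = S"
      using order_isoD(2,3)[OF iso] by (auto simp: image_image subset_iff f_inv_into_f intro!: image_cong)
    then show ?thesis
      using max[OF order_iso_chain[OF order_iso_inv[OF iso] S(1)]] S(2) by (metis image_mono)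
  qed
  then show ?thesis
    using order_iso_chain[OF iso \<Phi>] flag_iff_maximal[OF po(2)] by blast
qed

text \<open>Counts the rank of a face inside a flag and thereby makes it an invariant of the order.\<close>

lemma (in graded_poset) card_below:
  assumes "flag T \<Phi>" "x \<in> \<Phi>"
  shows "int (card {y \<in> \<Phi>. y \<sqsubseteq> x}) = rk T x + 2"
proof -
  have "bij_betw (rk T) {y \<in> \<Phi>. y \<sqsubseteq> x} {-1..rk T x}"
  proof (rule bij_betw_subset[OF flag_ranks[OF assms(1)]])
    show "rk T ` {y \<in> \<Phi>. y \<sqsubseteq> x} = {-1..rk T x}"
    proof (intro equalityI subsetI)
      fix k assume "k \<in> rk T ` {y \<in> \<Phi>. y \<sqsubseteq> x}"
      then show "k \<in> {-1..rk T x}"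
        using rk_range rk_le flag_carrier[OF assms(1)] assms(2) by fastforce
    next
      fix k assume k: "k \<in> {-1..rk T x}"
      have "rk T x \<le> n" using rk_range flag_carrier[OF assms] by blast
      then have "face T \<Phi> k \<in> \<Phi>" "rk T (face T \<Phi> k) = k" using k face_in[OF assms(1), of k] assms(1) by auto
      moreover from this have "face T \<Phi> k \<sqsubseteq> x" using flag_total[OF assms(1) _ assms(2)] k by auto
      ultimately show "k \<in> rk T ` {y \<in> \<Phi>. y \<sqsubseteq> x}" by force
    qed
  qed auto
  then have "card {y \<in> \<Phi>. y \<sqsubseteq> x} = card {-1..rk T x}" by (rule bij_betw_same_card)
  then show ?thesis using rk_range[OF flag_carrier[OF assms]] by auto
qed

lemma order_iso_rk:
  assumes iso: "order_iso T T' f" and "graded_poset n T" "graded_poset n T'" and x: "x \<in> carrier T"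
  shows "rk T' (f x) = rk T x"
proof -
  interpret T: graded_poset n T by fact
  interpret T': graded_poset n T' by fact
  obtain \<Phi> where \<Phi>: "flag T \<Phi>" "x \<in> \<Phi>" using T.flag_ex[OF x] by blast
  have fl: "flag T' (f ` \<Phi>)" by (rule order_iso_flag[OF iso T.po T'.po \<Phi>(1)])
  have "{y \<in> f ` \<Phi>. y \<sqsubseteq>\<^bsub>T'\<^esub> f x} = f ` {y \<in> \<Phi>. y \<sqsubseteq>\<^bsub>T\<^esub> x}"
    using order_isoD(5)[OF iso] T.flag_carrier[OF \<Phi>(1)] x by blast
  moreover have "inj_on f {y \<in> \<Phi>. y \<sqsubseteq>\<^bsub>T\<^esub> x}"
    using order_isoD(2)[OF iso] T.flag_carrier[OF \<Phi>(1)] by (auto intro: inj_on_subset)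
  ultimately have "card {y \<in> f ` \<Phi>. y \<sqsubseteq>\<^bsub>T'\<^esub> f x} = card {y \<in> \<Phi>. y \<sqsubseteq>\<^bsub>T\<^esub> x}"
    by (simp add: card_image)
  then show ?thesis using T.card_below[OF \<Phi>] T'.card_below[OF fl, of "f x"] \<Phi>(2) by simp
qed

text \<open>Common ground of isomorphisms and coverings: just enough to commute with walks.\<close>

locale flag_morphism = U: abstract_polytope n U + S: abstract_polytope n S
  for n :: int and U :: "'a ranked_order" and S :: "'b ranked_order" +
  fixes \<phi> :: "'a \<Rightarrow> 'b"
  assumes rk_image: "x \<in> carrier U \<Longrightarrow> rk S (\<phi> x) = rk U x"
    and flag_image: "flag U \<Phi> \<Longrightarrow> flag S (\<phi> ` \<Phi>)"
    and image_flip_neq: "\<lbrakk>flag U \<Phi>; 0 \<le> i; i < n\<rbrakk> \<Longrightarrow> \<phi> ` flip U i \<Phi> \<noteq> \<phi> ` \<Phi>"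
begin

lemma face_image:
  assumes "flag U \<Phi>" "-1 \<le> k" "k \<le> n"
  shows "face S (\<phi> ` \<Phi>) k = \<phi> (face U \<Phi> k)"
  using S.face_eqI[OF flag_image[OF assms(1)]] U.face_in[OF assms] U.face_carrier[OF assms]
    U.rk_face[OF assms] rk_image by simp

lemma image_flip:
  assumes "flag U \<Phi>" "0 \<le> i" "i < n"
  shows "\<phi> ` flip U i \<Phi> = flip S i (\<phi> ` \<Phi>)"
proof (rule S.flip_unique[OF flag_image[OF assms(1)] flag_image[OF U.flag_flip[OF assms]] assms(2,3)])
  show "\<phi> ` flip U i \<Phi> \<noteq> \<phi> ` \<Phi>" by (rule image_flip_neq[OF assms])
  show "face S (\<phi> ` flip U i \<Phi>) k = face S (\<phi> ` \<Phi>) k" if k: "-1 \<le> k" "k \<le> n" "k \<noteq> i" for k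
    using face_image[OF U.flag_flip[OF assms] k(1,2)] face_image[OF assms(1) k(1,2)]
      U.face_flip[OF assms k] by simp
qed

lemma image_walk:
  "\<lbrakk>flag U \<Phi>; set w \<subseteq> {0..<n}\<rbrakk> \<Longrightarrow> \<phi> ` walk U \<Phi> w = walk S (\<phi> ` \<Phi>) w"
proof (induction w arbitrary: \<Phi>)
  case (Cons i w)
  then have i: "0 \<le> i" "i < n" "set w \<subseteq> {0..<n}" by auto
  then show ?case
    using Cons.IH[OF U.flag_flip[OF Cons.prems(1) i(1,2)] i(3)] image_flip[OF Cons.prems(1) i(1,2)]
    by simp
qed simp

end

lemma order_iso_morphism:
  assumes iso: "order_iso T T' f" and "abstract_polytope n T" "abstract_polytope n T'"
  shows "flag_morphism n T T' f"
proof -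
  interpret T: abstract_polytope n T by fact
  interpret T': abstract_polytope n T' by fact
  have "f ` flip T i \<Phi> \<noteq> f ` \<Phi>" if "flag T \<Phi>" "0 \<le> i" "i < n" for \<Phi> i
  proof -
    have "\<Phi> \<subseteq> carrier T" "flip T i \<Phi> \<subseteq> carrier T"
      using T.flag_carrier[OF that(1)] T.flag_carrier[OF T.flag_flip[OF that]] by auto
    moreover have "flip T i \<Phi> \<noteq> \<Phi>" using T.face_flip_neq[OF that] by auto
    ultimately show ?thesis using inj_on_image_eq_iff[OF order_isoD(2)[OF iso]] by simp
  qed
  then show ?thesis
    using order_iso_rk[OF iso T.graded_poset_axioms T'.graded_poset_axioms]
      order_iso_flag[OF iso T.po T'.po]
    by unfold_locales auto
qed

text \<open>The rank is not part of the order, so \<open>T'\<close> must be given one that matches.\<close>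

lemma abstract_polytope_transport:
  assumes iso: "order_iso T T' f" and "abstract_polytope n T" and po': "partial_order T'"
    and rk: "\<And>x. x \<in> carrier T \<Longrightarrow> rk T' (f x) = rk T x"
  shows "abstract_polytope n T'"
proof -
  interpret T: abstract_polytope n T by fact
  let ?g = "inv_into (carrier T) f"
  note f = order_isoD[OF iso]
  have img: "\<exists>x'\<in>carrier T. x = f x'" if "x \<in> carrier T'" for x
    using that f(3) by auto
  have inv_flag: "\<exists>\<Phi>. flag T \<Phi> \<and> \<Phi>' = f ` \<Phi>" if "flag T' \<Phi>'" for \<Phi>'
  proof -
    have "flag T (?g ` \<Phi>')" by (rule order_iso_flag[OF order_iso_inv[OF iso] po' T.po that])
    moreover have "\<Phi>' \<subseteq> carrier T'"
      using that flag_iff_maximal[OF po'] unfolding chain_in_def by blast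
    then have "f ` ?g ` \<Phi>' = \<Phi>'"
      using f(3) by (auto simp: image_image subset_iff f_inv_into_f intro!: image_cong)
    ultimately show ?thesis by metis
  qed
  have adj: "adjacent_flags T' (f ` A) (f ` B)" if "adjacent_flags T A B" for A B
  proof -
    have fl: "flag T A" "flag T B" using that unfolding adjacent_flags_def by auto
    then have sub: "A \<subseteq> carrier T" "B \<subseteq> carrier T" using T.flag_carrier by auto
    have "f ` A - f ` B = f ` (A - B)" "f ` B - f ` A = f ` (B - A)"
      using sub inj_on_image_set_diff[OF f(2), of A B] inj_on_image_set_diff[OF f(2), of B A] by blast+
    moreover have "card (f ` (A - B)) = card (A - B)" "card (f ` (B - A)) = card (B - A)"
      using sub f(2) by (auto intro!: card_image intro: inj_on_subset)
    ultimately show ?thesis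
      using that order_iso_flag[OF iso T.po po'] fl unfolding adjacent_flags_def by simp
  qed
  show ?thesis
  proof (intro abstract_polytope.intro graded_poset.intro abstract_polytope_axioms.intro)
    show "partial_order T'" by (rule po')
    show "-1 \<le> rk T' x \<and> rk T' x \<le> n" if "x \<in> carrier T'" for x
      using img[OF that] rk T.rk_range by auto
    show "rk T' x < rk T' y" if xy: "x \<in> carrier T'" "y \<in> carrier T'" "x \<sqsubseteq>\<^bsub>T'\<^esub> y" "x \<noteq> y" for x y
    proof -
      obtain x' y' where *: "x' \<in> carrier T" "x = f x'" "y' \<in> carrier T" "y = f y'"
        using img[OF xy(1)] img[OF xy(2)] by auto
      then have "x' \<sqsubseteq>\<^bsub>T\<^esub> y'" "x' \<noteq> y'" using xy f(5) by auto
      then show ?thesis using T.rk_less[OF *(1,3)] rk * by simp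
    qed
    obtain F where F: "least T F (carrier T)" "rk T F = -1" using T.least_ex by blast
    then have "least T' (f F) (carrier T')" "rk T' (f F) = -1"
      using f(5) rk unfolding least_def f(3)[symmetric] by auto
    then show "\<exists>F. least T' F (carrier T') \<and> rk T' F = -1" by blast
    obtain G where G: "greatest T G (carrier T)" "rk T G = n" using T.greatest_ex by blast
    then have "greatest T' (f G) (carrier T')" "rk T' (f G) = n"
      using f(5) rk unfolding greatest_def f(3)[symmetric] by auto
    then show "\<exists>F. greatest T' F (carrier T') \<and> rk T' F = n" by blast
    show "bij_betw (rk T') \<Phi>' {-1..n}" if "flag T' \<Phi>'" for \<Phi>'
    proof -
      from inv_flag[OF that] obtain \<Phi> where \<Phi>: "flag T \<Phi>" "\<Phi>' = f ` \<Phi>" by blast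
      have sub: "\<Phi> \<subseteq> carrier T" using T.flag_carrier[OF \<Phi>(1)] by auto
      have "bij_betw (rk T' \<circ> f) \<Phi> {-1..n}"
        using T.flag_ranks[OF \<Phi>(1)] sub rk bij_betw_cong[of \<Phi> "rk T' \<circ> f" "rk T"] by (simp add: subset_iff)
      moreover have "bij_betw f \<Phi> \<Phi>'"
        unfolding bij_betw_def using \<Phi>(2) sub f(2) by (auto intro: inj_on_subset)
      ultimately show ?thesis using bij_betw_comp_iff by blast
    qed
    show "strongly_flag_connected T'"
      unfolding strongly_flag_connected_def
    proof (intro allI impI)
      fix \<Phi>' \<Psi>' assume "flag T' \<Phi>'" "flag T' \<Psi>'"
      then obtain \<Phi> \<Psi> where \<Phi>: "flag T \<Phi>" "\<Phi>' = f ` \<Phi>" and \<Psi>: "flag T \<Psi>" "\<Psi>' = f ` \<Psi>"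
        using inv_flag by meson
      have int: "\<Phi>' \<inter> \<Psi>' = f ` (\<Phi> \<inter> \<Psi>)"
        unfolding \<Phi>(2) \<Psi>(2)
        by (rule inj_on_image_Int[OF f(2), symmetric]) (use T.flag_carrier \<Phi> \<Psi> in auto)
      define S where "S = \<Phi> \<inter> \<Psi>"
      have "(\<lambda>A B. adjacent_flags T A B \<and> S \<subseteq> A \<and> S \<subseteq> B)\<^sup>*\<^sup>* \<Phi> \<Psi>"
        using T.connected \<Phi>(1) \<Psi>(1) unfolding strongly_flag_connected_def S_def by blast
      then have "(\<lambda>A B. adjacent_flags T' A B \<and> f ` S \<subseteq> A \<and> f ` S \<subseteq> B)\<^sup>*\<^sup>* (f ` \<Phi>) (f ` \<Psi>)"
      proof (induction rule: rtranclp_induct)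
        case (step A B)
        then have "adjacent_flags T' (f ` A) (f ` B) \<and> f ` S \<subseteq> f ` A \<and> f ` S \<subseteq> f ` B"
          using adj by (simp add: image_mono)
        with step.IH show ?case by (rule rtranclp.rtrancl_into_rtrancl)
      qed simp
      then show "(\<lambda>A B. adjacent_flags T' A B \<and> \<Phi>' \<inter> \<Psi>' \<subseteq> A \<and> \<Phi>' \<inter> \<Psi>' \<subseteq> B)\<^sup>*\<^sup>* \<Phi>' \<Psi>'"
        unfolding int S_def \<Phi>(2)[symmetric] \<Psi>(2)[symmetric] .
    qed
    show "diamond_condition T'"
      unfolding diamond_condition_def
    proof (intro ballI allI impI)
      fix F' G' j
      assume *: "F' \<in> carrier T'" "G' \<in> carrier T'" "F' \<sqsubseteq>\<^bsub>T'\<^esub> G'" "rk T' F' = j - 1" "rk T' G' = j + 1"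
      then obtain F G where F: "F \<in> carrier T" "F' = f F" and G: "G \<in> carrier T" "G' = f G"
        using img by meson
      let ?S = "{H \<in> carrier T. rk T H = j \<and> F \<sqsubseteq>\<^bsub>T\<^esub> H \<and> H \<sqsubseteq>\<^bsub>T\<^esub> G}"
      have "{H \<in> carrier T'. rk T' H = j \<and> F' \<sqsubseteq>\<^bsub>T'\<^esub> H \<and> H \<sqsubseteq>\<^bsub>T'\<^esub> G'} = f ` ?S"
        unfolding f(3)[symmetric] using F G f(5) rk by auto
      moreover have "card (f ` ?S) = card ?S"
        by (rule card_image) (use f(2) in \<open>auto intro: inj_on_subset\<close>)
      moreover have "F \<sqsubseteq>\<^bsub>T\<^esub> G" "rk T F = j - 1" "rk T G = j + 1"
        using * F G f(5) rk by auto
      then have "card ?S = 2"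
        using T.diamond F(1) G(1) unfolding diamond_condition_def by blast
      ultimately show "card {H \<in> carrier T'. rk T' H = j \<and> F' \<sqsubseteq>\<^bsub>T'\<^esub> H \<and> H \<sqsubseteq>\<^bsub>T'\<^esub> G'} = 2"
        by simp
    qed
  qed
qed

section \<open>Automorphisms\<close>

lemma aut_iso: "f \<in> carrier (Aut T) \<Longrightarrow> order_iso T T f"
  unfolding Aut_def order_iso_def Bij_def by simp

lemma iso_aut: "order_iso T T f \<Longrightarrow> restrict f (carrier T) \<in> carrier (Aut T)"
  unfolding Aut_def order_iso_def Bij_def order_emb_def by (auto cong: bij_betw_cong)

lemma aut_extensional: "f \<in> carrier (Aut T) \<Longrightarrow> f \<in> extensional (carrier T)"
  unfolding Aut_def Bij_def by simp

lemma aut_mult: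
  "\<lbrakk>f \<in> carrier (Aut T); g \<in> carrier (Aut T)\<rbrakk> \<Longrightarrow> f \<otimes>\<^bsub>Aut T\<^esub> g = compose (carrier T) f g"
  unfolding Aut_def BijGroup_def by simp

lemma aut_one: "\<one>\<^bsub>Aut T\<^esub> = (\<lambda>x\<in>carrier T. x)"
  unfolding Aut_def BijGroup_def by simp

lemma group_Aut:
  assumes "partial_order T"
  shows "group (Aut T)"
proof -
  interpret T: partial_order T by fact
  let ?S = "carrier T"
  interpret B: group "BijGroup ?S" by (rule group_BijGroup)
  have "subgroup {f \<in> Bij ?S. order_emb T T f} (BijGroup ?S)"
  proof (rule B.subgroupI)
    show "{f \<in> Bij ?S. order_emb T T f} \<noteq> {}"
      using id_Bij[of ?S] T.weak_partial_order_axioms unfolding order_emb_def by fastforce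
  next
    fix f assume "f \<in> {f \<in> Bij ?S. order_emb T T f}"
    then have f: "f \<in> Bij ?S" "order_iso T T f" unfolding order_iso_def Bij_def by auto
    have "inv\<^bsub>BijGroup ?S\<^esub> f = restrict (inv_into ?S f) ?S"
      using f(1) by (simp add: inv_BijGroup)
    then show "inv\<^bsub>BijGroup ?S\<^esub> f \<in> {f \<in> Bij ?S. order_emb T T f}"
      using iso_aut[OF order_iso_inv[OF f(2)]] unfolding Aut_def by simp
  next
    fix f g assume "f \<in> {f \<in> Bij ?S. order_emb T T f}" "g \<in> {f \<in> Bij ?S. order_emb T T f}"
    then have f: "f \<in> Bij ?S" "order_emb T T f" and g: "g \<in> Bij ?S" "order_emb T T g" by auto
    have "g x \<in> ?S" if "x \<in> ?S" for x using Bij_imp_funcset[OF g(1)] that by blast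
    then have "order_emb T T (compose ?S f g)"
      using f(2) g(2) unfolding order_emb_def compose_def by simp
    then show "f \<otimes>\<^bsub>BijGroup ?S\<^esub> g \<in> {f \<in> Bij ?S. order_emb T T f}"
      using f g compose_Bij by (simp add: BijGroup_def)
  qed (auto simp: BijGroup_def)
  then show ?thesis unfolding Aut_def by (rule subgroup.subgroup_is_group) (rule group_BijGroup)
qed

text \<open>For \<open>m = n - 1\<close> these are the relations that hold within the facet of the flag, since the letters
below \<open>n - 1\<close> do not change the facet.\<close>

definition relators :: "int \<Rightarrow> 'a ranked_order \<Rightarrow> 'a set \<Rightarrow> int list set" where
  "relators m T \<Phi> = {w. set w \<subseteq> {0..<m} \<and> walk T \<Phi> w = \<Phi>}"

lemma (in flag_morphism) relators_mono:
  "\<lbrakk>flag U \<Phi>; m \<le> n\<rbrakk> \<Longrightarrow> relators m U \<Phi> \<subseteq> relators m S (\<phi> ` \<Phi>)"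
proof
  fix w assume "flag U \<Phi>" "m \<le> n" "w \<in> relators m U \<Phi>"
  then have w: "set w \<subseteq> {0..<m}" "walk U \<Phi> w = \<Phi>" "set w \<subseteq> {0..<n}"
    unfolding relators_def by auto
  then show "w \<in> relators m S (\<phi> ` \<Phi>)"
    using image_walk[OF \<open>flag U \<Phi>\<close> w(3)] unfolding relators_def by simp
qed

lemma relators_iso:
  assumes iso: "order_iso T T' f" and T: "abstract_polytope n T" and T': "abstract_polytope n T'"
    and "flag T \<Phi>" "m \<le> n"
  shows "relators m T' (f ` \<Phi>) = relators m T \<Phi>"
proof
  interpret f: flag_morphism n T T' f by (rule order_iso_morphism[OF iso T T'])
  let ?g = "inv_into (carrier T) f"
  interpret g: flag_morphism n T' T ?g by (rule order_iso_morphism[OF order_iso_inv[OF iso] T' T])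
  show "relators m T \<Phi> \<subseteq> relators m T' (f ` \<Phi>)" by (rule f.relators_mono[OF assms(4,5)])
  have "\<Phi> \<subseteq> carrier T" using f.U.flag_carrier[OF assms(4)] by auto
  then have "?g ` f ` \<Phi> = \<Phi>"
    using order_isoD(2)[OF iso] by (auto simp: image_image subset_iff intro!: image_cong)
  then show "relators m T' (f ` \<Phi>) \<subseteq> relators m T \<Phi>"
    using g.relators_mono[OF f.flag_image[OF assms(4)] assms(5)] by simp
qed

context abstract_polytope
begin

lemma aut_morphism: "f \<in> carrier (Aut T) \<Longrightarrow> flag_morphism n T T f"
  by (rule order_iso_morphism[OF aut_iso abstract_polytope_axioms abstract_polytope_axioms])

lemma aut_flag: "\<lbrakk>f \<in> carrier (Aut T); flag T \<Phi>\<rbrakk> \<Longrightarrow> flag T (f ` \<Phi>)"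
  by (rule flag_morphism.flag_image[OF aut_morphism])

lemma aut_walk:
  "\<lbrakk>f \<in> carrier (Aut T); flag T \<Phi>; set w \<subseteq> {0..<n}\<rbrakk> \<Longrightarrow> f ` walk T \<Phi> w = walk T (f ` \<Phi>) w"
  by (rule flag_morphism.image_walk[OF aut_morphism])

lemma aut_rk: "\<lbrakk>f \<in> carrier (Aut T); x \<in> carrier T\<rbrakk> \<Longrightarrow> rk T (f x) = rk T x"
  by (rule flag_morphism.rk_image[OF aut_morphism])

lemma aut_face:
  "\<lbrakk>f \<in> carrier (Aut T); flag T \<Phi>; -1 \<le> k; k \<le> n\<rbrakk> \<Longrightarrow> face T (f ` \<Phi>) k = f (face T \<Phi> k)"
  by (rule flag_morphism.face_image[OF aut_morphism])

lemma aut_mult_image: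
  assumes "f \<in> carrier (Aut T)" "g \<in> carrier (Aut T)" "A \<subseteq> carrier T"
  shows "(f \<otimes>\<^bsub>Aut T\<^esub> g) ` A = f ` g ` A"
  unfolding aut_mult[OF assms(1,2)] using assms(3) by (force simp: compose_def image_image)

lemma aut_free:
  assumes f: "f \<in> carrier (Aut T)" and g: "g \<in> carrier (Aut T)" and \<Phi>: "flag T \<Phi>" and eq: "f ` \<Phi> = g ` \<Phi>"
  shows "f = g"
proof (rule extensionalityI[OF aut_extensional[OF f] aut_extensional[OF g]])
  fix x assume x: "x \<in> carrier T"
  obtain \<Psi> where \<Psi>: "flag T \<Psi>" "x \<in> \<Psi>" using flag_ex[OF x] by blast
  obtain w where w: "set w \<subseteq> {0..<n}" "walk T \<Phi> w = \<Psi>"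
    by (rule walk_connected[OF \<Phi> \<Psi>(1)])
  have "f ` \<Psi> = g ` \<Psi>"
    using aut_walk[OF f \<Phi> w(1)] aut_walk[OF g \<Phi> w(1)] eq w(2) by simp
  moreover have "face T (f ` \<Psi>) (rk T x) = f x" "face T (g ` \<Psi>) (rk T x) = g x"
    using face_eqI[OF aut_flag[OF f \<Psi>(1)]] face_eqI[OF aut_flag[OF g \<Psi>(1)]] \<Psi>(2)
      aut_rk[OF f x] aut_rk[OF g x] by auto
  ultimately show "f x = g x" by simp
qed

lemma walk_eq_transfer:
  assumes "flag T \<Phi>" "flag T \<Psi>" "relators n T \<Phi> \<subseteq> relators n T \<Psi>"
    and u: "set u \<subseteq> {0..<n}" and v: "set v \<subseteq> {0..<n}" and eq: "walk T \<Phi> u = walk T \<Phi> v"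
  shows "walk T \<Psi> u = walk T \<Psi> v"
proof -
  have "walk T \<Phi> (u @ rev v) = \<Phi>" using walk_rev[OF assms(1) v] eq by simp
  then have "u @ rev v \<in> relators n T \<Phi>" using u v unfolding relators_def by simp
  then have "u @ rev v \<in> relators n T \<Psi>" using assms(3) by blast
  then have "walk T (walk T \<Psi> u) (rev v) = walk T (walk T \<Psi> v) (rev v)"
    using walk_rev[OF assms(2) v] unfolding relators_def by simp
  moreover have "set (rev v) \<subseteq> {0..<n}" using v by simp
  ultimately show ?thesis
    using walk_inj[OF flag_walk[OF assms(2) u] flag_walk[OF assms(2) v]] by blast
qed

text \<open>By strong connectivity, equality of \<open>k\<close>-faces is witnessed by a word without the letter \<open>k\<close>, and hence
can be read off from the relators.\<close>

lemma same_face_transfer: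
  assumes "flag T \<Phi>" "flag T \<Psi>" "relators n T \<Phi> \<subseteq> relators n T \<Psi>"
    and u: "set u \<subseteq> {0..<n}" and v: "set v \<subseteq> {0..<n}" and k: "-1 \<le> k" "k \<le> n"
    and eq: "face T (walk T \<Phi> u) k = face T (walk T \<Phi> v) k"
  shows "face T (walk T \<Psi> u) k = face T (walk T \<Psi> v) k"
proof -
  obtain w where w: "set w \<subseteq> {0..<n}" "walk T (walk T \<Phi> u) w = walk T \<Phi> v"
      "\<forall>i\<in>set w. face T (walk T \<Phi> u) i \<noteq> face T (walk T \<Phi> v) i"
    by (rule walk_connected[OF flag_walk[OF assms(1) u] flag_walk[OF assms(1) v]])
  have "k \<notin> set w" using w(3) eq by blast
  have "walk T \<Psi> (u @ w) = walk T \<Psi> v"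
    by (rule walk_eq_transfer[OF assms(1-3) _ v]) (use u w in auto)
  then show ?thesis
    using face_walk[OF flag_walk[OF assms(2) u] w(1) \<open>k \<notin> set w\<close> k] by simp
qed

text \<open>A face \<open>x\<close> of the flag \<open>walk T \<Phi> w\<close> is sent to the face of the same rank of \<open>walk T \<Psi> w\<close>. By
\<open>same_face_transfer\<close> the choice of \<open>w\<close> does not matter, and the inclusion of relators in the other
direction yields injectivity and the converse comparison.\<close>

lemma aut_of_relators:
  assumes \<Phi>: "flag T \<Phi>" and \<Psi>: "flag T \<Psi>" and rel: "relators n T \<Phi> = relators n T \<Psi>"
  shows "\<exists>f\<in>carrier (Aut T). f ` \<Phi> = \<Psi>"
proof -
  define path where "path = (\<lambda>x. SOME w. set w \<subseteq> {0..<n} \<and> x \<in> walk T \<Phi> w)"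
  define f where "f = (\<lambda>x. face T (walk T \<Psi> (path x)) (rk T x))"
  have path: "set (path x) \<subseteq> {0..<n}" "x \<in> walk T \<Phi> (path x)" if x: "x \<in> carrier T" for x
  proof -
    obtain \<Lambda> where \<Lambda>: "flag T \<Lambda>" "x \<in> \<Lambda>" using flag_ex[OF x] by blast
    obtain w where w: "set w \<subseteq> {0..<n}" "walk T \<Phi> w = \<Lambda>"
      by (rule walk_connected[OF \<Phi> \<Lambda>(1)])
    then have "set w \<subseteq> {0..<n} \<and> x \<in> walk T \<Phi> w" using \<Lambda> by simp
    then show "set (path x) \<subseteq> {0..<n}" "x \<in> walk T \<Phi> (path x)"
      unfolding path_def by (metis (mono_tags, lifting) someI)+
  qed
  have f_eq: "f x = face T (walk T \<Psi> w) (rk T x)"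
    if w: "set w \<subseteq> {0..<n}" "x \<in> walk T \<Phi> w" for w x
  proof -
    have fl: "flag T (walk T \<Phi> w)" using \<Phi> w by simp
    then have x: "x \<in> carrier T" using flag_carrier w by blast
    have k: "-1 \<le> rk T x" "rk T x \<le> n" using rk_range[OF x] by auto
    have "face T (walk T \<Phi> (path x)) (rk T x) = x" "face T (walk T \<Phi> w) (rk T x) = x"
      using face_eqI[OF flag_walk[OF \<Phi> path(1)[OF x]] path(2)[OF x]] face_eqI[OF fl w(2)] by auto
    then show ?thesis
      unfolding f_def
      by (intro same_face_transfer[OF \<Phi> \<Psi> equalityD1[OF rel] path(1)[OF x] w(1) k]) simp
  qed
  have cov: "\<exists>w. set w \<subseteq> {0..<n} \<and> x \<in> walk T \<Lambda> w \<and> y \<in> walk T \<Lambda> w"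
    if xy: "x \<in> carrier T" "y \<in> carrier T" "x \<sqsubseteq> y" "flag T \<Lambda>" for x y \<Lambda>
  proof -
    obtain \<Theta> where \<Theta>: "flag T \<Theta>" "x \<in> \<Theta>" "y \<in> \<Theta>" using flag_ex2[OF xy(1-3)] by blast
    obtain w where w: "set w \<subseteq> {0..<n}" "walk T \<Lambda> w = \<Theta>"
      by (rule walk_connected[OF xy(4) \<Theta>(1)])
    then show ?thesis using \<Theta> by blast
  qed
  have f_rk: "rk T (f x) = rk T x" and f_in: "f x \<in> carrier T" if "x \<in> carrier T" for x
    using rk_range[OF that] rk_face[OF flag_walk[OF \<Psi> path(1)[OF that]]]
      face_carrier[OF flag_walk[OF \<Psi> path(1)[OF that]]] unfolding f_def by auto
  have mono: "f x \<sqsubseteq> f y" if xy: "x \<in> carrier T" "y \<in> carrier T" "x \<sqsubseteq> y" for x y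
  proof -
    obtain w where w: "set w \<subseteq> {0..<n}" "x \<in> walk T \<Phi> w" "y \<in> walk T \<Phi> w"
      using cov[OF xy \<Phi>] by blast
    show ?thesis
      unfolding f_eq[OF w(1,2)] f_eq[OF w(1,3)]
      using face_le[OF flag_walk[OF \<Psi> w(1)]] rk_le[OF xy] rk_range[OF xy(1)] rk_range[OF xy(2)] by simp
  qed
  have lift: "\<exists>x\<in>walk T \<Phi> w. f x = z \<and> rk T x = rk T z" if w: "set w \<subseteq> {0..<n}" "z \<in> walk T \<Psi> w" for w z
  proof -
    have z: "-1 \<le> rk T z" "rk T z \<le> n"
      using rk_range flag_carrier[OF flag_walk[OF \<Psi> w(1)] w(2)] by auto
    let ?x = "face T (walk T \<Phi> w) (rk T z)"
    have "?x \<in> walk T \<Phi> w" "rk T ?x = rk T z" using face_in[OF flag_walk[OF \<Phi> w(1)] z] \<Phi> w z by auto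
    moreover have "f ?x = z"
      unfolding f_eq[OF w(1) calculation(1)] calculation(2)
      by (rule face_eqI[OF flag_walk[OF \<Psi> w(1)] w(2) HOL.refl])
    ultimately show ?thesis by blast
  qed
  have inj: "x = y" if xy: "x \<in> carrier T" "y \<in> carrier T" "f x = f y" for x y
  proof -
    note px = path[OF xy(1)] and py = path[OF xy(2)]
    have r: "rk T y = rk T x" using f_rk xy by metis
    have k: "-1 \<le> rk T x" "rk T x \<le> n" using rk_range[OF xy(1)] by auto
    have "face T (walk T \<Psi> (path x)) (rk T x) = face T (walk T \<Psi> (path y)) (rk T x)"
      using xy(3) r unfolding f_def by simp
    then have "face T (walk T \<Phi> (path x)) (rk T x) = face T (walk T \<Phi> (path y)) (rk T x)"
      by (rule same_face_transfer[OF \<Psi> \<Phi> equalityD2[OF rel] px(1) py(1) k])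
    moreover have "face T (walk T \<Phi> (path x)) (rk T x) = x"
      by (rule face_eqI[OF flag_walk[OF \<Phi> px(1)] px(2) HOL.refl])
    moreover have "face T (walk T \<Phi> (path y)) (rk T x) = y"
      by (rule face_eqI[OF flag_walk[OF \<Phi> py(1)] py(2) r])
    ultimately show ?thesis by (simp only:)
  qed
  have emb: "f x \<sqsubseteq> f y \<longleftrightarrow> x \<sqsubseteq> y" if xy: "x \<in> carrier T" "y \<in> carrier T" for x y
  proof
    assume le: "f x \<sqsubseteq> f y"
    obtain w where w: "set w \<subseteq> {0..<n}" "f x \<in> walk T \<Psi> w" "f y \<in> walk T \<Psi> w"
      using cov[OF f_in[OF xy(1)] f_in[OF xy(2)] le \<Psi>] by (elim exE conjE)
    obtain x' where x': "x' \<in> walk T \<Phi> w" "f x' = f x" using lift[OF w(1,2)] by blast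
    obtain y' where y': "y' \<in> walk T \<Phi> w" "f y' = f y" using lift[OF w(1,3)] by blast
    have fl: "flag T (walk T \<Phi> w)" using \<Phi> w by simp
    have "x' = x" by (rule inj[OF flag_carrier[OF fl x'(1)] xy(1) x'(2)])
    moreover have "y' = y" by (rule inj[OF flag_carrier[OF fl y'(1)] xy(2) y'(2)])
    moreover have "rk T x \<le> rk T y" using rk_le[OF f_in[OF xy(1)] f_in[OF xy(2)] le] f_rk xy by simp
    ultimately show "x \<sqsubseteq> y" using flag_total[OF fl] x' y' by blast
  qed (rule mono[OF xy])
  have "bij_betw f (carrier T) (carrier T)"
    unfolding bij_betw_def
  proof
    show "inj_on f (carrier T)" by (rule inj_onI) (rule inj)
    show "f ` carrier T = carrier T"
    proof (intro equalityI subsetI)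
      fix z assume z: "z \<in> carrier T"
      then obtain w where w: "set w \<subseteq> {0..<n}" "z \<in> walk T \<Psi> w"
        using cov[OF z z _ \<Psi>] by auto
      then obtain x where "x \<in> walk T \<Phi> w" "f x = z" using lift by blast
      then show "z \<in> f ` carrier T" using flag_carrier[OF flag_walk[OF \<Phi> w(1)]] by blast
    qed (use f_in in auto)
  qed
  then have iso: "order_iso T T f"
    unfolding order_iso_def order_emb_def using emb weak_partial_order_axioms by blast
  have "f x = face T \<Psi> (rk T x)" if "x \<in> \<Phi>" for x using f_eq[of "[]" x] that by simp
  have "restrict f (carrier T) ` \<Phi> = f ` \<Phi>" using flag_carrier[OF \<Phi>] by auto
  also have "\<dots> = \<Psi>"
  proof (intro equalityI subsetI)
    fix z assume "z \<in> f ` \<Phi>"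
    then obtain x where "x \<in> \<Phi>" "z = face T \<Psi> (rk T x)" using f_eq[of "[]"] by auto
    then show "z \<in> \<Psi>" using face_in[OF \<Psi>] rk_range flag_carrier[OF \<Phi>] by auto
  next
    fix z assume "z \<in> \<Psi>"
    then show "z \<in> f ` \<Phi>" using lift[of "[]" z] by auto
  qed
  finally show ?thesis using iso_aut[OF iso] by blast
qed

end

section \<open>Facets as polytopes\<close>

lemma le_lower_section [simp]: "le (lower_section T G) = le T"
  and eq_lower_section [simp]: "eq (lower_section T G) = eq T"
  and rk_lower_section [simp]: "rk (lower_section T G) = rk T"
  unfolding lower_section_def by simp_all

context graded_poset
begin

lemma carrier_lower_section [simp]: "carrier (lower_section T G) = {x \<in> carrier T. x \<sqsubseteq> G}"
proof -
  have "least T \<bottom> (carrier T)"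
    unfolding bottom_def using least_ex by (metis someI_ex)
  then have "\<bottom> \<sqsubseteq> x" if "x \<in> carrier T" for x
    using that unfolding least_def by blast
  then show ?thesis unfolding lower_section_def at_least_at_most_def by auto
qed

lemma lower_section_po: "partial_order (lower_section T G)"
  by unfold_locales (auto simp: eq_is_equal intro: le_antisym le_trans)

lemma chain_in_lower_section:
  "chain_in (lower_section T G) C \<longleftrightarrow> chain_in T C \<and> (\<forall>x\<in>C. x \<sqsubseteq> G)"
  unfolding chain_in_def by auto

text \<open>A larger chain below \<open>G\<close> would, together with the faces of the flag above \<open>G\<close>, be a larger chain of \<open>T\<close>.\<close>

lemma flag_below_facet:
  assumes "flag T \<Phi>" "G \<in> \<Phi>"
  shows "flag (lower_section T G) {x \<in> \<Phi>. x \<sqsubseteq> G}"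
proof -
  let ?\<Psi> = "{x \<in> \<Phi>. x \<sqsubseteq> G}"
  have ch: "chain_in T \<Phi>" by (rule flag_chain[OF assms(1)])
  have "chain_in (lower_section T G) ?\<Psi>"
    using ch unfolding chain_in_lower_section chain_in_def by auto
  moreover have "S = ?\<Psi>" if S: "chain_in (lower_section T G) S" "?\<Psi> \<subseteq> S" for S
  proof -
    have S': "chain_in T S" "\<And>x. x \<in> S \<Longrightarrow> x \<sqsubseteq> G" "S \<subseteq> carrier T"
      using S(1) unfolding chain_in_lower_section unfolding chain_in_def by auto
    have G: "G \<in> carrier T" using flag_carrier[OF assms] .
    let ?E = "S \<union> {y \<in> \<Phi>. G \<sqsubseteq> y}"
    have up: "x \<sqsubseteq> y" if "x \<in> S" "y \<in> \<Phi>" "G \<sqsubseteq> y" for x y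
      using le_trans[OF S'(2)[OF that(1)] that(3)] that S'(3) G flag_carrier[OF assms(1)] by blast
    have "chain_in T ?E"
      using ch S'(1) up unfolding chain_in_def by blast
    moreover have "\<Phi> \<subseteq> ?E"
      using S(2) ch assms(2) unfolding chain_in_def by blast
    ultimately have "?E = \<Phi>" using assms(1) flag_iff_maximal[OF po] by blast
    then show ?thesis using S S'(2) by blast
  qed
  ultimately show ?thesis using flag_iff_maximal[OF lower_section_po] by blast
qed

lemma flag_of_lower_section:
  assumes "flag (lower_section T G) \<Psi>" "G \<in> carrier T"
  obtains \<Phi> where "flag T \<Phi>" "G \<in> \<Phi>" "\<Psi> = {x \<in> \<Phi>. x \<sqsubseteq> G}"
proof -
  have \<Psi>: "chain_in (lower_section T G) \<Psi>"
    and max: "\<And>S. chain_in (lower_section T G) S \<Longrightarrow> \<Psi> \<subseteq> S \<Longrightarrow> S = \<Psi>"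
    using assms(1) flag_iff_maximal[OF lower_section_po] by auto
  have "chain_in T (insert G \<Psi>)"
    using \<Psi> assms(2) unfolding chain_in_lower_section unfolding chain_in_def by auto
  then obtain \<Phi> where \<Phi>: "flag T \<Phi>" "insert G \<Psi> \<subseteq> \<Phi>" by (rule chain_extends)
  have "chain_in (lower_section T G) {x \<in> \<Phi>. x \<sqsubseteq> G}"
    using flag_below_facet[of \<Phi> G] \<Phi> flag_iff_maximal[OF lower_section_po] by blast
  moreover have "\<Psi> \<subseteq> {x \<in> \<Phi>. x \<sqsubseteq> G}"
    using \<Psi> \<Phi>(2) unfolding chain_in_lower_section by auto
  ultimately have "{x \<in> \<Phi>. x \<sqsubseteq> G} = \<Psi>" by (rule max)
  then show ?thesis using that \<Phi> by simp
qed

lemma lower_section_graded: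
  assumes G: "G \<in> carrier T"
  shows "graded_poset (rk T G) (lower_section T G)"
proof (rule graded_poset.intro)
  show "partial_order (lower_section T G)" by (rule lower_section_po)
  show "-1 \<le> rk (lower_section T G) x \<and> rk (lower_section T G) x \<le> rk T G"
    if "x \<in> carrier (lower_section T G)" for x
    using that rk_range[of x] rk_le[of x G] G by auto
  show "rk (lower_section T G) x < rk (lower_section T G) y"
    if "x \<in> carrier (lower_section T G)" "y \<in> carrier (lower_section T G)"
      "x \<sqsubseteq>\<^bsub>lower_section T G\<^esub> y" "x \<noteq> y" for x y
    using that rk_less[of x y] by auto
  obtain F where F: "least T F (carrier T)" "rk T F = -1" using least_ex by blast
  then show "\<exists>F. least (lower_section T G) F (carrier (lower_section T G)) \<and> rk (lower_section T G) F = -1"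
    using G by (intro exI[of _ F]) (auto simp: least_def)
  show "\<exists>F. greatest (lower_section T G) F (carrier (lower_section T G)) \<and> rk (lower_section T G) F = rk T G"
    using G by (intro exI[of _ G]) (auto simp: greatest_def)
  show "bij_betw (rk (lower_section T G)) \<Psi> {-1..rk T G}" if \<Psi>: "flag (lower_section T G) \<Psi>" for \<Psi>
  proof -
    obtain \<Phi> where \<Phi>: "flag T \<Phi>" "G \<in> \<Phi>" "\<Psi> = {x \<in> \<Phi>. x \<sqsubseteq> G}"
      by (rule flag_of_lower_section[OF \<Psi> G])
    have "bij_betw (rk T) \<Psi> {-1..rk T G}"
    proof (rule bij_betw_subset[OF flag_ranks[OF \<Phi>(1)]])
      show "rk T ` \<Psi> = {-1..rk T G}"
      proof (intro equalityI subsetI)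
        fix k assume "k \<in> rk T ` \<Psi>"
        then show "k \<in> {-1..rk T G}"
          using rk_range rk_le[OF _ G] flag_carrier[OF \<Phi>(1)] \<Phi>(3) by fastforce
      next
        fix k assume k: "k \<in> {-1..rk T G}"
        then have k': "-1 \<le> k" "k \<le> n" using rk_range[OF G] by auto
        have "face T \<Phi> k \<sqsubseteq> G"
          using flag_total[OF \<Phi>(1) face_in[OF \<Phi>(1) k'] \<Phi>(2)] rk_face[OF \<Phi>(1) k'] k by simp
        then have "face T \<Phi> k \<in> \<Psi>" using face_in[OF \<Phi>(1) k'] \<Phi>(3) by simp
        then show "k \<in> rk T ` \<Psi>" using rk_face[OF \<Phi>(1) k'] by (metis imageI)
      qed
    qed (use \<Phi> in auto)
    then show ?thesis by simp
  qed
qed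

end

context abstract_polytope
begin

context
  fixes G assumes G: "G \<in> carrier T" "rk T G = n - 1"
    and L: "abstract_polytope (n - 1) (lower_section T G)"
begin

interpretation L: abstract_polytope "n - 1" "lower_section T G" by (rule L)

lemma facet_in_flip:
  assumes "flag T \<Phi>" "G \<in> \<Phi>" "0 \<le> i" "i < n - 1"
  shows "G \<in> flip T i \<Phi>"
proof -
  have "face T (flip T i \<Phi>) (n - 1) = face T \<Phi> (n - 1)"
    using face_flip[OF assms(1), of i "n - 1"] assms by simp
  also have "\<dots> = G" by (rule face_eqI[OF assms(1,2) G(2)])
  finally show ?thesis using face_in[OF flag_flip[OF assms(1)], of i "n - 1"] assms by auto
qed

lemma facet_face:
  assumes \<Phi>: "flag T \<Phi>" "G \<in> \<Phi>" and k: "-1 \<le> k" "k \<le> n - 1"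
  shows "face (lower_section T G) {x \<in> \<Phi>. x \<sqsubseteq> G} k = face T \<Phi> k"
proof (rule L.face_eqI[OF flag_below_facet[OF \<Phi>]])
  have k': "-1 \<le> k" "k \<le> n" using k by auto
  show "face T \<Phi> k \<in> {x \<in> \<Phi>. x \<sqsubseteq> G}"
    using flag_total[OF \<Phi>(1) face_in[OF \<Phi>(1) k'] \<Phi>(2)] rk_face[OF \<Phi>(1) k'] face_in[OF \<Phi>(1) k'] k G by simp
  show "rk (lower_section T G) (face T \<Phi> k) = k" using rk_face[OF \<Phi>(1) k'] by simp
qed

lemma facet_flip:
  assumes \<Phi>: "flag T \<Phi>" "G \<in> \<Phi>" and i: "0 \<le> i" "i < n - 1"
  shows "{x \<in> flip T i \<Phi>. x \<sqsubseteq> G} = flip (lower_section T G) i {x \<in> \<Phi>. x \<sqsubseteq> G}"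
proof -
  have i': "0 \<le> i" "i < n" using i by auto
  note \<Phi>' = flag_flip[OF \<Phi>(1) i'] facet_in_flip[OF \<Phi> i]
  show ?thesis
  proof (rule L.flip_unique[OF flag_below_facet[OF \<Phi>] flag_below_facet[OF \<Phi>'] i])
    have "face (lower_section T G) {x \<in> flip T i \<Phi>. x \<sqsubseteq> G} i \<noteq> face (lower_section T G) {x \<in> \<Phi>. x \<sqsubseteq> G} i"
      using facet_face[OF \<Phi>', of i] facet_face[OF \<Phi>, of i] face_flip_neq[OF \<Phi>(1) i'] i by simp
    then show "{x \<in> flip T i \<Phi>. x \<sqsubseteq> G} \<noteq> {x \<in> \<Phi>. x \<sqsubseteq> G}" by metis
    show "face (lower_section T G) {x \<in> flip T i \<Phi>. x \<sqsubseteq> G} k = face (lower_section T G) {x \<in> \<Phi>. x \<sqsubseteq> G} k"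
      if k: "-1 \<le> k" "k \<le> n - 1" "k \<noteq> i" for k
      using facet_face[OF \<Phi>' k(1,2)] facet_face[OF \<Phi> k(1,2)] face_flip[OF \<Phi>(1) i' k(1) _ k(3)] k(2) by simp
  qed
qed

lemma facet_walk:
  "\<lbrakk>flag T \<Phi>; G \<in> \<Phi>; set w \<subseteq> {0..<n - 1}\<rbrakk> \<Longrightarrow>
   G \<in> walk T \<Phi> w \<and> {x \<in> walk T \<Phi> w. x \<sqsubseteq> G} = walk (lower_section T G) {x \<in> \<Phi>. x \<sqsubseteq> G} w"
proof (induction w arbitrary: \<Phi>)
  case (Cons i w)
  then have i: "0 \<le> i" "i < n - 1" "set w \<subseteq> {0..<n - 1}" by auto
  have "flag T (flip T i \<Phi>)" using flag_flip[OF Cons.prems(1), of i] i by simp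
  then show ?case
    using Cons.IH[OF _ facet_in_flip[OF Cons.prems(1,2) i(1,2)] i(3)] facet_flip[OF Cons.prems(1,2) i(1,2)]
    by simp
qed simp

text \<open>A flag of \<open>T\<close> through the facet \<open>G\<close> is a flag of \<open>G\<close> together with the greatest face, and walks that
do not use the letter \<open>n - 1\<close> take place in \<open>G\<close>.\<close>

lemma relators_facet:
  assumes \<Phi>: "flag T \<Phi>" "G \<in> \<Phi>"
  shows "relators (n - 1) (lower_section T G) {x \<in> \<Phi>. x \<sqsubseteq> G} = relators (n - 1) T \<Phi>"
proof -
  have "walk (lower_section T G) {x \<in> \<Phi>. x \<sqsubseteq> G} w = {x \<in> \<Phi>. x \<sqsubseteq> G} \<longleftrightarrow> walk T \<Phi> w = \<Phi>"
    if w: "set w \<subseteq> {0..<n - 1}" for w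
  proof
    assume eq: "walk (lower_section T G) {x \<in> \<Phi>. x \<sqsubseteq> G} w = {x \<in> \<Phi>. x \<sqsubseteq> G}"
    have fl: "flag T (walk T \<Phi> w)" using \<Phi> w by (intro flag_walk) auto
    note fw = facet_walk[OF \<Phi> w]
    show "walk T \<Phi> w = \<Phi>"
    proof (rule flag_eqI[OF fl \<Phi>(1)])
      fix k assume k: "-1 \<le> k" "k \<le> n"
      show "face T (walk T \<Phi> w) k = face T \<Phi> k"
      proof (cases "k = n")
        case True
        then show ?thesis
          using rank_top_unique[OF face_carrier[OF fl k] _ face_carrier[OF \<Phi>(1) k]] rk_face[OF fl k] rk_face[OF \<Phi>(1) k]
          by simp
      next
        case False
        then have "k \<le> n - 1" using k by simp
        then show ?thesis
          using facet_face[OF fl _ k(1)] facet_face[OF \<Phi> k(1)] fw eq by simp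
      qed
    qed
  next
    assume "walk T \<Phi> w = \<Phi>"
    then show "walk (lower_section T G) {x \<in> \<Phi>. x \<sqsubseteq> G} w = {x \<in> \<Phi>. x \<sqsubseteq> G}"
      using facet_walk[OF \<Phi> w] by simp
  qed
  then show ?thesis unfolding relators_def by blast
qed

end

end

lemma relators_regular:
  assumes "regular_polytope n T" "flag T \<Phi>" "flag T \<Psi>"
  shows "relators n T \<Phi> = relators n T \<Psi>"
proof -
  have T: "abstract_polytope n T" using assms(1) unfolding regular_polytope_def polytope_iff by simp
  obtain f where "f \<in> carrier (Aut T)" "f ` \<Phi> = \<Psi>"
    using assms unfolding regular_polytope_def by blast
  then show ?thesis using relators_iso[OF aut_iso T T assms(2), of f n] by simp
qed

lemma relators_isomorphic_regular:
  assumes "isomorphic T T'" "abstract_polytope n T" "regular_polytope n T'" "flag T \<Phi>" "flag T' \<Psi>"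
  shows "relators n T \<Phi> = relators n T' \<Psi>"
proof -
  obtain f where f: "order_iso T T' f" using assms(1) unfolding isomorphic_iff by blast
  have T': "abstract_polytope n T'" using assms(3) unfolding regular_polytope_def polytope_iff by simp
  interpret f: flag_morphism n T T' f by (rule order_iso_morphism[OF f assms(2) T'])
  show ?thesis
    using relators_iso[OF f assms(2) T' assms(4), of n]
      relators_regular[OF assms(3) f.flag_image[OF assms(4)] assms(5)] by simp
qed

text \<open>Regularity amounts to having the same relators at all flags, which is visible after an isomorphism.\<close>

lemma regular_isomorphic:
  assumes "isomorphic T T'" "abstract_polytope n T" "regular_polytope n T'"
  shows "regular_polytope n T"
proof -
  interpret T: abstract_polytope n T by fact
  interpret T': abstract_polytope n T' using assms(3) unfolding regular_polytope_def polytope_iff by simp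
  obtain \<Theta> where "flag T' \<Theta>" by (rule T'.ex_flag)
  then have rel: "relators n T \<Phi> = relators n T \<Psi>" if "flag T \<Phi>" "flag T \<Psi>" for \<Phi> \<Psi>
    using relators_isomorphic_regular[OF assms] that by blast
  show ?thesis
    unfolding regular_polytope_def polytope_iff
    using T.abstract_polytope_axioms T.aut_of_relators[OF _ _ rel] by blast
qed

section \<open>Paths of facets and tree-like polytopes\<close>

text \<open>One step in the graph of facets: from \<open>G\<close> through its ridge \<open>R\<close> to the neighbour \<open>H\<close>.\<close>

definition cross :: "int \<Rightarrow> 'a ranked_order \<Rightarrow> 'a \<Rightarrow> 'a \<Rightarrow> 'a \<Rightarrow> bool" where
  "cross n T R G H \<longleftrightarrow> R \<in> faces_of_rank (n - 2) T \<and> G \<in> faces_of_rank (n - 1) T \<and>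
     H \<in> faces_of_rank (n - 1) T \<and> R \<sqsubseteq>\<^bsub>T\<^esub> G \<and> R \<sqsubseteq>\<^bsub>T\<^esub> H \<and> G \<noteq> H"

fun ridge_path :: "int \<Rightarrow> 'a ranked_order \<Rightarrow> 'a \<Rightarrow> 'a list \<Rightarrow> 'a \<Rightarrow> bool" where
  "ridge_path n T G [] H \<longleftrightarrow> G \<in> faces_of_rank (n - 1) T \<and> H = G"
| "ridge_path n T G (R # Rs) H \<longleftrightarrow> (\<exists>M. cross n T R G M \<and> ridge_path n T M Rs H)"

lemma ridge_path_append:
  "ridge_path n T G (Rs @ Rs') H \<longleftrightarrow> (\<exists>M. ridge_path n T G Rs M \<and> ridge_path n T M Rs' H)"
proof (induction Rs arbitrary: G)
  case Nil
  have "G \<in> faces_of_rank (n - 1) T" if "ridge_path n T G Rs' H"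
    using that by (cases Rs') (auto simp: cross_def)
  then show ?case by auto
qed auto

lemma ridge_path_map:
  assumes facet: "\<And>G. G \<in> faces_of_rank (n - 1) T \<Longrightarrow> f G \<in> faces_of_rank (n - 1) T'"
    and cross: "\<And>R G H. cross n T R G H \<Longrightarrow> cross n T' (f R) (f G) (f H)"
  shows "ridge_path n T G Rs H \<Longrightarrow> ridge_path n T' (f G) (map f Rs) (f H)"
proof (induction Rs arbitrary: G)
  case (Cons R Rs)
  then obtain M where "cross n T R G M" "ridge_path n T M Rs H" by auto
  then have "cross n T' (f R) (f G) (f M)" "ridge_path n T' (f M) (map f Rs) (f H)"
    using cross Cons.IH by blast+
  then show ?case by auto
qed (use facet in auto)

lemma order_iso_faces_of_rank:
  assumes "order_iso T T' f" "abstract_polytope n T" "abstract_polytope n T'" "x \<in> faces_of_rank k T"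
  shows "f x \<in> faces_of_rank k T'"
  using assms(4) order_isoD(4)[OF assms(1)] flag_morphism.rk_image[OF order_iso_morphism[OF assms(1-3)]]
  unfolding faces_of_rank_def by simp

lemma order_iso_cross:
  assumes iso: "order_iso T T' f" "abstract_polytope n T" "abstract_polytope n T'" and c: "cross n T R G H"
  shows "cross n T' (f R) (f G) (f H)"
proof -
  have f: "R \<in> faces_of_rank (n - 2) T" "G \<in> faces_of_rank (n - 1) T" "H \<in> faces_of_rank (n - 1) T"
    using c unfolding cross_def by auto
  then have "R \<in> carrier T" "G \<in> carrier T" "H \<in> carrier T" unfolding faces_of_rank_def by auto
  then show ?thesis
    using c f order_iso_faces_of_rank[OF iso] order_isoD(5)[OF iso(1)] inj_onD[OF order_isoD(2)[OF iso(1)]]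
    unfolding cross_def by blast
qed

text \<open>A list of ridges with distinct neighbours is a path without backtracking, because the next facet is
determined by the ridge through which a facet is left.\<close>

definition treelike :: "int \<Rightarrow> 'a ranked_order \<Rightarrow> bool" where
  "treelike n T \<longleftrightarrow> (\<forall>G Rs H. ridge_path n T G Rs H \<longrightarrow> Rs \<noteq> [] \<longrightarrow> distinct_adj Rs \<longrightarrow> G \<noteq> H)"

text \<open>The ridges crossed along a walk; only the letter \<open>n - 1\<close> changes the facet.\<close>

fun ridges :: "int \<Rightarrow> 'a ranked_order \<Rightarrow> 'a set \<Rightarrow> int list \<Rightarrow> 'a list" where
  "ridges n T \<Phi> [] = []"
| "ridges n T \<Phi> (i # w) =
     (if i = n - 1 then [face T \<Phi> (n - 2)] else []) @ ridges n T (flip T i \<Phi>) w"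

context abstract_polytope
begin

lemma cross_flip:
  assumes "flag T \<Phi>" "1 \<le> n"
  shows "cross n T (face T \<Phi> (n - 2)) (face T \<Phi> (n - 1)) (face T (flip T (n - 1) \<Phi>) (n - 1))"
proof -
  have fl: "flag T (flip T (n - 1) \<Phi>)" using assms by (intro flag_flip) auto
  have r: "face T (flip T (n - 1) \<Phi>) (n - 2) = face T \<Phi> (n - 2)"
    using face_flip[OF assms(1), of "n - 1" "n - 2"] assms(2) by simp
  have b: "-1 \<le> n - 2" "n - 2 \<le> n" "-1 \<le> n - 1" "n - 1 \<le> n" using assms(2) by auto
  have "face T \<Phi> (n - 2) \<sqsubseteq> face T (flip T (n - 1) \<Phi>) (n - 1)"
    using face_le[OF fl, of "n - 2" "n - 1"] b r by simp
  moreover have "face T \<Phi> (n - 2) \<sqsubseteq> face T \<Phi> (n - 1)"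
    using face_le[OF assms(1), of "n - 2" "n - 1"] b by simp
  moreover have "face T \<Phi> (n - 1) \<noteq> face T (flip T (n - 1) \<Phi>) (n - 1)"
    using face_flip_neq[OF assms(1), of "n - 1"] b by auto
  ultimately show ?thesis
    unfolding cross_def faces_of_rank_def
    using face_carrier[OF assms(1)] face_carrier[OF fl] rk_face[OF assms(1)] rk_face[OF fl] b by simp
qed

lemma cross_unique:
  assumes "cross n T R G H" "cross n T R G H'" "1 \<le> n"
  shows "H = H'"
proof -
  have RG: "R \<in> carrier T" "rk T R = n - 2" "G \<in> carrier T" "rk T G = n - 1" "R \<sqsubseteq> G"
    using assms(1) unfolding cross_def faces_of_rank_def by auto
  obtain F where F: "greatest T F (carrier T)" "rk T F = n" using greatest_ex by blast
  then have Fc: "F \<in> carrier T" "\<And>x. x \<in> carrier T \<Longrightarrow> x \<sqsubseteq> F" unfolding greatest_def by auto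
  define S where "S = {X \<in> carrier T. rk T X = n - 1 \<and> R \<sqsubseteq> X \<and> X \<sqsubseteq> F}"
  have "card S = 2"
    using diamond RG(1,2) Fc F(2) unfolding diamond_condition_def S_def by auto
  moreover have "G \<in> S" "H \<in> S" "H' \<in> S" "G \<noteq> H" "G \<noteq> H'"
    using assms Fc unfolding cross_def faces_of_rank_def S_def by auto
  ultimately show ?thesis by (auto simp: card_2_iff)
qed

lemma ridge_path_walk:
  "\<lbrakk>flag T \<Phi>; set w \<subseteq> {0..<n}; 1 \<le> n\<rbrakk> \<Longrightarrow>
   ridge_path n T (face T \<Phi> (n - 1)) (ridges n T \<Phi> w) (face T (walk T \<Phi> w) (n - 1))"
proof (induction w arbitrary: \<Phi>)
  case Nil
  then show ?case using face_carrier[OF Nil(1), of "n - 1"] rk_face[OF Nil(1), of "n - 1"]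
    by (simp add: faces_of_rank_def)
next
  case (Cons i w)
  then have i: "0 \<le> i" "i < n" "set w \<subseteq> {0..<n}" by auto
  note IH = Cons.IH[OF flag_flip[OF Cons.prems(1) i(1,2)] i(3) Cons.prems(3)]
  show ?case
  proof (cases "i = n - 1")
    case True
    then show ?thesis using IH cross_flip[OF Cons.prems(1,3)] by auto
  next
    case False
    then have "face T (flip T i \<Phi>) (n - 1) = face T \<Phi> (n - 1)"
      using face_flip[OF Cons.prems(1) i(1,2), of "n - 1"] Cons.prems(3) by simp
    then show ?thesis using IH False by simp
  qed
qed

lemma ridges_hd:
  "\<lbrakk>flag T \<Phi>; set w \<subseteq> {0..<n}; ridges n T \<Phi> w \<noteq> []\<rbrakk> \<Longrightarrow>
   \<exists>b c. w = b @ (n - 1) # c \<and> n - 1 \<notin> set b \<and> hd (ridges n T \<Phi> w) = face T (walk T \<Phi> b) (n - 2)"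
proof (induction w arbitrary: \<Phi>)
  case (Cons i w)
  then have i: "0 \<le> i" "i < n" "set w \<subseteq> {0..<n}" by auto
  show ?case
  proof (cases "i = n - 1")
    case True
    then show ?thesis by (intro exI[of _ "[]"] exI[of _ w]) simp
  next
    case False
    then obtain b c where "w = b @ (n - 1) # c" "n - 1 \<notin> set b"
      "hd (ridges n T (flip T i \<Phi>) w) = face T (walk T (flip T i \<Phi>) b) (n - 2)"
      using Cons.IH[OF flag_flip[OF Cons.prems(1) i(1,2)] i(3)] Cons.prems(3) by auto
    then show ?thesis using False by (intro exI[of _ "i # b"] exI[of _ c]) simp
  qed
qed simp

text \<open>A repeated ridge comes from two consecutive crossings with a walk \<open>b\<close> inside a single facet between
them.\<close>

lemma backtrack:
  "\<lbrakk>flag T \<Phi>; set w \<subseteq> {0..<n}; 1 \<le> n; \<not> distinct_adj (ridges n T \<Phi> w)\<rbrakk> \<Longrightarrow>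
   \<exists>a b c. w = a @ (n - 1) # b @ (n - 1) # c \<and> n - 1 \<notin> set b \<and>
     face T (walk T \<Phi> (a @ [n - 1])) (n - 2) = face T (walk T \<Phi> (a @ (n - 1) # b)) (n - 2)"
proof (induction w arbitrary: \<Phi>)
  case (Cons i w)
  then have i: "0 \<le> i" "i < n" "set w \<subseteq> {0..<n}" by auto
  let ?\<Phi> = "flip T i \<Phi>"
  have fl: "flag T ?\<Phi>" by (rule flag_flip[OF Cons.prems(1) i(1,2)])
  show ?case
  proof (cases "distinct_adj (ridges n T ?\<Phi> w)")
    case False
    then obtain a b c where "w = a @ (n - 1) # b @ (n - 1) # c" "n - 1 \<notin> set b"
     "face T (walk T ?\<Phi> (a @ [n - 1])) (n - 2) = face T (walk T ?\<Phi> (a @ (n - 1) # b)) (n - 2)"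
      using Cons.IH[OF fl i(3) Cons.prems(3)] by blast
    then show ?thesis by (intro exI[of _ "i # a"] exI[of _ b] exI[of _ c]) simp
  next
    case True
    then have *: "i = n - 1" "ridges n T ?\<Phi> w \<noteq> []" "hd (ridges n T ?\<Phi> w) = face T \<Phi> (n - 2)"
      using Cons.prems(4) by (auto simp: distinct_adj_Cons split: if_splits)
    obtain b c where bc: "w = b @ (n - 1) # c" "n - 1 \<notin> set b"
      "hd (ridges n T ?\<Phi> w) = face T (walk T ?\<Phi> b) (n - 2)"
      using ridges_hd[OF fl i(3) *(2)] by blast
    have "face T ?\<Phi> (n - 2) = face T \<Phi> (n - 2)"
      using face_flip[OF Cons.prems(1) i(1,2), of "n - 2"] *(1) Cons.prems(3) by simp
    then show ?thesis
      using bc *(1,3) by (intro exI[of _ "[]"] exI[of _ b] exI[of _ c]) simp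
  qed
qed simp

lemma walk_commute_top:
  "\<lbrakk>flag T \<Phi>; set u \<subseteq> {0..<n - 2}; 1 \<le> n\<rbrakk> \<Longrightarrow> walk T (flip T (n - 1) \<Phi>) u = flip T (n - 1) (walk T \<Phi> u)"
proof (induction u arbitrary: \<Phi>)
  case (Cons i u)
  then have i: "0 \<le> i" "i < n" "i + 1 < n - 1" "set u \<subseteq> {0..<n - 2}" by auto
  show ?case
    using Cons.IH[OF flag_flip[OF Cons.prems(1) i(1,2)] i(4) Cons.prems(3)]
      flip_commute[OF Cons.prems(1) i(1,2) _ _ i(3)] Cons.prems(3) by simp
qed simp

end

text \<open>Two flags have the same kind if the same words return to them within their facets. That the kinds
\<open>r\<^sub>1\<close> and \<open>r\<^sub>2\<close> alternate is stated for flags; the case \<open>r\<^sub>1 = r\<^sub>2\<close> of isomorphic facets is included.\<close>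

locale tree_polytope = abstract_polytope +
  fixes r\<^sub>1 r\<^sub>2 :: "int list set"
  assumes n_ge2: "2 \<le> n"
    and facets_regular: "\<lbrakk>flag T \<Phi>; 0 \<le> i; i < n - 1\<rbrakk> \<Longrightarrow> relators (n - 1) T (flip T i \<Phi>) = relators (n - 1) T \<Phi>"
    and facets_alternating:
      "flag T \<Phi> \<Longrightarrow> {relators (n - 1) T \<Phi>, relators (n - 1) T (flip T (n - 1) \<Phi>)} = {r\<^sub>1, r\<^sub>2}"
    and tree: "treelike n T"
begin

lemma same_kind_flip:
  assumes "flag T \<Phi>" "flag T \<Psi>" "relators (n - 1) T \<Phi> = relators (n - 1) T \<Psi>" "0 \<le> i" "i < n"
  shows "relators (n - 1) T (flip T i \<Phi>) = relators (n - 1) T (flip T i \<Psi>)"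
proof (cases "i = n - 1")
  case True
  then show ?thesis
    using facets_alternating[OF assms(1)] facets_alternating[OF assms(2)] assms(3)
    by (metis doubleton_eq_iff)
next
  case False
  then have "i < n - 1" using assms by simp
  then show ?thesis
    using facets_regular[OF assms(1,4)] facets_regular[OF assms(2,4)] assms(3) by simp
qed

lemma same_kind_walk:
  "\<lbrakk>flag T \<Phi>; flag T \<Psi>; relators (n - 1) T \<Phi> = relators (n - 1) T \<Psi>; set w \<subseteq> {0..<n}\<rbrakk> \<Longrightarrow>
   relators (n - 1) T (walk T \<Phi> w) = relators (n - 1) T (walk T \<Psi> w)"
proof (induction w arbitrary: \<Phi> \<Psi>)
  case (Cons i w)
  then have i: "0 \<le> i" "i < n" "set w \<subseteq> {0..<n}" by auto
  show ?case
    using Cons.IH[OF flag_flip[OF Cons.prems(1) i(1,2)] flag_flip[OF Cons.prems(2) i(1,2)]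
      same_kind_flip[OF Cons.prems(1-3) i(1,2)] i(3)] by simp
qed simp

text \<open>Induction on the number of crossings, that is, of letters \<open>n - 1\<close>. As the facets form a tree, a word that
returns to its starting flag and crosses at least one ridge has the form \<open>a @ (n - 1) # b @ (n - 1) # c\<close>
where \<open>b\<close> stays in one facet and ends at a flag with the same ridge. There is a word \<open>u\<close> with the same effect
as \<open>b\<close> that changes neither the ridge nor the facet, and it commutes with the crossing; so the word can be
shortened to \<open>a @ u @ c\<close>. As \<open>b\<close> and \<open>u\<close> agree at all flags of the same kind, the same replacement works at \<open>\<Psi>\<close>.\<close>

lemma relators_transfer:
  "\<lbrakk>flag T \<Phi>; flag T \<Psi>; relators (n - 1) T \<Phi> = relators (n - 1) T \<Psi>; set w \<subseteq> {0..<n}; walk T \<Phi> w = \<Phi>\<rbrakk>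
   \<Longrightarrow> walk T \<Psi> w = \<Psi>"
proof (induction "count_list w (n - 1)" arbitrary: w rule: less_induct)
  case less
  note \<Phi> = less.prems(1) and \<Psi> = less.prems(2) and kind = less.prems(3) and w = less.prems(4)
  have n1: "1 \<le> n" using n_ge2 by simp
  show ?case
  proof (cases "n - 1 \<in> set w")
    case False
    then have "set w \<subseteq> {0..<n - 1}" by (rule letters_below[OF w])
    then have "w \<in> relators (n - 1) T \<Phi>" using less.prems(5) unfolding relators_def by simp
    then show ?thesis unfolding kind unfolding relators_def by simp
  next
    case True
    have "ridge_path n T (face T \<Phi> (n - 1)) (ridges n T \<Phi> w) (face T \<Phi> (n - 1))"
      using ridge_path_walk[OF \<Phi> w n1] less.prems(5) by simp
    moreover have "ridges n T \<Phi> v \<noteq> []" if "n - 1 \<in> set v" for v \<Phi>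
      using that by (induction v arbitrary: \<Phi>) auto
    ultimately have "\<not> distinct_adj (ridges n T \<Phi> w)"
      using tree True unfolding treelike_def by blast
    then obtain a b c where abc: "w = a @ (n - 1) # b @ (n - 1) # c" "n - 1 \<notin> set b"
      and ridge: "face T (walk T \<Phi> (a @ [n - 1])) (n - 2) = face T (walk T \<Phi> (a @ (n - 1) # b)) (n - 2)"
      using backtrack[OF \<Phi> w n1] by blast
    have sets: "set a \<subseteq> {0..<n}" "set b \<subseteq> {0..<n}" "set c \<subseteq> {0..<n}" "set (a @ [n - 1]) \<subseteq> {0..<n}"
      using w abc(1) n1 by auto
    have b1: "set b \<subseteq> {0..<n - 1}" by (rule letters_below[OF sets(2) abc(2)])
    define \<Lambda> where "\<Lambda> = walk T \<Phi> (a @ [n - 1])"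
    define \<Lambda>' where "\<Lambda>' = walk T \<Psi> (a @ [n - 1])"
    have fl: "flag T \<Lambda>" "flag T \<Lambda>'"
      unfolding \<Lambda>_def \<Lambda>'_def by (rule flag_walk[OF \<Phi> sets(4)], rule flag_walk[OF \<Psi> sets(4)])
    have kind': "relators (n - 1) T \<Lambda> = relators (n - 1) T \<Lambda>'"
      unfolding \<Lambda>_def \<Lambda>'_def by (rule same_kind_walk[OF \<Phi> \<Psi> kind sets(4)])
    \<comment> \<open>A walk that leaves the ridge and the facet alone, as they are the same at both ends.\<close>
    obtain u where u: "set u \<subseteq> {0..<n}" "walk T \<Lambda> u = walk T \<Lambda> b"
      "\<forall>i\<in>set u. face T \<Lambda> i \<noteq> face T (walk T \<Lambda> b) i"
      by (rule walk_connected[OF fl(1) flag_walk[OF fl(1) sets(2)]])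
    have same: "face T \<Lambda> (n - 2) = face T (walk T \<Lambda> b) (n - 2)"
      "face T \<Lambda> (n - 1) = face T (walk T \<Lambda> b) (n - 1)"
      using ridge face_walk[OF fl(1) sets(2) abc(2)] n1 unfolding \<Lambda>_def by simp_all
    have "n - 1 \<notin> set u" "n - 1 - 1 \<notin> set u" using u(3) same by auto
    then have u2: "set u \<subseteq> {0..<n - 2}" using letters_below[OF letters_below[OF u(1)]] by simp
    have ub: "walk T \<Lambda>' u = walk T \<Lambda>' b"
    proof -
      have "walk T \<Lambda> (b @ rev u) = \<Lambda>" using walk_rev[OF fl(1) u(1)] u(2) by simp
      then have "b @ rev u \<in> relators (n - 1) T \<Lambda>"
        using b1 u2 unfolding relators_def by auto
      then have "walk T (walk T \<Lambda>' b) (rev u) = walk T (walk T \<Lambda>' u) (rev u)"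
        using walk_rev[OF fl(2) u(1)] unfolding kind' unfolding relators_def by simp
      moreover have "set (rev u) \<subseteq> {0..<n}" using u(1) by simp
      ultimately show ?thesis
        using walk_inj[OF flag_walk[OF fl(2) sets(2)] flag_walk[OF fl(2) u(1)]] by metis
    qed
    \<comment> \<open>The word \<open>u\<close> commutes with the crossing, so the two crossings around \<open>b\<close> cancel.\<close>
    have shorten: "walk T \<Theta> w = walk T \<Theta> (a @ u @ c)"
      if \<Theta>: "flag T \<Theta>" "walk T (walk T \<Theta> (a @ [n - 1])) u = walk T (walk T \<Theta> (a @ [n - 1])) b" for \<Theta>
    proof -
      let ?X = "walk T \<Theta> (a @ [n - 1])"
      have X: "flag T ?X" by (rule flag_walk[OF \<Theta>(1) sets(4)])
      have "flip T (n - 1) ?X = walk T \<Theta> a"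
        using flip_flip[OF flag_walk[OF \<Theta>(1) sets(1)], of "n - 1"] n1 by simp
      moreover have "walk T \<Theta> w = walk T (flip T (n - 1) (walk T ?X u)) c"
        using \<Theta>(2) by (simp add: abc(1))
      ultimately show ?thesis using walk_commute_top[OF X u2 n1] by simp
    qed
    have "walk T \<Phi> w = walk T \<Phi> (a @ u @ c)" using shorten[OF \<Phi>] u(2) unfolding \<Lambda>_def by simp
    then have "walk T \<Phi> (a @ u @ c) = \<Phi>" using less.prems(5) by simp
    moreover have "count_list (a @ u @ c) (n - 1) < count_list w (n - 1)"
    proof -
      have "n - 1 \<notin> set u" using u2 by auto
      then have "count_list u (n - 1) = 0" by (simp add: count_list_0_iff)
      then show ?thesis by (simp add: abc(1))
    qed
    moreover have "set (a @ u @ c) \<subseteq> {0..<n}" using sets u by simp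
    ultimately have "walk T \<Psi> (a @ u @ c) = \<Psi>" using less.hyps[OF _ \<Phi> \<Psi> kind] by blast
    then show ?thesis using shorten[OF \<Psi>] ub unfolding \<Lambda>'_def by simp
  qed
qed

lemma aut_of_same_kind:
  assumes "flag T \<Phi>" "flag T \<Psi>" "relators (n - 1) T \<Phi> = relators (n - 1) T \<Psi>"
  shows "\<exists>f\<in>carrier (Aut T). f ` \<Phi> = \<Psi>"
proof (rule aut_of_relators[OF assms(1,2)])
  show "relators n T \<Phi> = relators n T \<Psi>"
    using relators_transfer[OF assms(1,2,3)] relators_transfer[OF assms(2,1) assms(3)[symmetric]]
    unfolding relators_def by blast
qed

end

section \<open>The automorphism group of a tree-like polytope\<close>

abbreviation word_power :: "int list \<Rightarrow> nat \<Rightarrow> int list" where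
  "word_power w k \<equiv> concat (replicate k w)"

lemma set_word_power: "set w \<subseteq> A \<Longrightarrow> set (word_power w k) \<subseteq> A"
  by (induction k) auto

text \<open>The property of relators that expresses that an automorphism of finite order has
order a power of two, see \<open>aut_pow_one_iff\<close>.\<close>

definition two_torsion :: "int \<Rightarrow> int list set \<Rightarrow> bool" where
  "two_torsion m r \<longleftrightarrow> (\<forall>w k. set w \<subseteq> {0..<m} \<longrightarrow> 0 < k \<longrightarrow> word_power w k \<in> r \<longrightarrow>
     (\<exists>j. word_power w (2 ^ j) \<in> r))"

context abstract_polytope
begin

interpretation A: group "Aut T" by (rule group_Aut[OF po])

lemma flag_sub: "flag T \<Phi> \<Longrightarrow> \<Phi> \<subseteq> carrier T"
  using flag_carrier by blast

lemma aut_one_image: "flag T \<Phi> \<Longrightarrow> \<one>\<^bsub>Aut T\<^esub> ` \<Phi> = \<Phi>"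
  unfolding aut_one using flag_carrier by auto

lemma aut_pow_image:
  assumes f: "f \<in> carrier (Aut T)" and \<Phi>: "flag T \<Phi>" and w: "set w \<subseteq> {0..<n}" and eq: "f ` \<Phi> = walk T \<Phi> w"
  shows "(f [^]\<^bsub>Aut T\<^esub> k) ` \<Phi> = walk T \<Phi> (word_power w k)"
proof (induction k)
  case 0
  show ?case using aut_one_image[OF \<Phi>] by simp
next
  case (Suc k)
  have "(f [^]\<^bsub>Aut T\<^esub> Suc k) ` \<Phi> = (f \<otimes>\<^bsub>Aut T\<^esub> f [^]\<^bsub>Aut T\<^esub> k) ` \<Phi>"
    using A.nat_pow_Suc2[OF f, of k] by simp
  also have "\<dots> = f ` walk T \<Phi> (word_power w k)"
    using aut_mult_image[OF f A.nat_pow_closed[OF f] flag_sub[OF \<Phi>]] Suc by simp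
  also have "\<dots> = walk T (walk T \<Phi> w) (word_power w k)"
    using aut_walk[OF f \<Phi> set_word_power[OF w]] eq by simp
  finally show ?case by simp
qed

text \<open>Orders of automorphisms become a matter of relators.\<close>

lemma aut_pow_one_iff:
  assumes f: "f \<in> carrier (Aut T)" and \<Phi>: "flag T \<Phi>" and w: "set w \<subseteq> {0..<n}" and eq: "f ` \<Phi> = walk T \<Phi> w"
  shows "f [^]\<^bsub>Aut T\<^esub> k = \<one>\<^bsub>Aut T\<^esub> \<longleftrightarrow> walk T \<Phi> (word_power w k) = \<Phi>"
  using aut_free[OF A.nat_pow_closed[OF f] A.one_closed \<Phi>, of k] aut_pow_image[OF assms, of k]
    aut_one_image[OF \<Phi>] by auto

lemma aut_pow_apply:
  assumes "f \<in> carrier (Aut T)" "x \<in> carrier T"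
  shows "(f [^]\<^bsub>Aut T\<^esub> k) x = (f ^^ k) x"
proof (induction k)
  case 0
  then show ?case using assms by (simp add: aut_one)
next
  case (Suc k)
  have "f [^]\<^bsub>Aut T\<^esub> Suc k = compose (carrier T) f (f [^]\<^bsub>Aut T\<^esub> k)"
    using A.nat_pow_Suc2[OF assms(1), of k] aut_mult[OF assms(1) A.nat_pow_closed[OF assms(1)]] by simp
  then show ?case using Suc assms(2) by (simp add: compose_def)
qed

lemma two_torsion_relators:
  assumes reg: "regular_polytope n T" and grp: "finite_2_group (Aut T) \<or> infinite_2_group (Aut T)" and \<Phi>: "flag T \<Phi>"
  shows "two_torsion n (relators n T \<Phi>)"
  unfolding two_torsion_def
proof (intro allI impI)
  fix w k assume w: "set w \<subseteq> {0..<n}" and k: "0 < (k::nat)" and rel: "word_power w k \<in> relators n T \<Phi>"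
  obtain f where f: "f \<in> carrier (Aut T)" "f ` \<Phi> = walk T \<Phi> w"
    using reg \<Phi> flag_walk[OF \<Phi> w] unfolding regular_polytope_def by blast
  note one = aut_pow_one_iff[OF f(1) \<Phi> w f(2)]
  have "f [^]\<^bsub>Aut T\<^esub> k = \<one>\<^bsub>Aut T\<^esub>" using one rel unfolding relators_def by simp
  then have nz: "A.ord f \<noteq> 0" using A.pow_eq_id[OF f(1)] k by auto
  have "\<exists>j. A.ord f = 2 ^ j"
    using grp
  proof
    assume "finite_2_group (Aut T)"
    then obtain l where "order (Aut T) = 2 ^ l" unfolding finite_2_group_def by blast
    then have "A.ord f dvd 2 ^ l" using A.ord_dvd_group_order[OF f(1)] by simp
    then show ?thesis using divides_primepow_nat[of 2 "A.ord f" l] two_is_prime_nat by blast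
  next
    assume "infinite_2_group (Aut T)"
    then show ?thesis using f(1) nz unfolding infinite_2_group_def by blast
  qed
  then obtain j where "A.ord f = 2 ^ j" by blast
  then have "f [^]\<^bsub>Aut T\<^esub> (2 ^ j :: nat) = \<one>\<^bsub>Aut T\<^esub>" using A.pow_ord_eq_1[OF f(1)] by simp
  then have "walk T \<Phi> (word_power w (2 ^ j)) = \<Phi>" using one by simp
  then show "\<exists>j. word_power w (2 ^ j) \<in> relators n T \<Phi>"
    unfolding relators_def using set_word_power[OF w] by blast
qed

lemma cross_sym: "cross n T R G H \<Longrightarrow> cross n T R H G"
  unfolding cross_def by auto

lemma ridge_path_carrier: "ridge_path n T G Rs H \<Longrightarrow> set Rs \<subseteq> carrier T \<and> G \<in> faces_of_rank (n - 1) T"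
  by (induction Rs arbitrary: G) (auto simp: cross_def faces_of_rank_def)

lemma aut_cross: "f \<in> carrier (Aut T) \<Longrightarrow> cross n T R G H \<Longrightarrow> cross n T (f R) (f G) (f H)"
  by (rule order_iso_cross[OF aut_iso abstract_polytope_axioms abstract_polytope_axioms])

lemma aut_faces_of_rank: "f \<in> carrier (Aut T) \<Longrightarrow> x \<in> faces_of_rank k T \<Longrightarrow> f x \<in> faces_of_rank k T"
  by (rule order_iso_faces_of_rank[OF aut_iso abstract_polytope_axioms abstract_polytope_axioms])

lemma aut_ridge_path:
  "f \<in> carrier (Aut T) \<Longrightarrow> ridge_path n T G Rs H \<Longrightarrow> ridge_path n T (f G) (map f Rs) (f H)"
  by (rule ridge_path_map[OF aut_faces_of_rank aut_cross])

text \<open>The path from \<open>G\<close> over \<open>f G\<close>, \<open>f (f G)\<close>, ... that follows the images of a given path from \<open>G\<close>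
to \<open>f G\<close>.\<close>

fun orbit_path :: "('a \<Rightarrow> 'a) \<Rightarrow> 'a list \<Rightarrow> nat \<Rightarrow> 'a list" where
  "orbit_path f Rs 0 = []"
| "orbit_path f Rs (Suc m) = Rs @ map f (orbit_path f Rs m)"

lemma orbit_path_ridge_path:
  assumes f: "f \<in> carrier (Aut T)" and "ridge_path n T G Rs (f G)"
  shows "ridge_path n T G (orbit_path f Rs m) ((f ^^ m) G)"
proof (induction m)
  case 0
  then show ?case using ridge_path_carrier[OF assms(2)] by simp
next
  case (Suc m)
  then show ?case using assms(2) aut_ridge_path[OF f Suc] by (auto simp: ridge_path_append)
qed

lemma orbit_path_distinct_adj:
  assumes f: "f \<in> carrier (Aut T)" and Rs: "distinct_adj Rs" "Rs \<noteq> []" "last Rs \<noteq> f (hd Rs)" "set Rs \<subseteq> carrier T"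
  shows "distinct_adj (orbit_path f Rs m)"
proof (induction m)
  case (Suc m)
  have "set (orbit_path f Rs m) \<subseteq> carrier T"
    using Rs(4) order_isoD(4)[OF aut_iso[OF f]] by (induction m) auto
  then have "distinct_adj (map f (orbit_path f Rs m))"
    using Suc order_isoD(2)[OF aut_iso[OF f]] by (auto intro!: distinct_adj_mapI intro: inj_on_subset)
  moreover have "hd (map f (orbit_path f Rs m)) = f (hd Rs)" if "orbit_path f Rs m \<noteq> []"
    using that Rs(2) by (cases m) (auto simp: hd_map)
  ultimately show ?case using Rs by (auto simp: distinct_adj_append_iff)
qed simp

lemma ridge_path_ex:
  assumes "G \<in> faces_of_rank (n - 1) T" "H \<in> faces_of_rank (n - 1) T" "1 \<le> n"
  obtains Rs where "ridge_path n T G Rs H"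
proof -
  have c: "G \<in> carrier T" "H \<in> carrier T" "rk T G = n - 1" "rk T H = n - 1"
    using assms unfolding faces_of_rank_def by auto
  obtain \<Phi> where \<Phi>: "flag T \<Phi>" "G \<in> \<Phi>" using flag_ex[OF c(1)] by blast
  obtain \<Psi> where \<Psi>: "flag T \<Psi>" "H \<in> \<Psi>" using flag_ex[OF c(2)] by blast
  obtain w where w: "set w \<subseteq> {0..<n}" "walk T \<Phi> w = \<Psi>" by (rule walk_connected[OF \<Phi>(1) \<Psi>(1)])
  show ?thesis
    using that ridge_path_walk[OF \<Phi>(1) w(1) assms(3)] face_eqI[OF \<Phi> c(3)] face_eqI[OF \<Psi> c(4)] w(2) by simp
qed

end

lemma not_distinct_adj_split: "\<not> distinct_adj xs \<Longrightarrow> \<exists>a x b. xs = a @ x # x # b"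
proof (induction xs)
  case (Cons y ys)
  show ?case
  proof (cases "distinct_adj ys")
    case True
    then have "ys \<noteq> []" "hd ys = y" using Cons.prems by (auto simp: distinct_adj_Cons)
    then obtain zs where "ys = y # zs" by (cases ys) auto
    then have "y # ys = [] @ y # y # zs" by simp
    then show ?thesis by (intro exI)
  next
    case False
    then have "\<exists>a x b. ys = a @ x # x # b" by (rule Cons.IH)
    then obtain a x b where "ys = a @ x # x # b" by (elim exE)
    then have "y # ys = (y # a) @ x # x # b" by (simp only: append_Cons)
    then show ?thesis by (intro exI)
  qed
qed simp

context tree_polytope
begin

interpretation A: group "Aut T" by (rule group_Aut[OF po])

lemma n_ge1: "1 \<le> n"
  using n_ge2 by simp

lemma facet_ex: "\<exists>G. G \<in> faces_of_rank (n - 1) T"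
proof -
  obtain \<Phi> where "flag T \<Phi>" by (rule ex_flag)
  then show ?thesis using face_carrier[of \<Phi> "n - 1"] rk_face[of \<Phi> "n - 1"] n_ge1
    unfolding faces_of_rank_def by auto
qed

text \<open>Choose a facet \<open>G\<close> for which the path from \<open>G\<close> to \<open>f G\<close> is shortest. Following it and its images under
\<open>f\<close> leads back to \<open>G\<close>, so in the tree there must be backtracking, and by minimality it occurs where two
copies of a non-trivial path meet: the last ridge of the path is the image of the first one. Then both can
be dropped and \<open>f\<close> moves the next facet less than \<open>G\<close>, unless the path consists of a single ridge, in which case \<open>f\<close>
exchanges its two facets.\<close>

lemma finite_order_fixes_facet:
  assumes f: "f \<in> carrier (Aut T)" and m: "f [^]\<^bsub>Aut T\<^esub> (m :: nat) = \<one>\<^bsub>Aut T\<^esub>" "0 < m"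
  shows "\<exists>G\<in>faces_of_rank (n - 1) T. f (f G) = G"
proof -
  define Q where "Q = (\<lambda>l. \<exists>G Rs. ridge_path n T G Rs (f G) \<and> length Rs = l)"
  obtain G0 where G0: "G0 \<in> faces_of_rank (n - 1) T" using facet_ex by blast
  then have "f G0 \<in> faces_of_rank (n - 1) T" by (rule aut_faces_of_rank[OF f])
  then obtain Rs0 where "ridge_path n T G0 Rs0 (f G0)" by (rule ridge_path_ex[OF G0 _ n_ge1])
  then have "\<exists>l. Q l" unfolding Q_def by blast
  then have "Q (LEAST l. Q l)" by (rule LeastI_ex)
  then obtain G Rs where path: "ridge_path n T G Rs (f G)" and len: "length Rs = (LEAST l. Q l)"
    unfolding Q_def by blast
  have min: "length Rs \<le> length Rs'" if "ridge_path n T H Rs' (f H)" for H Rs'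
    unfolding len by (rule Least_le) (use that in \<open>auto simp: Q_def\<close>)
  have G: "G \<in> faces_of_rank (n - 1) T" "set Rs \<subseteq> carrier T" using ridge_path_carrier[OF path] by auto
  have dist: "distinct_adj Rs"
  proof (rule ccontr)
    assume "\<not> distinct_adj Rs"
    then obtain a R b where ab: "Rs = a @ R # R # b" using not_distinct_adj_split by blast
    then obtain M M' M'' where p: "ridge_path n T G a M" "cross n T R M M'" "cross n T R M' M''" "ridge_path n T M'' b (f G)"
      using path by (auto simp: ridge_path_append)
    have "M'' = M" using cross_unique[OF p(3) cross_sym[OF p(2)] n_ge1] .
    then have "ridge_path n T G (a @ b) (f G)" using p by (auto simp: ridge_path_append)
    from min[OF this] show False using ab by simp
  qed
  show ?thesis
  proof (cases "Rs = []")
    case True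
    then have "f (f G) = G" using path by simp
    then show ?thesis using G(1) by blast
  next
    case False
    have "last Rs = f (hd Rs)"
    proof (rule ccontr)
      assume neq: "last Rs \<noteq> f (hd Rs)"
      have "(f ^^ m) G = G"
        using aut_pow_apply[OF f, of G m] m(1) G(1) by (simp add: aut_one faces_of_rank_def)
      then have "ridge_path n T G (orbit_path f Rs m) G" using orbit_path_ridge_path[OF f path, of m] by simp
      moreover have "orbit_path f Rs m \<noteq> []" using m(2) False by (cases m) auto
      ultimately show False
        using tree orbit_path_distinct_adj[OF f dist False neq G(2)] unfolding treelike_def by blast
    qed
    show ?thesis
    proof (cases "tl Rs = []")
      case True
      then obtain R where R: "Rs = [R]" using False by (cases Rs) auto
      then have fR: "f R = R" using \<open>last Rs = f (hd Rs)\<close> by simp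
      have c: "cross n T R G (f G)" using path R by auto
      have "f (f G) = G"
        using cross_unique[OF _ cross_sym[OF c] n_ge1] aut_cross[OF f c] fR by simp
      then show ?thesis using G(1) by blast
    next
      case False
      then obtain R Rs' where R: "Rs = R # Rs' @ [f R]"
        using \<open>last Rs = f (hd Rs)\<close> by (metis append_butlast_last_id hd_Cons_tl last_tl list.sel(2))
      then obtain G1 M where p: "cross n T R G G1" "ridge_path n T G1 Rs' M" "cross n T (f R) M (f G)"
        using path by (auto simp: ridge_path_append)
      \<comment> \<open>The facets before the last ridge \<open>f R\<close> and after the first ridge \<open>R\<close> correspond under \<open>f\<close>.\<close>
      have "M = f G1"
        using cross_unique[OF cross_sym[OF p(3)] aut_cross[OF f p(1)] n_ge1] .
      then have "length Rs \<le> length Rs'" using min p(2) by blast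
      then show ?thesis using R by simp
    qed
  qed
qed

lemma relators_cases: "flag T \<Phi> \<Longrightarrow> relators (n - 1) T \<Phi> = r\<^sub>1 \<or> relators (n - 1) T \<Phi> = r\<^sub>2"
  using facets_alternating by blast

text \<open>The square of \<open>f\<close> fixes a facet \<open>G\<close>, so it acts on a flag through \<open>G\<close> like a word within \<open>G\<close>, and
its order is controlled by the relators of \<open>G\<close>.\<close>

lemma torsion_two_power:
  assumes r: "two_torsion (n - 1) r\<^sub>1" "two_torsion (n - 1) r\<^sub>2"
    and f: "f \<in> carrier (Aut T)" and fin: "A.ord f \<noteq> 0"
  shows "\<exists>k. A.ord f = 2 ^ k"
proof -
  let ?m = "A.ord f"
  let ?h = "f [^]\<^bsub>Aut T\<^esub> (2::nat)"
  have m: "f [^]\<^bsub>Aut T\<^esub> ?m = \<one>\<^bsub>Aut T\<^esub>" by (rule A.pow_ord_eq_1[OF f])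
  have h: "?h \<in> carrier (Aut T)" using f by simp
  obtain G where G: "G \<in> faces_of_rank (n - 1) T" "f (f G) = G"
    using finite_order_fixes_facet[OF f m] fin by auto
  then have Gc: "G \<in> carrier T" "rk T G = n - 1" unfolding faces_of_rank_def by auto
  have hG: "?h G = G" using aut_pow_apply[OF f Gc(1), of 2] G(2) by (simp add: eval_nat_numeral)
  obtain \<Phi> where \<Phi>: "flag T \<Phi>" "G \<in> \<Phi>" using flag_ex[OF Gc(1)] by blast
  have fl: "flag T (?h ` \<Phi>)" by (rule aut_flag[OF h \<Phi>(1)])
  obtain w where w: "set w \<subseteq> {0..<n}" "walk T \<Phi> w = ?h ` \<Phi>" "\<forall>i\<in>set w. face T \<Phi> i \<noteq> face T (?h ` \<Phi>) i"
    by (rule walk_connected[OF \<Phi>(1) fl])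
  have "face T (?h ` \<Phi>) (n - 1) = face T \<Phi> (n - 1)"
    using aut_face[OF h \<Phi>(1), of "n - 1"] face_eqI[OF \<Phi> Gc(2)] hG n_ge1 by simp
  then have "n - 1 \<notin> set w" using w(3) by metis
  then have w1: "set w \<subseteq> {0..<n - 1}" by (rule letters_below[OF w(1)])
  note one = aut_pow_one_iff[OF h \<Phi>(1) w(1) w(2)[symmetric]]
  have "?h [^]\<^bsub>Aut T\<^esub> ?m = (f [^]\<^bsub>Aut T\<^esub> ?m) [^]\<^bsub>Aut T\<^esub> (2::nat)"
    using A.nat_pow_pow[OF f] by (simp add: mult.commute)
  then have "?h [^]\<^bsub>Aut T\<^esub> ?m = \<one>\<^bsub>Aut T\<^esub>" using m by simp
  then have "word_power w ?m \<in> relators (n - 1) T \<Phi>"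
    using one set_word_power[OF w1] unfolding relators_def by blast
  moreover have "two_torsion (n - 1) (relators (n - 1) T \<Phi>)" using relators_cases[OF \<Phi>(1)] r by metis
  moreover have "0 < ?m" using fin by simp
  ultimately obtain j where "word_power w (2 ^ j) \<in> relators (n - 1) T \<Phi>"
    using w1 unfolding two_torsion_def by blast
  then have "?h [^]\<^bsub>Aut T\<^esub> (2 ^ j :: nat) = \<one>\<^bsub>Aut T\<^esub>" using one unfolding relators_def by blast
  then have "f [^]\<^bsub>Aut T\<^esub> (2 * 2 ^ j :: nat) = \<one>\<^bsub>Aut T\<^esub>" using A.nat_pow_pow[OF f] by simp
  then have "?m dvd 2 ^ Suc j" using A.pow_eq_id[OF f] by simp
  then show ?thesis using divides_primepow_nat[of 2 ?m "Suc j"] two_is_prime_nat by blast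
qed

lemma zigzag_ridges:
  "flag T \<Phi> \<Longrightarrow> distinct_adj (ridges n T \<Phi> (word_power [n - 2, n - 1] k)) \<and>
     (0 < k \<longrightarrow> ridges n T \<Phi> (word_power [n - 2, n - 1] k) \<noteq> [] \<and>
        hd (ridges n T \<Phi> (word_power [n - 2, n - 1] k)) \<noteq> face T \<Phi> (n - 2))"
proof (induction k arbitrary: \<Phi>)
  case (Suc k)
  let ?\<Phi>1 = "flip T (n - 2) \<Phi>"
  let ?\<Phi>2 = "flip T (n - 1) ?\<Phi>1"
  have f1: "flag T ?\<Phi>1" using flag_flip[OF Suc.prems, of "n - 2"] n_ge2 by simp
  have f2: "flag T ?\<Phi>2" using flag_flip[OF f1, of "n - 1"] n_ge2 by simp
  have "face T ?\<Phi>2 (n - 2) = face T ?\<Phi>1 (n - 2)"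
    using face_flip[OF f1, of "n - 1" "n - 2"] n_ge2 by simp
  moreover have "face T ?\<Phi>1 (n - 2) \<noteq> face T \<Phi> (n - 2)"
    using face_flip_neq[OF Suc.prems, of "n - 2"] n_ge2 by simp
  moreover have "ridges n T \<Phi> (word_power [n - 2, n - 1] (Suc k)) =
      face T ?\<Phi>1 (n - 2) # ridges n T ?\<Phi>2 (word_power [n - 2, n - 1] k)"
    by simp
  moreover have "ridges n T ?\<Phi>2 (word_power [n - 2, n - 1] k) = []" if "k = 0" using that by simp
  ultimately show ?case using Suc.IH[OF f2] by (cases "k = 0") (auto simp: distinct_adj_Cons)
qed simp

text \<open>Two zigzags lead to a flag of the original kind, so they are realised by an automorphism, all of whose
powers move the starting flag further away.\<close>

lemma infinite_Aut: "infinite (carrier (Aut T))"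
proof -
  let ?z = "[n - 2, n - 1]"
  let ?t = "relators (n - 1) T"
  obtain \<Phi> where \<Phi>: "flag T \<Phi>" by (rule ex_flag)
  have set: "set ?z \<subseteq> {0..<n}" using n_ge2 by auto
  have other: "{?t \<Psi>, ?t (walk T \<Psi> ?z)} = {r\<^sub>1, r\<^sub>2}" if \<Psi>: "flag T \<Psi>" for \<Psi>
  proof -
    have "flag T (flip T (n - 2) \<Psi>)" using flag_flip[OF \<Psi>, of "n - 2"] n_ge2 by simp
    from facets_alternating[OF this] show ?thesis using facets_regular[OF \<Psi>, of "n - 2"] n_ge2 by simp
  qed
  have "?t (walk T \<Phi> (?z @ ?z)) = ?t \<Phi>"
    using other[OF \<Phi>] other[OF flag_walk[OF \<Phi> set]] unfolding walk_append by (metis doubleton_eq_iff)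
  moreover have set2: "set (?z @ ?z) \<subseteq> {0..<n}" using set by simp
  ultimately obtain f where f: "f \<in> carrier (Aut T)" "f ` \<Phi> = walk T \<Phi> (?z @ ?z)"
    using aut_of_same_kind[OF \<Phi> flag_walk[OF \<Phi> set2]] by metis
  have zz: "word_power (?z @ ?z) k = word_power ?z (2 * k)" for k
    by (induction k) auto
  have "f [^]\<^bsub>Aut T\<^esub> k \<noteq> \<one>\<^bsub>Aut T\<^esub>" if k: "0 < (k::nat)" for k
  proof
    assume "f [^]\<^bsub>Aut T\<^esub> k = \<one>\<^bsub>Aut T\<^esub>"
    then have closed: "walk T \<Phi> (word_power ?z (2 * k)) = \<Phi>"
      using aut_pow_one_iff[OF f(1) \<Phi> set2 f(2), of k] zz by simp
    have "ridge_path n T (face T \<Phi> (n - 1)) (ridges n T \<Phi> (word_power ?z (2 * k))) (face T \<Phi> (n - 1))"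
      using ridge_path_walk[OF \<Phi> set_word_power[OF set] n_ge1, of "2 * k"] closed by simp
    then show False
      using zigzag_ridges[OF \<Phi>, of "2 * k"] k tree unfolding treelike_def by force
  qed
  then have "A.ord f = 0" using A.pow_eq_id[OF f(1)] A.pow_ord_eq_1[OF f(1)] by (metis neq0_conv)
  then show ?thesis using A.ord_ge_1[OF _ f(1)] by fastforce
qed

text \<open>Any flag \<open>\<Psi>\<close>, or else the flag across its ridge, is an image of the flag \<open>\<Phi>\<close>. Hence moving
along one further letter changes the automorphism by a factor that moves \<open>\<Phi>\<close> by a word of length at most
three: the letter itself, with a possible crossing before and after it.\<close>

lemma finitely_generated_Aut: "finitely_generated_group (Aut T)"
proof -
  obtain \<Phi> where \<Phi>: "flag T \<Phi>" by (rule ex_flag)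
  define W where "W = {w. set w \<subseteq> {0..<n} \<and> length w \<le> 3}"
  define X where "X = {f \<in> carrier (Aut T). f ` \<Phi> \<in> walk T \<Phi> ` W}"
  have "finite W" unfolding W_def by (rule finite_lists_length_le) simp
  moreover have "inj_on (\<lambda>f. f ` \<Phi>) X"
  proof (rule inj_onI)
    fix f g assume "f \<in> X" "g \<in> X" "f ` \<Phi> = g ` \<Phi>"
    then show "f = g" unfolding X_def by (intro aut_free[OF _ _ \<Phi>]) simp_all
  qed
  moreover have "(\<lambda>f. f ` \<Phi>) ` X \<subseteq> walk T \<Phi> ` W" unfolding X_def by (rule image_subsetI) simp
  ultimately have finX: "finite X" using finite_imageD finite_imageI finite_subset by metis
  have sub: "X \<subseteq> carrier (Aut T)" unfolding X_def by blast
  have last: "n - 1 \<in> {0..<n}" using n_ge1 by simp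
  have key: "f \<in> generate (Aut T) X"
    if "set w \<subseteq> {0..<n}" "f \<in> carrier (Aut T)" "f ` \<Phi> = walk T \<Phi> w \<or> f ` \<Phi> = walk T \<Phi> (w @ [n - 1])" for w f
    using that
  proof (induction w arbitrary: f rule: rev_induct)
    case Nil
    have "[] \<in> W" "[n - 1] \<in> W" unfolding W_def using last by auto
    then have "f ` \<Phi> \<in> walk T \<Phi> ` W"
      using Nil.prems(3) imageI[of "[]" W "walk T \<Phi>"] imageI[of "[n - 1]" W "walk T \<Phi>"] by (metis append_Nil)
    then have "f \<in> X" unfolding X_def using Nil.prems(2) by simp
    then show ?case by (rule generate.incl)
  next
    case (snoc i w)
    let ?\<Psi> = "walk T \<Phi> w"
    have w: "set w \<subseteq> {0..<n}" and i: "i \<in> {0..<n}" using snoc.prems(1) by auto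
    have \<Psi>: "flag T ?\<Psi>" by (rule flag_walk[OF \<Phi> w])
    have \<Psi>': "flag T (flip T (n - 1) ?\<Psi>)" using flag_flip[OF \<Psi>, of "n - 1"] n_ge1 by simp
    have "relators (n - 1) T \<Phi> = relators (n - 1) T ?\<Psi> \<or> relators (n - 1) T \<Phi> = relators (n - 1) T (flip T (n - 1) ?\<Psi>)"
      using relators_cases[OF \<Phi>] facets_alternating[OF \<Psi>] by (metis doubleton_eq_iff)
    then obtain g where g: "g \<in> carrier (Aut T)" "g ` \<Phi> = ?\<Psi> \<or> g ` \<Phi> = flip T (n - 1) ?\<Psi>"
      using aut_of_same_kind[OF \<Phi> \<Psi>] aut_of_same_kind[OF \<Phi> \<Psi>'] by metis
    then have gX: "g \<in> generate (Aut T) X" using snoc.IH[OF w g(1)] by simp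
    have "flip T (n - 1) (flip T (n - 1) ?\<Psi>) = ?\<Psi>"
      using flip_flip[OF \<Psi>, of "n - 1"] n_ge1 by simp
    then have "?\<Psi> = walk T (g ` \<Phi>) [] \<or> ?\<Psi> = walk T (g ` \<Phi>) [n - 1]" using g(2) by auto
    then obtain e where e: "e \<in> {[], [n - 1]}" "?\<Psi> = walk T (g ` \<Phi>) e" by blast
    have "f ` \<Phi> = walk T ?\<Psi> [i] \<or> f ` \<Phi> = walk T ?\<Psi> [i, n - 1]"
      using snoc.prems(3) by simp
    then obtain v where v: "v \<in> {[i], [i, n - 1]}" "f ` \<Phi> = walk T ?\<Psi> v" by blast
    have ev: "set (e @ v) \<subseteq> {0..<n}" "e @ v \<in> W" using e(1) v(1) i last unfolding W_def by auto
    let ?h = "inv\<^bsub>Aut T\<^esub> g \<otimes>\<^bsub>Aut T\<^esub> f"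
    have ig: "inv\<^bsub>Aut T\<^esub> g \<in> carrier (Aut T)" using g(1) by simp
    have "f ` \<Phi> = g ` walk T \<Phi> (e @ v)"
      using aut_walk[OF g(1) \<Phi> ev(1)] e(2) v(2) by simp
    then have "?h ` \<Phi> = (inv\<^bsub>Aut T\<^esub> g) ` g ` walk T \<Phi> (e @ v)"
      using aut_mult_image[OF ig snoc.prems(2) flag_sub[OF \<Phi>]] by simp
    also have "\<dots> = (inv\<^bsub>Aut T\<^esub> g \<otimes>\<^bsub>Aut T\<^esub> g) ` walk T \<Phi> (e @ v)"
      using aut_mult_image[OF ig g(1) flag_sub[OF flag_walk[OF \<Phi> ev(1)]]] by simp
    also have "\<dots> = walk T \<Phi> (e @ v)"
      using aut_one_image[OF flag_walk[OF \<Phi> ev(1)]] A.l_inv[OF g(1)] by simp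
    finally have "?h \<in> X" unfolding X_def using ev(2) ig snoc.prems(2) by blast
    then have "g \<otimes>\<^bsub>Aut T\<^esub> ?h \<in> generate (Aut T) X"
      by (intro generate.eng[OF gX] generate.incl)
    moreover have "g \<otimes>\<^bsub>Aut T\<^esub> ?h = f"
      using A.m_assoc[OF g(1) ig snoc.prems(2)] g(1) snoc.prems(2) by simp
    ultimately show ?case by simp
  qed
  have "carrier (Aut T) \<subseteq> generate (Aut T) X"
  proof
    fix f assume f: "f \<in> carrier (Aut T)"
    obtain w where "set w \<subseteq> {0..<n}" "walk T \<Phi> w = f ` \<Phi>"
      by (rule walk_connected[OF \<Phi> aut_flag[OF f \<Phi>]])
    then show "f \<in> generate (Aut T) X" using key[OF _ f] by metis
  qed
  then have "generate (Aut T) X = carrier (Aut T)" using A.generate_incl[OF sub] by blast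
  then show ?thesis
    unfolding finitely_generated_group_def using A.group_axioms finX sub by blast
qed

theorem infinite_2_group_Aut:
  assumes "two_torsion (n - 1) r\<^sub>1" "two_torsion (n - 1) r\<^sub>2"
  shows "infinite_2_group (Aut T)"
  unfolding infinite_2_group_def
  using finitely_generated_Aut infinite_Aut torsion_two_power[OF assms] by blast

end

section \<open>Gluing polytopes along a tree\<close>

lemma (in graded_poset) order_iso_lower_section:
  assumes "order_iso T T' f" "graded_poset n' T'" "G \<in> carrier T"
  shows "order_iso (lower_section T G) (lower_section T' (f G)) f"
proof -
  interpret T': graded_poset n' T' by fact
  note f = order_isoD[OF assms(1)]
  have "f ` {x \<in> carrier T. x \<sqsubseteq> G} = {x \<in> carrier T'. x \<sqsubseteq>\<^bsub>T'\<^esub> f G}"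
    unfolding f(3)[symmetric] using f(5) assms(3) by auto
  moreover have "inj_on f {x \<in> carrier T. x \<sqsubseteq> G}" using f(2) by (rule inj_on_subset) auto
  ultimately show ?thesis
    unfolding order_iso_def order_emb_def bij_betw_def
    using f(5) partial_order.axioms(1)[OF lower_section_po] partial_order.axioms(1)[OF T'.lower_section_po]
    by simp
qed

text \<open>Data for gluing copies of two polytopes \<open>X True\<close> and \<open>X False\<close> alternately along facets: each copy other
than the root is attached to its parent along its base facet \<open>B k\<close>, and \<open>glue k F\<close> identifies the base
facet of a child with the facet \<open>F\<close> of its parent of kind \<open>k\<close>.\<close>

locale gluing =
  fixes d :: int and X :: "bool \<Rightarrow> 'x ranked_order" and B :: "bool \<Rightarrow> 'x"
    and glue :: "bool \<Rightarrow> 'x \<Rightarrow> 'x \<Rightarrow> 'x"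
  assumes d_ge1: "1 \<le> d"
    and X: "abstract_polytope d (X k)"
    and B: "B k \<in> faces_of_rank (d - 1) (X k)"
    and glue: "F \<in> faces_of_rank (d - 1) (X k) \<Longrightarrow>
      order_iso (lower_section (X (\<not> k)) (B (\<not> k))) (lower_section (X k) F) (glue k F)"
begin

sublocale X: abstract_polytope d "X k" for k
  by (rule X)

abbreviation in_base :: "bool \<Rightarrow> 'x \<Rightarrow> bool" where
  "in_base k x \<equiv> x \<sqsubseteq>\<^bsub>X k\<^esub> B k"

lemma Bc: "B k \<in> carrier (X k)" "rk (X k) (B k) = d - 1"
  using B[of k] unfolding faces_of_rank_def by auto

definition top_face :: "bool \<Rightarrow> 'x" where
  "top_face k = (SOME x. greatest (X k) x (carrier (X k)) \<and> rk (X k) x = d)"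

lemma top_face: "top_face k \<in> carrier (X k)" "rk (X k) (top_face k) = d" "x \<in> carrier (X k) \<Longrightarrow> x \<sqsubseteq>\<^bsub>X k\<^esub> top_face k"
proof -
  have "greatest (X k) (top_face k) (carrier (X k)) \<and> rk (X k) (top_face k) = d"
    unfolding top_face_def by (rule someI_ex[OF X.greatest_ex])
  then show "top_face k \<in> carrier (X k)" "rk (X k) (top_face k) = d" "x \<in> carrier (X k) \<Longrightarrow> x \<sqsubseteq>\<^bsub>X k\<^esub> top_face k"
    unfolding greatest_def by auto
qed

lemma top_face_not_in_base: "\<not> in_base k (top_face k)"
  using X.rk_le[OF top_face(1)[of k] Bc(1)[of k]] top_face(2)[of k] Bc(2)[of k] by auto

lemma eq_top_face: "x \<in> carrier (X k) \<Longrightarrow> rk (X k) x = d \<Longrightarrow> x = top_face k"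
  using X.rank_top_unique[of x k "top_face k"] top_face by auto

context
  fixes k F assumes F: "F \<in> faces_of_rank (d - 1) (X k)"
begin

lemma Fc: "F \<in> carrier (X k)" "rk (X k) F = d - 1"
  using F unfolding faces_of_rank_def by auto

lemma glue_in:
  "\<lbrakk>x \<in> carrier (X (\<not> k)); in_base (\<not> k) x\<rbrakk> \<Longrightarrow> glue k F x \<in> carrier (X k) \<and> glue k F x \<sqsubseteq>\<^bsub>X k\<^esub> F"
  using order_isoD(4)[OF glue[OF F], of x] by simp

lemma glue_le_iff:
  "\<lbrakk>x \<in> carrier (X (\<not> k)); in_base (\<not> k) x; y \<in> carrier (X (\<not> k)); in_base (\<not> k) y\<rbrakk> \<Longrightarrow>
   glue k F x \<sqsubseteq>\<^bsub>X k\<^esub> glue k F y \<longleftrightarrow> x \<sqsubseteq>\<^bsub>X (\<not> k)\<^esub> y"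
  using order_isoD(5)[OF glue[OF F], of x y] by simp

lemma glue_inj:
  "\<lbrakk>x \<in> carrier (X (\<not> k)); in_base (\<not> k) x; y \<in> carrier (X (\<not> k)); in_base (\<not> k) y;
    glue k F x = glue k F y\<rbrakk> \<Longrightarrow> x = y"
  using inj_onD[OF order_isoD(2)[OF glue[OF F]], of x y] by simp

lemma glue_surj:
  assumes "y \<in> carrier (X k)" "y \<sqsubseteq>\<^bsub>X k\<^esub> F"
  obtains x where "x \<in> carrier (X (\<not> k))" "in_base (\<not> k) x" "y = glue k F x"
proof -
  have "y \<in> glue k F ` carrier (lower_section (X (\<not> k)) (B (\<not> k)))"
    unfolding order_isoD(3)[OF glue[OF F]] using assms by simp
  then show ?thesis using that by auto
qed

lemma glue_rk:
  assumes "x \<in> carrier (X (\<not> k))" "in_base (\<not> k) x"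
  shows "rk (X k) (glue k F x) = rk (X (\<not> k)) x"
proof -
  have "graded_poset (d - 1) (lower_section (X (\<not> k)) (B (\<not> k)))"
    using X.lower_section_graded[OF Bc(1), of "\<not> k"] Bc(2) by simp
  moreover have "graded_poset (d - 1) (lower_section (X k) F)"
    using X.lower_section_graded[OF Fc(1)] Fc(2) by simp
  ultimately show ?thesis
    using order_iso_rk[OF glue[OF F], of "d - 1" x] assms by simp
qed

lemma glue_B: "glue k F (B (\<not> k)) = F"
proof -
  have *: "B (\<not> k) \<in> carrier (X (\<not> k))" "B (\<not> k) \<sqsubseteq>\<^bsub>X (\<not> k)\<^esub> B (\<not> k)"
    using Bc(1) by auto
  then show ?thesis
    using X.eq_of_rk[of "glue k F (B (\<not> k))" k F] glue_in[OF *] glue_rk[OF *] Fc Bc(2)[of "\<not> k"] by simp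
qed

end

fun kind :: "'x list \<Rightarrow> bool" where
  "kind [] = True"
| "kind (F # \<sigma>) = (\<not> kind \<sigma>)"

abbreviation Y :: "'x list \<Rightarrow> 'x ranked_order" where
  "Y \<sigma> \<equiv> X (kind \<sigma>)"

abbreviation base :: "'x list \<Rightarrow> 'x" where
  "base \<sigma> \<equiv> B (kind \<sigma>)"

text \<open>A node is the list of facets through which it is reached from the root, the last one first. The base
facet of a non-root node leads back to its parent, hence it is excluded.\<close>

fun node :: "'x list \<Rightarrow> bool" where
  "node [] \<longleftrightarrow> True"
| "node (F # \<sigma>) \<longleftrightarrow> node \<sigma> \<and> F \<in> faces_of_rank (d - 1) (Y \<sigma>) \<and> (\<sigma> = [] \<or> F \<noteq> base \<sigma>)"

text \<open>A face of the copy at a node also belongs to the parent if it lies below the base facet. The canonical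
representative of a face is its occurrence closest to the root.\<close>

fun reduce :: "'x list \<Rightarrow> 'x \<Rightarrow> 'x list \<times> 'x" where
  "reduce [] x = ([], x)"
| "reduce (F # \<sigma>) x =
     (if in_base (kind (F # \<sigma>)) x then reduce \<sigma> (glue (kind \<sigma>) F x) else (F # \<sigma>, x))"

lemma reduce_props:
  "\<lbrakk>node \<tau>; x \<in> carrier (Y \<tau>); reduce \<tau> x = (\<sigma>, y)\<rbrakk> \<Longrightarrow>
   node \<sigma> \<and> y \<in> carrier (Y \<sigma>) \<and> (\<sigma> = [] \<or> \<not> in_base (kind \<sigma>) y) \<and> (\<exists>\<rho>. \<tau> = \<rho> @ \<sigma>) \<and>
   rk (Y \<sigma>) y = rk (Y \<tau>) x"
proof (induction \<tau> arbitrary: x)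
  case (Cons F \<tau>)
  have n: "node \<tau>" "F \<in> faces_of_rank (d - 1) (Y \<tau>)" using Cons.prems(1) by auto
  show ?case
  proof (cases "in_base (kind (F # \<tau>)) x")
    case True
    then have x: "x \<in> carrier (X (\<not> kind \<tau>))" "in_base (\<not> kind \<tau>) x"
      using Cons.prems(2) by auto
    have "reduce \<tau> (glue (kind \<tau>) F x) = (\<sigma>, y)" using Cons.prems(3) True by simp
    from Cons.IH[OF n(1) _ this] show ?thesis
      using glue_in[OF n(2) x] glue_rk[OF n(2) x] by auto
  next
    case False
    then show ?thesis using Cons.prems by auto
  qed
qed auto

lemma reduce_length: "\<lbrakk>node \<tau>; x \<in> carrier (Y \<tau>); reduce \<tau> x = (\<sigma>, y)\<rbrakk> \<Longrightarrow> length \<sigma> \<le> length \<tau>"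
  using reduce_props[of \<tau> x \<sigma> y] by auto

lemma reduce_reduced: "\<sigma> = [] \<or> \<not> in_base (kind \<sigma>) x \<Longrightarrow> reduce \<sigma> x = (\<sigma>, x)"
  by (cases \<sigma>) auto

lemma reduce_inj:
  "\<lbrakk>node \<tau>; x \<in> carrier (Y \<tau>); y \<in> carrier (Y \<tau>); reduce \<tau> x = reduce \<tau> y\<rbrakk> \<Longrightarrow> x = y"
proof (induction \<tau> arbitrary: x y)
  case (Cons F \<tau>)
  have n: "node \<tau>" "F \<in> faces_of_rank (d - 1) (Y \<tau>)" using Cons.prems(1) by auto
  let ?le = "\<lambda>x. in_base (\<not> kind \<tau>) x"
  have c: "x \<in> carrier (X (\<not> kind \<tau>))" "y \<in> carrier (X (\<not> kind \<tau>))" using Cons.prems(2,3) by auto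
  have up: "reduce \<tau> (glue (kind \<tau>) F z) \<noteq> (F # \<tau>, z')" if "z \<in> carrier (X (\<not> kind \<tau>))" "?le z" for z z'
  proof
    assume "reduce \<tau> (glue (kind \<tau>) F z) = (F # \<tau>, z')"
    from reduce_length[OF n(1) _ this] show False using glue_in[OF n(2) that] by simp
  qed
  consider "?le x" "?le y" | "?le x" "\<not> ?le y" | "\<not> ?le x" "?le y" | "\<not> ?le x" "\<not> ?le y" by blast
  then show ?case
  proof cases
    case 1
    then have "reduce \<tau> (glue (kind \<tau>) F x) = reduce \<tau> (glue (kind \<tau>) F y)" using Cons.prems(4) by simp
    then have "glue (kind \<tau>) F x = glue (kind \<tau>) F y"
      using Cons.IH[OF n(1)] glue_in[OF n(2) c(1) 1(1)] glue_in[OF n(2) c(2) 1(2)] by blast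
    then show ?thesis by (rule glue_inj[OF n(2) c(1) 1(1) c(2) 1(2)])
  next
    case 2
    then show ?thesis using Cons.prems(4) up[OF c(1)] by simp
  next
    case 3
    then show ?thesis using Cons.prems(4) up[OF c(2), of x] by simp
  next
    case 4
    then show ?thesis using Cons.prems(4) by simp
  qed
qed simp

lemma reduce_down:
  "\<lbrakk>node \<tau>; x \<in> carrier (Y \<tau>); y \<in> carrier (Y \<tau>); x \<sqsubseteq>\<^bsub>Y \<tau>\<^esub> y; reduce \<tau> y = (\<sigma>, z)\<rbrakk> \<Longrightarrow>
   \<exists>x'\<in>carrier (Y \<sigma>). x' \<sqsubseteq>\<^bsub>Y \<sigma>\<^esub> z \<and> reduce \<sigma> x' = reduce \<tau> x"
proof (induction \<tau> arbitrary: x y)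
  case (Cons F \<tau>)
  have n: "node \<tau>" "F \<in> faces_of_rank (d - 1) (Y \<tau>)" using Cons.prems(1) by auto
  have c: "x \<in> carrier (X (\<not> kind \<tau>))" "y \<in> carrier (X (\<not> kind \<tau>))" "x \<sqsubseteq>\<^bsub>X (\<not> kind \<tau>)\<^esub> y"
    using Cons.prems(2-4) by auto
  show ?case
  proof (cases "in_base (\<not> kind \<tau>) y")
    case True
    then have x: "in_base (\<not> kind \<tau>) x"
      using X.le_trans[OF c(3) _ c(1,2) Bc(1)] by blast
    have "reduce \<tau> (glue (kind \<tau>) F y) = (\<sigma>, z)" using Cons.prems(5) True by simp
    then have "\<exists>x'\<in>carrier (Y \<sigma>). x' \<sqsubseteq>\<^bsub>Y \<sigma>\<^esub> z \<and> reduce \<sigma> x' = reduce \<tau> (glue (kind \<tau>) F x)"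
      using Cons.IH[OF n(1)] glue_in[OF n(2) c(1) x] glue_in[OF n(2) c(2) True] glue_le_iff[OF n(2) c(1) x c(2) True] c(3)
      by blast
    then show ?thesis using x by simp
  next
    case False
    then have "\<sigma> = F # \<tau>" "z = y" using Cons.prems(5) by auto
    then show ?thesis using Cons.prems by blast
  qed
qed auto

lemma reduce_up:
  "\<lbrakk>node \<tau>; y \<in> carrier (Y \<tau>); reduce \<tau> y = (\<sigma>, z); x \<in> carrier (Y \<sigma>); x \<sqsubseteq>\<^bsub>Y \<sigma>\<^esub> z\<rbrakk> \<Longrightarrow>
   \<exists>x'\<in>carrier (Y \<tau>). x' \<sqsubseteq>\<^bsub>Y \<tau>\<^esub> y \<and> reduce \<tau> x' = reduce \<sigma> x"
proof (induction \<tau> arbitrary: y)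
  case (Cons F \<tau>)
  have n: "node \<tau>" "F \<in> faces_of_rank (d - 1) (Y \<tau>)" using Cons.prems(1) by auto
  have c: "y \<in> carrier (X (\<not> kind \<tau>))" using Cons.prems(2) by auto
  show ?case
  proof (cases "in_base (\<not> kind \<tau>) y")
    case True
    have "reduce \<tau> (glue (kind \<tau>) F y) = (\<sigma>, z)" using Cons.prems(3) True by simp
    then obtain v where v: "v \<in> carrier (Y \<tau>)" "v \<sqsubseteq>\<^bsub>Y \<tau>\<^esub> glue (kind \<tau>) F y" "reduce \<tau> v = reduce \<sigma> x"
      using Cons.IH[OF n(1) _ _ Cons.prems(4,5)] glue_in[OF n(2) c True] by blast
    have "v \<sqsubseteq>\<^bsub>Y \<tau>\<^esub> F"
      using X.le_trans[OF v(2) _ v(1) _ Fc(1)[OF n(2)]] glue_in[OF n(2) c True] by blast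
    then obtain w where w: "w \<in> carrier (X (\<not> kind \<tau>))" "in_base (\<not> kind \<tau>) w" "v = glue (kind \<tau>) F w"
      by (rule glue_surj[OF n(2) v(1)])
    then have "w \<sqsubseteq>\<^bsub>X (\<not> kind \<tau>)\<^esub> y" using glue_le_iff[OF n(2) w(1,2) c True] v(2) by simp
    moreover have "reduce (F # \<tau>) w = reduce \<sigma> x" using w v(3) by simp
    ultimately show ?thesis using w(1) by (intro bexI[of _ w]) simp_all
  next
    case False
    then have "\<sigma> = F # \<tau>" "z = y" using Cons.prems(3) by auto
    then show ?thesis using Cons.prems by blast
  qed
qed auto

text \<open>A face brings all its subfaces along to every node where it occurs. This makes the comparison
of faces independent of the node in which it takes place.\<close>

lemma reduce_transfer:
  assumes "node \<tau>" "x \<in> carrier (Y \<tau>)" "y \<in> carrier (Y \<tau>)" "x \<sqsubseteq>\<^bsub>Y \<tau>\<^esub> y"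
    and "node \<upsilon>" "y' \<in> carrier (Y \<upsilon>)" "reduce \<upsilon> y' = reduce \<tau> y"
  obtains x' where "x' \<in> carrier (Y \<upsilon>)" "x' \<sqsubseteq>\<^bsub>Y \<upsilon>\<^esub> y'" "reduce \<upsilon> x' = reduce \<tau> x"
proof -
  obtain \<sigma> z where r: "reduce \<tau> y = (\<sigma>, z)" by (cases "reduce \<tau> y")
  obtain v where v: "v \<in> carrier (Y \<sigma>)" "v \<sqsubseteq>\<^bsub>Y \<sigma>\<^esub> z" "reduce \<sigma> v = reduce \<tau> x"
    using reduce_down[OF assms(1-4) r] by blast
  have "reduce \<upsilon> y' = (\<sigma>, z)" using assms(7) r by simp
  from reduce_up[OF assms(5,6) this v(1,2)] show ?thesis using that v(3) by auto
qed

text \<open>A face that occurs at two different nodes also occurs at the parent of whichever is not closer to the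
root than the other.\<close>

lemma reduce_common:
  assumes "node \<tau>" "x \<in> carrier (Y \<tau>)" "node \<upsilon>" "y \<in> carrier (Y \<upsilon>)" "reduce \<tau> x = reduce \<upsilon> y"
    "length \<upsilon> \<le> length \<tau>" "\<tau> \<noteq> \<upsilon>"
  obtains F \<tau>' where "\<tau> = F # \<tau>'" "in_base (kind \<tau>) x"
proof -
  have "in_base (kind \<tau>) x \<and> \<tau> \<noteq> []"
  proof (rule ccontr)
    assume "\<not> ?thesis"
    then have "reduce \<upsilon> y = (\<tau>, x)" using reduce_reduced[of \<tau> x] assms(5) by auto
    from reduce_props[OF assms(3,4) this] show False using assms(6,7) by auto
  qed
  then show ?thesis using that by (cases \<tau>) auto
qed

definition place :: "'x list \<Rightarrow> 'x \<Rightarrow> ('x list \<times> 'x) option" where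
  "place \<tau> x = Some (reduce \<tau> x)"

text \<open>The glued polytope: \<open>None\<close> is the greatest face, and the other faces are compared in some common node.\<close>

definition Z :: "('x list \<times> 'x) option ranked_order" where
  "Z = \<lparr>carrier = insert None {place \<tau> x | \<tau> x. node \<tau> \<and> x \<in> carrier (Y \<tau>)},
        eq = (=),
        le = (\<lambda>a b. b = None \<or>
          (\<exists>\<tau> x y. node \<tau> \<and> x \<in> carrier (Y \<tau>) \<and> y \<in> carrier (Y \<tau>) \<and> x \<sqsubseteq>\<^bsub>Y \<tau>\<^esub> y \<and> a = place \<tau> x \<and> b = place \<tau> y)),
        rk = (\<lambda>a. case a of None \<Rightarrow> d + 1 | Some (\<sigma>, x) \<Rightarrow> rk (Y \<sigma>) x)\<rparr>"

lemma carrier_Z: "carrier Z = insert None {place \<tau> x | \<tau> x. node \<tau> \<and> x \<in> carrier (Y \<tau>)}"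
  and eq_Z: "eq Z = (=)"
  and le_Z: "a \<sqsubseteq>\<^bsub>Z\<^esub> b \<longleftrightarrow> b = None \<or>
      (\<exists>\<tau> x y. node \<tau> \<and> x \<in> carrier (Y \<tau>) \<and> y \<in> carrier (Y \<tau>) \<and> x \<sqsubseteq>\<^bsub>Y \<tau>\<^esub> y \<and> a = place \<tau> x \<and> b = place \<tau> y)"
  and rk_Z: "rk Z a = (case a of None \<Rightarrow> d + 1 | Some (\<sigma>, x) \<Rightarrow> rk (Y \<sigma>) x)"
  unfolding Z_def by simp_all

lemma place_not_None [simp]: "place \<tau> x \<noteq> None" "None \<noteq> place \<tau> x"
  unfolding place_def by simp_all

lemma None_Z [simp]: "None \<in> carrier Z" "rk Z None = d + 1" "a \<sqsubseteq>\<^bsub>Z\<^esub> None"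
  unfolding carrier_Z rk_Z le_Z by simp_all

lemma place_in: "node \<tau> \<Longrightarrow> x \<in> carrier (Y \<tau>) \<Longrightarrow> place \<tau> x \<in> carrier Z"
  unfolding carrier_Z by blast

lemma Z_cases:
  assumes "a \<in> carrier Z"
  obtains "a = None" | \<tau> x where "node \<tau>" "x \<in> carrier (Y \<tau>)" "a = place \<tau> x"
  using assms unfolding carrier_Z by blast

lemma rk_place: "node \<tau> \<Longrightarrow> x \<in> carrier (Y \<tau>) \<Longrightarrow> rk Z (place \<tau> x) = rk (Y \<tau>) x"
  using reduce_props[of \<tau> x "fst (reduce \<tau> x)" "snd (reduce \<tau> x)"] unfolding rk_Z place_def by (simp add: split_beta)

lemma place_inj: "\<lbrakk>node \<tau>; x \<in> carrier (Y \<tau>); y \<in> carrier (Y \<tau>); place \<tau> x = place \<tau> y\<rbrakk> \<Longrightarrow> x = y"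
  using reduce_inj unfolding place_def by blast

lemma place_transfer:
  assumes "a \<sqsubseteq>\<^bsub>Z\<^esub> place \<upsilon> y'" "node \<upsilon>" "y' \<in> carrier (Y \<upsilon>)"
  obtains x' where "x' \<in> carrier (Y \<upsilon>)" "x' \<sqsubseteq>\<^bsub>Y \<upsilon>\<^esub> y'" "a = place \<upsilon> x'"
proof -
  obtain \<tau> x y where *: "node \<tau>" "x \<in> carrier (Y \<tau>)" "y \<in> carrier (Y \<tau>)" "x \<sqsubseteq>\<^bsub>Y \<tau>\<^esub> y" "a = place \<tau> x" "place \<upsilon> y' = place \<tau> y"
    using assms(1) unfolding le_Z by auto
  then have "reduce \<upsilon> y' = reduce \<tau> y" unfolding place_def by simp
  from reduce_transfer[OF *(1-4) assms(2,3) this] show ?thesis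
    using that *(5) unfolding place_def by metis
qed

lemma place_le_iff:
  assumes "node \<tau>" "x \<in> carrier (Y \<tau>)" "y \<in> carrier (Y \<tau>)"
  shows "place \<tau> x \<sqsubseteq>\<^bsub>Z\<^esub> place \<tau> y \<longleftrightarrow> x \<sqsubseteq>\<^bsub>Y \<tau>\<^esub> y"
proof
  assume "place \<tau> x \<sqsubseteq>\<^bsub>Z\<^esub> place \<tau> y"
  then obtain x' where "x' \<in> carrier (Y \<tau>)" "x' \<sqsubseteq>\<^bsub>Y \<tau>\<^esub> y" "place \<tau> x = place \<tau> x'"
    by (rule place_transfer[OF _ assms(1,3)])
  then show "x \<sqsubseteq>\<^bsub>Y \<tau>\<^esub> y" using place_inj[OF assms(1,2)] by metis
qed (use assms in \<open>unfold le_Z, blast\<close>)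

lemma None_le: "None \<sqsubseteq>\<^bsub>Z\<^esub> a \<longleftrightarrow> a = None"
  unfolding le_Z by auto

lemma po_Z: "partial_order Z"
proof -
  have refl: "a \<sqsubseteq>\<^bsub>Z\<^esub> a" if "a \<in> carrier Z" for a
    using that by (cases rule: Z_cases) (auto simp: place_le_iff)
  have antisym: "a = b" if "a \<sqsubseteq>\<^bsub>Z\<^esub> b" "b \<sqsubseteq>\<^bsub>Z\<^esub> a" "a \<in> carrier Z" "b \<in> carrier Z" for a b
    using that(4)
  proof (cases rule: Z_cases)
    case 1
    then show ?thesis using that None_le by simp
  next
    case (2 \<tau> y)
    have "a \<sqsubseteq>\<^bsub>Z\<^esub> place \<tau> y" using that(1) 2(3) by simp
    then obtain x where x: "x \<in> carrier (Y \<tau>)" "x \<sqsubseteq>\<^bsub>Y \<tau>\<^esub> y" "a = place \<tau> x"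
      by (rule place_transfer[OF _ 2(1,2)])
    then have "y \<sqsubseteq>\<^bsub>Y \<tau>\<^esub> x" using that(2) 2 place_le_iff by auto
    then show ?thesis using X.le_antisym[OF x(2) _ x(1) 2(2)] x(3) 2(3) by simp
  qed
  have trans: "a \<sqsubseteq>\<^bsub>Z\<^esub> c" if "a \<sqsubseteq>\<^bsub>Z\<^esub> b" "b \<sqsubseteq>\<^bsub>Z\<^esub> c" "c \<in> carrier Z" for a b c
    using that(3)
  proof (cases rule: Z_cases)
    case (2 \<tau> z)
    have "b \<sqsubseteq>\<^bsub>Z\<^esub> place \<tau> z" using that(2) 2(3) by simp
    then obtain y where y: "y \<in> carrier (Y \<tau>)" "y \<sqsubseteq>\<^bsub>Y \<tau>\<^esub> z" "b = place \<tau> y"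
      by (rule place_transfer[OF _ 2(1,2)])
    have "a \<sqsubseteq>\<^bsub>Z\<^esub> place \<tau> y" using that(1) y(3) by simp
    then obtain x where x: "x \<in> carrier (Y \<tau>)" "x \<sqsubseteq>\<^bsub>Y \<tau>\<^esub> y" "a = place \<tau> x"
      by (rule place_transfer[OF _ 2(1) y(1)])
    show ?thesis
      using X.le_trans[OF x(2) y(2) x(1) y(1) 2(2)] place_le_iff[OF 2(1) x(1) 2(2)] x(3) 2(3) by simp
  qed simp
  show ?thesis
  proof (intro partial_order.intro weak_partial_order.intro equivalence.intro weak_partial_order_axioms.intro partial_order_axioms.intro)
    show "eq Z = (=)" by (rule eq_Z)
  qed (auto simp: eq_Z intro: refl antisym trans)
qed

sublocale Z: partial_order Z
  by (rule po_Z)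

declare Z.le_antisym [rule del]

definition node_facet :: "'x list \<Rightarrow> ('x list \<times> 'x) option" where
  "node_facet \<tau> = place \<tau> (top_face (kind \<tau>))"

lemma node_facet_eq: "node_facet \<tau> = Some (\<tau>, top_face (kind \<tau>))"
  unfolding node_facet_def place_def using reduce_reduced[of \<tau> "top_face (kind \<tau>)"] top_face_not_in_base by auto

lemma node_facet_inj: "node_facet \<tau> = node_facet \<upsilon> \<Longrightarrow> \<tau> = \<upsilon>"
  unfolding node_facet_eq by simp

lemma node_facet_carrier: "node \<tau> \<Longrightarrow> node_facet \<tau> \<in> carrier Z" "node \<tau> \<Longrightarrow> rk Z (node_facet \<tau>) = d"
  unfolding node_facet_def using place_in[OF _ top_face(1)] rk_place[OF _ top_face(1)] top_face(2) by auto

lemma below_node_facet: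
  assumes "node \<tau>"
  shows "a \<sqsubseteq>\<^bsub>Z\<^esub> node_facet \<tau> \<longleftrightarrow> (\<exists>x\<in>carrier (Y \<tau>). a = place \<tau> x)"
proof
  assume "a \<sqsubseteq>\<^bsub>Z\<^esub> node_facet \<tau>"
  then show "\<exists>x\<in>carrier (Y \<tau>). a = place \<tau> x" unfolding node_facet_def by (rule place_transfer[OF _ assms top_face(1)]) blast
qed (use place_le_iff[OF assms _ top_face(1)] top_face(3) in \<open>auto simp: node_facet_def\<close>)

lemma rk_d_node_facet:
  assumes "a \<in> carrier Z" "rk Z a = d"
  obtains \<tau> where "node \<tau>" "a = node_facet \<tau>"
  using assms(1)
proof (cases rule: Z_cases)
  case (2 \<tau> x)
  then have "x = top_face (kind \<tau>)" using eq_top_face assms(2) rk_place by simp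
  then show ?thesis using that 2 unfolding node_facet_def by simp
qed (use assms(2) in auto)

lemma rk_less_Z:
  assumes "a \<in> carrier Z" "b \<in> carrier Z" "a \<sqsubseteq>\<^bsub>Z\<^esub> b" "a \<noteq> b"
  shows "rk Z a < rk Z b"
  using assms(2)
proof (cases rule: Z_cases)
  case 1
  from assms(1) show ?thesis
  proof (cases rule: Z_cases)
    case (2 \<tau> x)
    then show ?thesis using 1 X.rk_range[OF 2(2)] rk_place[OF 2(1,2)] by simp
  qed (use 1 assms(4) in auto)
next
  case (2 \<tau> y)
  have "a \<sqsubseteq>\<^bsub>Z\<^esub> place \<tau> y" using assms(3) 2(3) by simp
  then obtain x where x: "x \<in> carrier (Y \<tau>)" "x \<sqsubseteq>\<^bsub>Y \<tau>\<^esub> y" "a = place \<tau> x"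
    by (rule place_transfer[OF _ 2(1,2)])
  then have "x \<noteq> y" using assms(4) 2(3) by auto
  then show ?thesis using X.rk_less[OF x(1) 2(2) x(2)] rk_place[OF 2(1) x(1)] rk_place[OF 2(1,2)] x(3) 2(3) by simp
qed

lemma reduce_bottom:
  "\<lbrakk>node \<tau>; x \<in> carrier (Y \<tau>); rk (Y \<tau>) x = -1; z \<in> carrier (X True); rk (X True) z = -1\<rbrakk> \<Longrightarrow> reduce \<tau> x = ([], z)"
proof (induction \<tau> arbitrary: x)
  case Nil
  then show ?case using X.rank_bot_unique[of x True z] by simp
next
  case (Cons F \<tau>)
  have n: "node \<tau>" "F \<in> faces_of_rank (d - 1) (Y \<tau>)" using Cons.prems(1) by auto
  have x: "x \<in> carrier (X (\<not> kind \<tau>))" "in_base (\<not> kind \<tau>) x"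
    using Cons.prems(2,3) X.rank_bot[of x "\<not> kind \<tau>" "B (\<not> kind \<tau>)"] Bc(1) by auto
  then show ?case
    using Cons.IH[OF n(1) _ _ Cons.prems(4,5), of "glue (kind \<tau>) F x"] glue_in[OF n(2) x] glue_rk[OF n(2) x] Cons.prems(3)
    by simp
qed

lemma chain_place:
  assumes "node \<tau>" "C \<subseteq> carrier (Y \<tau>)"
  shows "chain_in Z (insert None (place \<tau> ` C)) \<longleftrightarrow> chain_in (Y \<tau>) C"
proof -
  have "place \<tau> x \<sqsubseteq>\<^bsub>Z\<^esub> place \<tau> y \<longleftrightarrow> x \<sqsubseteq>\<^bsub>Y \<tau>\<^esub> y" if "x \<in> C" "y \<in> C" for x y
    using place_le_iff[OF assms(1)] that assms(2) by blast
  then show ?thesis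
    using place_in[OF assms(1)] assms(2) unfolding chain_in_def by auto
qed

text \<open>All proper faces of a flag lie below its largest proper face, and hence occur at one node.\<close>

lemma flag_form:
  assumes "flag Z \<Phi>"
  obtains \<tau> \<Psi> where "node \<tau>" "flag (Y \<tau>) \<Psi>" "\<Phi> = insert None (place \<tau> ` \<Psi>)"
proof -
  have ch: "chain_in Z \<Phi>" and max: "\<And>S. chain_in Z S \<Longrightarrow> \<Phi> \<subseteq> S \<Longrightarrow> S = \<Phi>"
    using assms flag_iff_maximal[OF po_Z] by auto
  have "chain_in Z (insert None \<Phi>)" using ch unfolding chain_in_def by auto
  then have None: "None \<in> \<Phi>" using max by blast
  have sub: "\<Phi> \<subseteq> carrier Z" using ch unfolding chain_in_def by auto
  have "\<exists>\<tau>. node \<tau> \<and> \<Phi> - {None} \<subseteq> place \<tau> ` carrier (Y \<tau>)"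
  proof (cases "\<Phi> - {None} = {}")
    case True
    then have "\<Phi> - {None} \<subseteq> place [] ` carrier (Y [])" by blast
    then show ?thesis by (intro exI[of _ "[]"]) simp
  next
    case False
    have "inj_on (rk Z) \<Phi>"
    proof (rule inj_onI, rule ccontr)
      fix a b assume ab: "a \<in> \<Phi>" "b \<in> \<Phi>" "rk Z a = rk Z b" "a \<noteq> b"
      then have c: "a \<in> carrier Z" "b \<in> carrier Z" using sub by auto
      have "a \<sqsubseteq>\<^bsub>Z\<^esub> b \<or> b \<sqsubseteq>\<^bsub>Z\<^esub> a" using ch ab(1,2) unfolding chain_in_def by blast
      then show False using rk_less_Z[OF c] rk_less_Z[OF c(2,1)] ab(3,4) by auto
    qed
    moreover have "rk Z ` \<Phi> \<subseteq> {-1..d+1}"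
    proof
      fix k assume "k \<in> rk Z ` \<Phi>"
      then obtain a where a: "a \<in> carrier Z" "k = rk Z a" using sub by auto
      from a(1) show "k \<in> {-1..d+1}"
      proof (cases rule: Z_cases)
        case (2 \<tau> x)
        then show ?thesis using a(2) X.rk_range[OF 2(2)] rk_place[OF 2(1,2)] by simp
      qed (use a(2) d_ge1 in auto)
    qed
    ultimately have "finite \<Phi>" by (meson finite_atLeastAtMost_int finite_imageD finite_subset)
    then have fin: "finite (rk Z ` (\<Phi> - {None}))" by simp
    have "Max (rk Z ` (\<Phi> - {None})) \<in> rk Z ` (\<Phi> - {None})"
      by (rule Max_in[OF fin]) (use False in simp)
    then obtain b where b: "Max (rk Z ` (\<Phi> - {None})) = rk Z b" and b0: "b \<in> \<Phi> - {None}"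
      by (rule imageE)
    have bmax: "rk Z a \<le> rk Z b" if "a \<in> \<Phi> - {None}" for a
      unfolding b[symmetric] by (rule Max_ge[OF fin imageI[OF that]])
    have "b \<in> carrier Z" "b \<noteq> None" using b0 sub by auto
    then obtain \<tau> y where y: "node \<tau>" "y \<in> carrier (Y \<tau>)" "b = place \<tau> y"
      unfolding carrier_Z by blast
    have "a \<in> place \<tau> ` carrier (Y \<tau>)" if a: "a \<in> \<Phi> - {None}" for a
    proof -
      have "a \<sqsubseteq>\<^bsub>Z\<^esub> b"
      proof (rule ccontr)
        assume "\<not> a \<sqsubseteq>\<^bsub>Z\<^esub> b"
        moreover have "a \<sqsubseteq>\<^bsub>Z\<^esub> b \<or> b \<sqsubseteq>\<^bsub>Z\<^esub> a" using ch a b0 unfolding chain_in_def by blast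
        moreover have c: "a \<in> carrier Z" "b \<in> carrier Z" using a b0 sub by auto
        ultimately have "b \<sqsubseteq>\<^bsub>Z\<^esub> a" "b \<noteq> a" using Z.le_refl by auto
        then show False using rk_less_Z[OF c(2,1)] bmax[OF a] by simp
      qed
      then have "a \<sqsubseteq>\<^bsub>Z\<^esub> place \<tau> y" using y(3) by simp
      then show ?thesis by (rule place_transfer[OF _ y(1,2)]) blast
    qed
    then show ?thesis using y(1) by blast
  qed
  then obtain \<tau> where \<tau>: "node \<tau>" "\<Phi> - {None} \<subseteq> place \<tau> ` carrier (Y \<tau>)" by blast
  define \<Psi> where "\<Psi> = {x \<in> carrier (Y \<tau>). place \<tau> x \<in> \<Phi>}"
  have \<Phi>: "\<Phi> = insert None (place \<tau> ` \<Psi>)" unfolding \<Psi>_def using \<tau>(2) None by auto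
  have \<Psi>sub: "\<Psi> \<subseteq> carrier (Y \<tau>)" unfolding \<Psi>_def by auto
  have "chain_in (Y \<tau>) \<Psi>" using chain_place[OF \<tau>(1) \<Psi>sub] ch \<Phi> by simp
  moreover have "S = \<Psi>" if S: "chain_in (Y \<tau>) S" "\<Psi> \<subseteq> S" for S
  proof -
    have Ssub: "S \<subseteq> carrier (Y \<tau>)" using S(1) unfolding chain_in_def by auto
    have "insert None (place \<tau> ` S) = \<Phi>"
      by (rule max) (use chain_place[OF \<tau>(1) Ssub] S \<Phi> in auto)
    then have "S \<subseteq> \<Psi>" unfolding \<Psi>_def using Ssub by auto
    then show ?thesis using S(2) by simp
  qed
  ultimately have "flag (Y \<tau>) \<Psi>" using flag_iff_maximal[OF X.po] by blast
  then show ?thesis using that \<tau>(1) \<Phi> by blast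
qed

lemma graded_Z: "graded_poset (d + 1) Z"
proof (rule graded_poset.intro)
  show "partial_order Z" by (rule po_Z)
  show "-1 \<le> rk Z a \<and> rk Z a \<le> d + 1" if "a \<in> carrier Z" for a
    using that
  proof (cases rule: Z_cases)
    case (2 \<tau> x)
    then show ?thesis using X.rk_range[OF 2(2)] rk_place[OF 2(1,2)] by simp
  qed (use d_ge1 in auto)
  show "rk Z a < rk Z b" if "a \<in> carrier Z" "b \<in> carrier Z" "a \<sqsubseteq>\<^bsub>Z\<^esub> b" "a \<noteq> b" for a b
    by (rule rk_less_Z[OF that])
  obtain z where z: "least (X True) z (carrier (X True))" "rk (X True) z = -1" using X.least_ex by blast
  then have zc: "z \<in> carrier (X True)" unfolding least_def by auto
  have "least Z (place [] z) (carrier Z)"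
    unfolding least_def
  proof (intro conjI ballI)
    show "place [] z \<in> carrier Z" using place_in[of "[]" z] zc by simp
    fix a assume "a \<in> carrier Z"
    then show "place [] z \<sqsubseteq>\<^bsub>Z\<^esub> a"
    proof (cases rule: Z_cases)
      case (2 \<tau> x)
      obtain b where b: "least (Y \<tau>) b (carrier (Y \<tau>))" "rk (Y \<tau>) b = -1" using X.least_ex by blast
      then have bc: "b \<in> carrier (Y \<tau>)" "b \<sqsubseteq>\<^bsub>Y \<tau>\<^esub> x" using 2 unfolding least_def by auto
      have "place \<tau> b = place [] z" unfolding place_def using reduce_bottom[OF 2(1) bc(1) b(2) zc z(2)] by simp
      then show ?thesis using place_le_iff[OF 2(1) bc(1) 2(2)] bc(2) 2(3) by simp
    qed simp
  qed simp
  moreover have "rk Z (place [] z) = -1" using rk_place[of "[]" z] zc z(2) by simp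
  ultimately show "\<exists>F. least Z F (carrier Z) \<and> rk Z F = -1" by blast
  have "greatest Z None (carrier Z)" unfolding greatest_def by simp
  then show "\<exists>F. greatest Z F (carrier Z) \<and> rk Z F = d + 1" by force
  show "bij_betw (rk Z) \<Phi> {-1..d + 1}" if fl: "flag Z \<Phi>" for \<Phi>
  proof -
    obtain \<tau> \<Psi> where \<tau>: "node \<tau>" "flag (Y \<tau>) \<Psi>" "\<Phi> = insert None (place \<tau> ` \<Psi>)" by (rule flag_form[OF fl])
    have sub: "\<Psi> \<subseteq> carrier (Y \<tau>)" using X.flag_carrier[OF \<tau>(2)] by auto
    have "bij_betw (rk Z \<circ> place \<tau>) \<Psi> {-1..d}"
      using X.flag_ranks[OF \<tau>(2)] sub rk_place[OF \<tau>(1)] bij_betw_cong[of \<Psi> "rk Z \<circ> place \<tau>" "rk (Y \<tau>)"]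
      by (simp add: subset_iff)
    moreover have "bij_betw (place \<tau>) \<Psi> (place \<tau> ` \<Psi>)"
      using place_inj[OF \<tau>(1)] sub by (intro inj_on_imp_bij_betw inj_onI) blast
    ultimately have "bij_betw (rk Z) (place \<tau> ` \<Psi>) {-1..d}" using bij_betw_comp_iff by blast
    then have "bij_betw (rk Z) (place \<tau> ` \<Psi> \<union> {None}) ({-1..d} \<union> {rk Z None})"
      by (intro notIn_Un_bij_betw) auto
    moreover have "{-1..d} \<union> {rk Z None} = {-1..d + 1}" using d_ge1 by auto
    ultimately show ?thesis unfolding \<tau>(3) by simp
  qed
qed

sublocale Z: graded_poset "d + 1" Z
  by (rule graded_Z)

lemma flag_place:
  assumes "node \<tau>" "flag (Y \<tau>) \<Psi>"
  shows "flag Z (insert None (place \<tau> ` \<Psi>))"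
proof -
  have sub: "\<Psi> \<subseteq> carrier (Y \<tau>)" using X.flag_carrier[OF assms(2)] by auto
  have "rk Z ` place \<tau> ` \<Psi> = rk (Y \<tau>) ` \<Psi>"
    using sub rk_place[OF assms(1)] by (auto simp: image_image subset_iff)
  also have "\<dots> = {-1..d}" using X.flag_ranks[OF assms(2)] by (simp add: bij_betw_def)
  finally have "{-1..d+1} \<subseteq> rk Z ` insert None (place \<tau> ` \<Psi>)" by auto
  then show ?thesis
    using Z.flag_iff chain_place[OF assms(1) sub] X.flag_chain[OF assms(2)] by blast
qed

definition joined :: "('x list \<times> 'x) option set \<Rightarrow> ('x list \<times> 'x) option set \<Rightarrow> ('x list \<times> 'x) option set \<Rightarrow> bool" where
  "joined S \<Phi> \<Psi> \<longleftrightarrow> adjacent_flags Z \<Phi> \<Psi> \<and> S \<subseteq> \<Phi> \<and> S \<subseteq> \<Psi>"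

lemma joined_sym: "(joined S)\<^sup>*\<^sup>* \<Phi> \<Psi> \<Longrightarrow> (joined S)\<^sup>*\<^sup>* \<Psi> \<Phi>"
proof (induction rule: rtranclp_induct)
  case (step A B)
  then have "joined S B A" unfolding joined_def adjacent_flags_def by blast
  then show ?case using step.IH by (rule converse_rtranclp_into_rtranclp)
qed simp

lemma adjacent_place:
  assumes "node \<tau>" "adjacent_flags (Y \<tau>) A A'"
  shows "adjacent_flags Z (insert None (place \<tau> ` A)) (insert None (place \<tau> ` A'))"
proof -
  have fl: "flag (Y \<tau>) A" "flag (Y \<tau>) A'" and card: "card (A - A') = 1" "card (A' - A) = 1"
    using assms(2) unfolding adjacent_flags_def by auto
  have sub: "A \<subseteq> carrier (Y \<tau>)" "A' \<subseteq> carrier (Y \<tau>)"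
    using X.flag_carrier[OF fl(1)] X.flag_carrier[OF fl(2)] by auto
  have inj: "inj_on (place \<tau>) (carrier (Y \<tau>))" by (rule inj_onI) (rule place_inj[OF assms(1)])
  have diff: "insert None (place \<tau> ` C) - insert None (place \<tau> ` D) = place \<tau> ` (C - D)"
    if "C \<subseteq> carrier (Y \<tau>)" "D \<subseteq> carrier (Y \<tau>)" for C D
    using inj_on_image_set_diff[OF inj, of C D] that by auto
  have "card (place \<tau> ` (C - D)) = card (C - D)" if "C \<subseteq> carrier (Y \<tau>)" for C D
    using that by (intro card_image inj_on_subset[OF inj]) auto
  then show ?thesis
    using flag_place[OF assms(1) fl(1)] flag_place[OF assms(1) fl(2)] diff sub card
    unfolding adjacent_flags_def by simp
qed

lemma joined_same_node:
  assumes "node \<tau>" "flag (Y \<tau>) A" "flag (Y \<tau>) A'"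
    and S: "S \<subseteq> insert None (place \<tau> ` A)" "S \<subseteq> insert None (place \<tau> ` A')"
  shows "(joined S)\<^sup>*\<^sup>* (insert None (place \<tau> ` A)) (insert None (place \<tau> ` A'))"
proof -
  define I where "I = A \<inter> A'"
  have SI: "S \<subseteq> insert None (place \<tau> ` I)"
  proof
    fix s assume s: "s \<in> S"
    show "s \<in> insert None (place \<tau> ` I)"
    proof (cases "s = None")
      case False
      then obtain x y where "x \<in> A" "s = place \<tau> x" "y \<in> A'" "s = place \<tau> y" using s S by blast
      then have "x = y" using place_inj[OF assms(1)] X.flag_carrier[OF assms(2)] X.flag_carrier[OF assms(3)] by metis
      then show ?thesis using \<open>x \<in> A\<close> \<open>y \<in> A'\<close> \<open>s = place \<tau> x\<close> unfolding I_def by blast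
    qed simp
  qed
  have "(\<lambda>C D. adjacent_flags (Y \<tau>) C D \<and> I \<subseteq> C \<and> I \<subseteq> D)\<^sup>*\<^sup>* A A'"
    using X.connected assms(2,3) unfolding strongly_flag_connected_def I_def by blast
  then show ?thesis
  proof (induction rule: rtranclp_induct)
    case (step C D)
    have CD: "adjacent_flags (Y \<tau>) C D" "I \<subseteq> C" "I \<subseteq> D" using step.hyps(2) by auto
    have "S \<subseteq> insert None (place \<tau> ` C)" "S \<subseteq> insert None (place \<tau> ` D)"
      using SI image_mono[OF CD(2), of "place \<tau>"] image_mono[OF CD(3), of "place \<tau>"] by blast+
    then have "joined S (insert None (place \<tau> ` C)) (insert None (place \<tau> ` D))"
      unfolding joined_def using adjacent_place[OF assms(1) CD(1)] by simp
    with step.IH show ?case by (rule rtranclp.rtrancl_into_rtrancl)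
  qed simp
qed

text \<open>First walk, within the node, to a flag through the base facet; then cross the base facet into the parent.
The faces in \<open>S\<close> are kept, as they lie below the base facet.\<close>

lemma joined_to_parent:
  assumes node: "node (F # \<tau>)" and A: "flag (Y (F # \<tau>)) A" and S: "S \<subseteq> insert None (place (F # \<tau>) ` A)"
    and below: "\<And>x. \<lbrakk>x \<in> A; place (F # \<tau>) x \<in> S\<rbrakk> \<Longrightarrow> in_base (kind (F # \<tau>)) x"
  obtains A' where "flag (Y \<tau>) A'" "S \<subseteq> insert None (place \<tau> ` A')"
    "(joined S)\<^sup>*\<^sup>* (insert None (place (F # \<tau>) ` A)) (insert None (place \<tau> ` A'))"
proof -
  let ?Y = "X (\<not> kind \<tau>)" and ?B = "B (\<not> kind \<tau>)"
  have n: "node \<tau>" "F \<in> faces_of_rank (d - 1) (Y \<tau>)" using node by auto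
  have A_flag: "flag ?Y A" using A by simp
  have "chain_in ?Y (insert ?B {x \<in> A. x \<sqsubseteq>\<^bsub>?Y\<^esub> ?B})"
    using X.flag_chain[OF A_flag] Bc(1)[of "\<not> kind \<tau>"] unfolding chain_in_def by auto
  then obtain A1 where A1: "flag ?Y A1" "insert ?B {x \<in> A. x \<sqsubseteq>\<^bsub>?Y\<^esub> ?B} \<subseteq> A1"
    by (rule X.chain_extends)
  \<comment> \<open>A flag through the base facet consists of the greatest face of the copy and of faces below the base facet.\<close>
  define M where "M = {x \<in> A1. x \<sqsubseteq>\<^bsub>?Y\<^esub> ?B}"
  have Mc: "x \<in> carrier ?Y" "x \<sqsubseteq>\<^bsub>?Y\<^esub> ?B" if "x \<in> M" for x
    using that X.flag_carrier[OF A1(1)] unfolding M_def by auto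
  have S_M: "S \<subseteq> insert None (place (F # \<tau>) ` M)"
  proof
    fix s assume s: "s \<in> S"
    show "s \<in> insert None (place (F # \<tau>) ` M)"
    proof (cases "s = None")
      case False
      then obtain x where x: "x \<in> A" "s = place (F # \<tau>) x" using s S by blast
      then have "x \<in> M" using below[OF x(1)] s A1(2) unfolding M_def by auto
      then show ?thesis using x(2) by blast
    qed simp
  qed
  have A1_eq: "A1 = insert (top_face (\<not> kind \<tau>)) M"
  proof (intro equalityI subsetI)
    fix x assume x: "x \<in> A1"
    have xc: "x \<in> carrier ?Y" by (rule X.flag_carrier[OF A1(1) x])
    show "x \<in> insert (top_face (\<not> kind \<tau>)) M"
    proof (cases "rk ?Y x = d")
      case True
      then show ?thesis using eq_top_face[OF xc] by simp
    next
      case False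
      then have "rk ?Y x \<le> rk ?Y ?B" using X.rk_range[OF xc] Bc(2) by simp
      then have "x \<sqsubseteq>\<^bsub>?Y\<^esub> ?B" using X.flag_total[OF A1(1) x] A1(2) by blast
      then show ?thesis using x unfolding M_def by simp
    qed
  next
    fix x assume "x \<in> insert (top_face (\<not> kind \<tau>)) M"
    moreover have "face ?Y A1 d = top_face (\<not> kind \<tau>)"
      using eq_top_face X.face_carrier[OF A1(1), of d] X.rk_face[OF A1(1), of d] d_ge1 by simp
    then have "top_face (\<not> kind \<tau>) \<in> A1" using X.face_in[OF A1(1), of d] d_ge1 by simp
    ultimately show "x \<in> A1" unfolding M_def by auto
  qed
  let ?u = "glue (kind \<tau>) F"
  have um: "?u x \<in> carrier (Y \<tau>)" "?u x \<sqsubseteq>\<^bsub>Y \<tau>\<^esub> F" "rk (Y \<tau>) (?u x) = rk ?Y x" "place \<tau> (?u x) = place (F # \<tau>) x"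
    if "x \<in> M" for x
    using glue_in[OF n(2) Mc[OF that]] glue_rk[OF n(2) Mc[OF that]] Mc[OF that] unfolding place_def by auto
  \<comment> \<open>The same faces, seen from the parent.\<close>
  define A2 where "A2 = insert (top_face (kind \<tau>)) (?u ` M)"
  have A2: "flag (Y \<tau>) A2"
  proof (rule iffD2[OF X.flag_iff], intro conjI)
    have "?u x \<sqsubseteq>\<^bsub>Y \<tau>\<^esub> ?u y \<or> ?u y \<sqsubseteq>\<^bsub>Y \<tau>\<^esub> ?u x" if xy: "x \<in> M" "y \<in> M" for x y
    proof -
      have "x \<sqsubseteq>\<^bsub>?Y\<^esub> y \<or> y \<sqsubseteq>\<^bsub>?Y\<^esub> x"
        using X.flag_chain[OF A1(1)] xy unfolding chain_in_def M_def by blast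
      then show ?thesis
        using glue_le_iff[OF n(2) Mc[OF xy(1)] Mc[OF xy(2)]] glue_le_iff[OF n(2) Mc[OF xy(2)] Mc[OF xy(1)]] by blast
    qed
    then show "chain_in (Y \<tau>) A2"
      unfolding chain_in_def A2_def using um(1) top_face(1,3) by auto
    have "{-1..d} = rk ?Y ` A1" using X.flag_ranks[OF A1(1)] by (simp add: bij_betw_def)
    also have "\<dots> \<subseteq> rk (Y \<tau>) ` A2"
      unfolding A1_eq A2_def using um(3) top_face(2) by (auto simp: image_image)
    finally show "{-1..d} \<subseteq> rk (Y \<tau>) ` A2" .
  qed
  let ?N = "insert None (place (F # \<tau>) ` M)"
  have eM: "place \<tau> ` ?u ` M = place (F # \<tau>) ` M" using um(4) by (auto simp: image_image)
  have \<Phi>1: "insert None (place (F # \<tau>) ` A1) = insert (node_facet (F # \<tau>)) ?N" unfolding A1_eq node_facet_def by auto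
  have \<Phi>2: "insert None (place \<tau> ` A2) = insert (node_facet \<tau>) ?N" unfolding A2_def node_facet_def using eM by auto
  have neq: "node_facet (F # \<tau>) \<noteq> node_facet \<tau>" unfolding node_facet_eq by simp
  have rkM: "rk Z a \<noteq> d" if aN: "a \<in> ?N" for a
  proof (cases "a = None")
    case False
    then obtain x where x: "x \<in> M" "a = place (F # \<tau>) x" using aN by blast
    have "rk Z a = rk ?Y x" using rk_place[OF node, of x] x Mc(1) by simp
    also have "\<dots> \<le> d - 1" using X.rk_le[OF Mc(1)[OF x(1)] Bc(1) Mc(2)[OF x(1)]] Bc(2) by simp
    finally show ?thesis by simp
  qed simp
  have diff: "insert x N - insert y N = {x}" if "x \<notin> N" "y \<notin> N" "x \<noteq> y" for x y and N :: "('x list \<times> 'x) option set"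
    using that by blast
  have notin: "node_facet (F # \<tau>) \<notin> ?N" "node_facet \<tau> \<notin> ?N"
    using rkM node_facet_carrier(2)[OF node] node_facet_carrier(2)[OF n(1)] by blast+
  have "insert (node_facet (F # \<tau>)) ?N - insert (node_facet \<tau>) ?N = {node_facet (F # \<tau>)}"
    "insert (node_facet \<tau>) ?N - insert (node_facet (F # \<tau>)) ?N = {node_facet \<tau>}"
    using diff[OF notin neq] diff[OF notin(2,1) neq[symmetric]] by blast+
  then have "adjacent_flags Z (insert None (place (F # \<tau>) ` A1)) (insert None (place \<tau> ` A2))"
    unfolding adjacent_flags_def using flag_place[OF node, of A1] flag_place[OF n(1) A2] A1(1) \<Phi>1 \<Phi>2 by simp
  then have j: "joined S (insert None (place (F # \<tau>) ` A1)) (insert None (place \<tau> ` A2))"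
    unfolding joined_def \<Phi>1 \<Phi>2 using S_M by blast
  then have S1: "S \<subseteq> insert None (place (F # \<tau>) ` A1)" "S \<subseteq> insert None (place \<tau> ` A2)" unfolding joined_def by auto
  have "(joined S)\<^sup>*\<^sup>* (insert None (place (F # \<tau>) ` A)) (insert None (place (F # \<tau>) ` A1))"
    by (rule joined_same_node[OF node A _ S S1(1)]) (use A1(1) in simp)
  then have "(joined S)\<^sup>*\<^sup>* (insert None (place (F # \<tau>) ` A)) (insert None (place \<tau> ` A2))"
    using j by (rule rtranclp.rtrancl_into_rtrancl)
  then show ?thesis using that A2 S1(2) by blast
qed

lemma below_base:
  assumes "node \<tau>" "flag (Y \<tau>) A" "node \<upsilon>" "flag (Y \<upsilon>) A'" "length \<upsilon> \<le> length \<tau>" "\<tau> \<noteq> \<upsilon>"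
    and "S \<subseteq> insert None (place \<upsilon> ` A')" "x \<in> A" "place \<tau> x \<in> S"
  shows "in_base (kind \<tau>) x"
proof -
  obtain y where y: "y \<in> A'" "place \<tau> x = place \<upsilon> y" using assms(7,9) by auto
  then have eq: "reduce \<tau> x = reduce \<upsilon> y" unfolding place_def by simp
  show ?thesis
    by (rule reduce_common[OF assms(1) X.flag_carrier[OF assms(2,8)] assms(3) X.flag_carrier[OF assms(4) y(1)] eq assms(5,6)])
qed

text \<open>Induction on the distances from the root: the proper faces that two flags at different nodes have in
common also occur at the parent of a node of maximal distance, so the flag at that node can be moved to its parent.\<close>

lemma joined_all:
  "\<lbrakk>node \<tau>; flag (Y \<tau>) A; node \<upsilon>; flag (Y \<upsilon>) A'; S \<subseteq> insert None (place \<tau> ` A); S \<subseteq> insert None (place \<upsilon> ` A')\<rbrakk> \<Longrightarrow>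
   (joined S)\<^sup>*\<^sup>* (insert None (place \<tau> ` A)) (insert None (place \<upsilon> ` A'))"
proof (induction "length \<tau> + length \<upsilon>" arbitrary: \<tau> \<upsilon> A A' rule: less_induct)
  case less
  note \<tau> = less.prems(1,2) and \<upsilon> = less.prems(3,4) and S = less.prems(5,6)
  consider "\<tau> = \<upsilon>" | "\<tau> \<noteq> \<upsilon>" "length \<upsilon> \<le> length \<tau>" | "\<upsilon> \<noteq> \<tau>" "length \<tau> \<le> length \<upsilon>"
    using le_cases[of "length \<upsilon>" "length \<tau>"] by metis
  then show ?case
  proof cases
    case 1
    then show ?thesis using joined_same_node[OF \<tau> _ S(1)] \<upsilon>(2) S(2) by simp
  next
    case 2
    then obtain F \<tau>' where F: "\<tau> = F # \<tau>'" by (cases \<tau>) auto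
    have b: "in_base (kind \<tau>) x" if "x \<in> A" "place \<tau> x \<in> S" for x
      by (rule below_base[OF \<tau> \<upsilon> 2(2,1) S(2) that])
    obtain A'' where A'': "flag (Y \<tau>') A''" "S \<subseteq> insert None (place \<tau>' ` A'')"
      "(joined S)\<^sup>*\<^sup>* (insert None (place \<tau> ` A)) (insert None (place \<tau>' ` A''))"
      using joined_to_parent[of F \<tau>' A S] \<tau> S(1) b unfolding F by blast
    have "(joined S)\<^sup>*\<^sup>* (insert None (place \<tau>' ` A'')) (insert None (place \<upsilon> ` A'))"
      by (rule less.hyps[OF _ _ A''(1) \<upsilon> A''(2) S(2)]) (use F \<tau> in auto)
    with A''(3) show ?thesis by (rule rtranclp_trans)
  next
    case 3
    then obtain F \<upsilon>' where F: "\<upsilon> = F # \<upsilon>'" by (cases \<upsilon>) auto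
    have b: "in_base (kind \<upsilon>) x" if "x \<in> A'" "place \<upsilon> x \<in> S" for x
      by (rule below_base[OF \<upsilon> \<tau> 3(2,1) S(1) that])
    obtain A'' where A'': "flag (Y \<upsilon>') A''" "S \<subseteq> insert None (place \<upsilon>' ` A'')"
      "(joined S)\<^sup>*\<^sup>* (insert None (place \<upsilon> ` A')) (insert None (place \<upsilon>' ` A''))"
      using joined_to_parent[of F \<upsilon>' A' S] \<upsilon> S(2) b unfolding F by blast
    have "(joined S)\<^sup>*\<^sup>* (insert None (place \<tau> ` A)) (insert None (place \<upsilon>' ` A''))"
      by (rule less.hyps[OF _ \<tau> _ A''(1) S(1) A''(2)]) (use F \<upsilon> in auto)
    then show ?thesis using joined_sym[OF A''(3)] by (rule rtranclp_trans)
  qed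
qed

lemma connected_Z: "strongly_flag_connected Z"
  unfolding strongly_flag_connected_def
proof (intro allI impI)
  fix \<Phi> \<Psi> assume fl: "flag Z \<Phi>" "flag Z \<Psi>"
  obtain \<tau> A where \<tau>: "node \<tau>" "flag (Y \<tau>) A" "\<Phi> = insert None (place \<tau> ` A)" by (rule flag_form[OF fl(1)])
  obtain \<upsilon> A' where \<upsilon>: "node \<upsilon>" "flag (Y \<upsilon>) A'" "\<Psi> = insert None (place \<upsilon> ` A')" by (rule flag_form[OF fl(2)])
  have "(joined (\<Phi> \<inter> \<Psi>))\<^sup>*\<^sup>* \<Phi> \<Psi>"
    unfolding \<tau>(3) \<upsilon>(3) by (rule joined_all[OF \<tau>(1,2) \<upsilon>(1,2)]) auto
  then show "(\<lambda>A B. adjacent_flags Z A B \<and> \<Phi> \<inter> \<Psi> \<subseteq> A \<and> \<Phi> \<inter> \<Psi> \<subseteq> B)\<^sup>*\<^sup>* \<Phi> \<Psi>"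
    unfolding joined_def .
qed

lemma eq_base: "\<lbrakk>x \<in> carrier (X k); rk (X k) x = d - 1; in_base k x\<rbrakk> \<Longrightarrow> x = B k"
  using X.eq_of_rk[of x k "B k"] Bc by simp

text \<open>A ridge of the glued polytope corresponds to an edge of the tree: the face \<open>F\<close> of rank \<open>d - 1\<close> at the
node \<open>\<sigma>\<close>, shared with the child \<open>F # \<sigma>\<close>.\<close>

lemma ridge_cases:
  assumes "a \<in> carrier Z" "rk Z a = d - 1"
  obtains \<sigma> F where "node (F # \<sigma>)" "a = Some (\<sigma>, F)"
  using assms(1)
proof (cases rule: Z_cases)
  case 1
  then show ?thesis using assms(2) by simp
next
  case (2 \<tau> x)
  obtain \<sigma> F where r: "reduce \<tau> x = (\<sigma>, F)" by (cases "reduce \<tau> x")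
  note p = reduce_props[OF 2(1,2) r]
  have rkF: "rk (Y \<sigma>) F = d - 1" using p assms(2) rk_place[OF 2(1,2)] 2(3) by simp
  then have "node (F # \<sigma>)" using p Bc(1) X.le_refl by (auto simp: faces_of_rank_def)
  then show ?thesis by (rule that) (use 2(3) r in \<open>simp add: place_def\<close>)
qed

lemma ridge_props:
  assumes "node (F # \<sigma>)"
  shows "Some (\<sigma>, F) = place \<sigma> F" "Some (\<sigma>, F) = place (F # \<sigma>) (base (F # \<sigma>))" "F \<in> carrier (Y \<sigma>)" "rk (Y \<sigma>) F = d - 1"
    "Some (\<sigma>, F) \<in> carrier Z" "rk Z (Some (\<sigma>, F)) = d - 1"
proof -
  have F: "F \<in> faces_of_rank (d - 1) (Y \<sigma>)" "node \<sigma>" "\<sigma> = [] \<or> F \<noteq> base \<sigma>" using assms by auto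
  show Fc: "F \<in> carrier (Y \<sigma>)" "rk (Y \<sigma>) F = d - 1" using F(1) unfolding faces_of_rank_def by auto
  have "\<sigma> = [] \<or> \<not> in_base (kind \<sigma>) F" using F(3) eq_base[OF Fc] by auto
  then have r: "reduce \<sigma> F = (\<sigma>, F)" by (rule reduce_reduced)
  then show place: "Some (\<sigma>, F) = place \<sigma> F" unfolding place_def by simp
  show "Some (\<sigma>, F) = place (F # \<sigma>) (base (F # \<sigma>))"
    unfolding place_def using r glue_B[OF F(1)] X.le_refl[OF Bc(1)] by simp
  show "Some (\<sigma>, F) \<in> carrier Z" using place_in[OF F(2) Fc(1)] place by simp
  show "rk Z (Some (\<sigma>, F)) = d - 1" using rk_place[OF F(2) Fc(1)] Fc(2) place by simp
qed

lemma ridge_below: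
  assumes "node (F # \<sigma>)" "node \<tau>"
  shows "Some (\<sigma>, F) \<sqsubseteq>\<^bsub>Z\<^esub> node_facet \<tau> \<longleftrightarrow> \<tau> = \<sigma> \<or> \<tau> = F # \<sigma>"
proof
  note R = ridge_props[OF assms(1)]
  assume "Some (\<sigma>, F) \<sqsubseteq>\<^bsub>Z\<^esub> node_facet \<tau>"
  then obtain x where x: "x \<in> carrier (Y \<tau>)" "Some (\<sigma>, F) = place \<tau> x" using below_node_facet[OF assms(2)] by blast
  have rx: "rk (Y \<tau>) x = d - 1" using rk_place[OF assms(2) x(1)] x(2) R(6) by simp
  have reduce: "reduce \<tau> x = (\<sigma>, F)" using x(2) unfolding place_def by simp
  show "\<tau> = \<sigma> \<or> \<tau> = F # \<sigma>"
  proof (cases \<tau>)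
    case Nil
    then show ?thesis using reduce by simp
  next
    case (Cons G \<upsilon>)
    show ?thesis
    proof (cases "in_base (kind \<tau>) x")
      case False
      then show ?thesis using reduce Cons by auto
    next
      case True
      then have "x = base \<tau>" using eq_base[OF x(1) rx] by simp
      then have "place (G # \<upsilon>) (base (G # \<upsilon>)) = Some (\<sigma>, F)" using x(2) Cons by simp
      then have "Some (\<upsilon>, G) = Some (\<sigma>, F)" using ridge_props(2)[of G \<upsilon>] assms(2) Cons by simp
      then show ?thesis using Cons by simp
    qed
  qed
next
  note R = ridge_props[OF assms(1)]
  assume "\<tau> = \<sigma> \<or> \<tau> = F # \<sigma>"
  then show "Some (\<sigma>, F) \<sqsubseteq>\<^bsub>Z\<^esub> node_facet \<tau>"
  proof
    assume "\<tau> = \<sigma>"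
    then show ?thesis using R(1,3) unfolding below_node_facet[OF assms(2)] by blast
  next
    assume "\<tau> = F # \<sigma>"
    then show ?thesis using R(2) Bc(1) unfolding below_node_facet[OF assms(2)] by blast
  qed
qed

lemma diamond_Z: "diamond_condition Z"
  unfolding diamond_condition_def
proof (intro ballI allI impI)
  fix a b j
  assume a: "a \<in> carrier Z" and b: "b \<in> carrier Z" and ab: "a \<sqsubseteq>\<^bsub>Z\<^esub> b" "rk Z a = j - 1" "rk Z b = j + 1"
  let ?S = "{c \<in> carrier Z. rk Z c = j \<and> a \<sqsubseteq>\<^bsub>Z\<^esub> c \<and> c \<sqsubseteq>\<^bsub>Z\<^esub> b}"
  from b show "card ?S = 2"
  proof (cases rule: Z_cases)
    case 1
    then have j: "j = d" using ab(3) by simp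
    have "rk Z a = d - 1" using ab(2) j by simp
    then obtain \<sigma> F where F: "node (F # \<sigma>)" "a = Some (\<sigma>, F)" by (rule ridge_cases[OF a])
    have n: "node \<sigma>" using F(1) by simp
    have "?S = {node_facet \<sigma>, node_facet (F # \<sigma>)}"
    proof (intro equalityI subsetI)
      fix c assume c: "c \<in> ?S"
      then have c': "c \<in> carrier Z" "rk Z c = d" "a \<sqsubseteq>\<^bsub>Z\<^esub> c" using j by auto
      obtain \<tau> where "node \<tau>" "c = node_facet \<tau>" by (rule rk_d_node_facet[OF c'(1,2)])
      then show "c \<in> {node_facet \<sigma>, node_facet (F # \<sigma>)}" using ridge_below[OF F(1)] c'(3) F(2) by auto
    next
      fix c assume "c \<in> {node_facet \<sigma>, node_facet (F # \<sigma>)}"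
      then obtain \<tau> where \<tau>: "c = node_facet \<tau>" "\<tau> = \<sigma> \<or> \<tau> = F # \<sigma>" by blast
      then have "node \<tau>" using F(1) n by auto
      then show "c \<in> ?S" using ridge_below[OF F(1), of \<tau>] \<tau> node_facet_carrier[of \<tau>] j 1 F(2) by simp
    qed
    moreover have "node_facet \<sigma> \<noteq> node_facet (F # \<sigma>)" unfolding node_facet_eq by simp
    ultimately show ?thesis by simp
  next
    case (2 \<tau> y)
    have "a \<sqsubseteq>\<^bsub>Z\<^esub> place \<tau> y" using ab(1) 2(3) by simp
    then obtain x where x: "x \<in> carrier (Y \<tau>)" "x \<sqsubseteq>\<^bsub>Y \<tau>\<^esub> y" "a = place \<tau> x"
      by (rule place_transfer[OF _ 2(1,2)])
    define H where "H = {h \<in> carrier (Y \<tau>). rk (Y \<tau>) h = j \<and> x \<sqsubseteq>\<^bsub>Y \<tau>\<^esub> h \<and> h \<sqsubseteq>\<^bsub>Y \<tau>\<^esub> y}"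
    have "?S = place \<tau> ` H"
    proof (intro equalityI subsetI)
      fix c assume c: "c \<in> ?S"
      then have "c \<sqsubseteq>\<^bsub>Z\<^esub> place \<tau> y" using 2(3) by simp
      then obtain h where h: "h \<in> carrier (Y \<tau>)" "h \<sqsubseteq>\<^bsub>Y \<tau>\<^esub> y" "c = place \<tau> h"
        by (rule place_transfer[OF _ 2(1,2)])
      then have "h \<in> H" using c x(3) place_le_iff[OF 2(1) x(1) h(1)] rk_place[OF 2(1) h(1)] unfolding H_def by simp
      then show "c \<in> place \<tau> ` H" using h(3) by simp
    next
      fix c assume "c \<in> place \<tau> ` H"
      then obtain h where h: "h \<in> H" "c = place \<tau> h" by blast
      then show "c \<in> ?S"
        using place_le_iff[OF 2(1) x(1), of h] place_le_iff[OF 2(1) _ 2(2), of h] rk_place[OF 2(1), of h] place_in[OF 2(1), of h]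
          x(3) 2(3) unfolding H_def by simp
    qed
    moreover have "card (place \<tau> ` H) = card H"
    proof (rule card_image, rule inj_onI)
      show "h = h'" if "h \<in> H" "h' \<in> H" "place \<tau> h = place \<tau> h'" for h h'
        using place_inj[OF 2(1) _ _ that(3)] that(1,2) unfolding H_def by simp
    qed
    moreover have "rk (Y \<tau>) x = j - 1" "rk (Y \<tau>) y = j + 1"
      using ab(2,3) x(3) 2(3) rk_place[OF 2(1) x(1)] rk_place[OF 2(1,2)] by auto
    then have "card H = 2"
      using X.diamond x(1,2) 2(2) unfolding diamond_condition_def H_def by blast
    ultimately show ?thesis by simp
  qed
qed

sublocale Z: abstract_polytope "d + 1" Z
  by unfold_locales (rule connected_Z, rule diamond_Z)

lemma cross_Z:
  assumes "cross (d + 1) Z R G H"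
  obtains \<sigma> F where "node (F # \<sigma>)" "R = Some (\<sigma>, F)" "G = node_facet \<sigma> \<and> H = node_facet (F # \<sigma>) \<or> G = node_facet (F # \<sigma>) \<and> H = node_facet \<sigma>"
proof -
  have *: "R \<in> carrier Z" "rk Z R = d - 1" "G \<in> carrier Z" "rk Z G = d" "H \<in> carrier Z" "rk Z H = d"
    "R \<sqsubseteq>\<^bsub>Z\<^esub> G" "R \<sqsubseteq>\<^bsub>Z\<^esub> H" "G \<noteq> H"
    using assms unfolding cross_def faces_of_rank_def by auto
  obtain \<sigma> F where F: "node (F # \<sigma>)" "R = Some (\<sigma>, F)" by (rule ridge_cases[OF *(1,2)])
  obtain \<tau> where \<tau>: "node \<tau>" "G = node_facet \<tau>" by (rule rk_d_node_facet[OF *(3,4)])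
  obtain \<upsilon> where \<upsilon>: "node \<upsilon>" "H = node_facet \<upsilon>" by (rule rk_d_node_facet[OF *(5,6)])
  show ?thesis
    using that[OF F] ridge_below[OF F(1) \<tau>(1)] ridge_below[OF F(1) \<upsilon>(1)] * F(2) \<tau>(2) \<upsilon>(2) by auto
qed

text \<open>After a step down the tree, a path without backtracking can never turn upwards again.\<close>

lemma descending_path:
  "\<lbrakk>ridge_path (d + 1) Z (node_facet (F # \<sigma>)) Rs H; distinct_adj (Some (\<sigma>, F) # Rs)\<rbrakk> \<Longrightarrow> \<exists>\<rho>. H = node_facet (\<rho> @ F # \<sigma>)"
proof (induction Rs arbitrary: F \<sigma>)
  case Nil
  then show ?case by (intro exI[of _ "[]"]) simp
next
  case (Cons R Rs)
  then obtain M where M: "cross (d + 1) Z R (node_facet (F # \<sigma>)) M" "ridge_path (d + 1) Z M Rs H" by auto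
  obtain \<sigma>' F' where c: "node (F' # \<sigma>')" "R = Some (\<sigma>', F')"
    "node_facet (F # \<sigma>) = node_facet \<sigma>' \<and> M = node_facet (F' # \<sigma>') \<or> node_facet (F # \<sigma>) = node_facet (F' # \<sigma>') \<and> M = node_facet \<sigma>'"
    by (rule cross_Z[OF M(1)])
  have "R \<noteq> Some (\<sigma>, F)" "distinct_adj (R # Rs)" using Cons.prems(2) by auto
  then have "\<sigma>' = F # \<sigma>" "M = node_facet (F' # F # \<sigma>)" using c(2,3) node_facet_inj by auto
  then have "\<exists>\<rho>. H = node_facet (\<rho> @ F' # F # \<sigma>)"
    using Cons.IH[of F' "F # \<sigma>"] M(2) c(2) \<open>distinct_adj (R # Rs)\<close> by simp
  then obtain \<rho> where "H = node_facet (\<rho> @ F' # F # \<sigma>)" by blast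
  then show ?case by (intro exI[of _ "\<rho> @ [F']"]) simp
qed

end

lemma (in abstract_polytope) ridge_path_rev: "ridge_path n T G Rs H \<Longrightarrow> ridge_path n T H (rev Rs) G"
proof (induction Rs arbitrary: G)
  case (Cons R Rs)
  then obtain M where M: "cross n T R G M" "ridge_path n T M Rs H" by auto
  have "ridge_path n T M [R] G" using cross_sym[OF M(1)] by (auto simp: cross_def)
  then show ?case using Cons.IH[OF M(2)] by (auto simp: ridge_path_append)
qed simp

context gluing
begin

lemma first_step_up:
  assumes "ridge_path (d + 1) Z G (R # Rs) G" "distinct_adj (R # Rs)"
  obtains \<sigma> F where "node (F # \<sigma>)" "R = Some (\<sigma>, F)" "G = node_facet (F # \<sigma>)" "ridge_path (d + 1) Z (node_facet \<sigma>) Rs G"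
    "cross (d + 1) Z R G (node_facet \<sigma>)"
proof -
  obtain M where M: "cross (d + 1) Z R G M" "ridge_path (d + 1) Z M Rs G" using assms(1) by auto
  obtain \<sigma> F where c: "node (F # \<sigma>)" "R = Some (\<sigma>, F)"
    "G = node_facet \<sigma> \<and> M = node_facet (F # \<sigma>) \<or> G = node_facet (F # \<sigma>) \<and> M = node_facet \<sigma>"
    by (rule cross_Z[OF M(1)])
  have "False" if down: "G = node_facet \<sigma>" "M = node_facet (F # \<sigma>)"
  proof -
    obtain \<rho> where "G = node_facet (\<rho> @ F # \<sigma>)"
      using descending_path[of F \<sigma> Rs G] M(2) assms(2) c(2) down(2) by auto
    then have "node_facet \<sigma> = node_facet (\<rho> @ F # \<sigma>)" using down(1) by simp
    then have "\<sigma> = \<rho> @ F # \<sigma>" by (rule node_facet_inj)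
    then have "length \<sigma> = length (\<rho> @ F # \<sigma>)" by (rule arg_cong)
    then show False by simp
  qed
  then have "G = node_facet (F # \<sigma>)" "M = node_facet \<sigma>" using c(3) by metis+
  then show ?thesis using that[OF c(1,2)] M by simp
qed

text \<open>A shortest counterexample must start and end with a step up, from and to the same facet, hence across
the same ridge. Removing both steps leaves a shorter counterexample.\<close>

lemma treelike_Z: "treelike (d + 1) Z"
proof -
  have "Rs = []" if "ridge_path (d + 1) Z G Rs G" "distinct_adj Rs" for G Rs
    using that
  proof (induction "length Rs" arbitrary: G Rs rule: less_induct)
    case less
    show ?case
    proof (rule ccontr)
      assume "Rs \<noteq> []"
      then obtain R Rs1 where Rs: "Rs = R # Rs1" by (cases Rs) auto
      obtain \<sigma> F where up: "node (F # \<sigma>)" "R = Some (\<sigma>, F)" "G = node_facet (F # \<sigma>)" "ridge_path (d + 1) Z (node_facet \<sigma>) Rs1 G"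
        "cross (d + 1) Z R G (node_facet \<sigma>)"
        by (rule first_step_up[of G R Rs1]) (use less.prems Rs in auto)
      have "Rs1 \<noteq> []" using up(3,4) node_facet_inj[of "F # \<sigma>" \<sigma>] by auto
      then obtain R' Rs2 where Rs1: "Rs1 = Rs2 @ [R']" by (cases Rs1 rule: rev_cases) auto
      have "ridge_path (d + 1) Z G (rev Rs) G" by (rule Z.ridge_path_rev[OF less.prems(1)])
      then have rev: "ridge_path (d + 1) Z G (R' # rev (R # Rs2)) G" using Rs Rs1 by simp
      have "distinct_adj (rev Rs)" using less.prems(2) by simp
      then have drev: "distinct_adj (R' # rev (R # Rs2))" using Rs Rs1 by simp
      obtain \<sigma>' F' where up': "node (F' # \<sigma>')" "R' = Some (\<sigma>', F')" "G = node_facet (F' # \<sigma>')"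
        "ridge_path (d + 1) Z (node_facet \<sigma>') (rev (R # Rs2)) G"
        by (rule first_step_up[OF rev drev])
      have same: "\<sigma>' = \<sigma>" "F' = F" using up(3) up'(3) node_facet_inj by auto
      then have RR: "R' = R" using up(2) up'(2) by simp
      obtain M where M: "ridge_path (d + 1) Z (node_facet \<sigma>) Rs2 M" "cross (d + 1) Z R M G"
        using up(4) Rs1 RR by (auto simp: ridge_path_append)
      have "M = node_facet \<sigma>"
        using Z.cross_unique[OF Z.cross_sym[OF M(2)] up(5)] d_ge1 by simp
      moreover have "distinct_adj Rs2" using less.prems(2) Rs Rs1 by (auto simp: distinct_adj_Cons)
      ultimately have "Rs2 = []" using less.hyps[of Rs2 "node_facet \<sigma>"] M(1) Rs Rs1 by simp
      then show False using less.prems(2) Rs Rs1 RR by simp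
    qed
  qed
  then show ?thesis unfolding treelike_def by blast
qed

lemma facet_Z_iso:
  assumes "node \<tau>"
  shows "order_iso (Y \<tau>) (lower_section Z (node_facet \<tau>)) (place \<tau>)"
proof -
  have "place \<tau> ` carrier (Y \<tau>) = carrier (lower_section Z (node_facet \<tau>))"
    using below_node_facet[OF assms] place_in[OF assms] by auto
  moreover have "inj_on (place \<tau>) (carrier (Y \<tau>))" by (rule inj_onI) (rule place_inj[OF assms])
  ultimately show ?thesis
    unfolding order_iso_def order_emb_def bij_betw_def
    using place_le_iff[OF assms] partial_order.axioms(1)[OF X.po] partial_order.axioms(1)[OF Z.lower_section_po]
    by simp
qed

end

section \<open>Copies on the natural numbers\<close>

definition relabel :: "('a \<Rightarrow> 'b) \<Rightarrow> 'a ranked_order \<Rightarrow> 'b ranked_order" where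
  "relabel f T = \<lparr>carrier = f ` carrier T, eq = (=),
     le = (\<lambda>x y. inv_into (carrier T) f x \<sqsubseteq>\<^bsub>T\<^esub> inv_into (carrier T) f y),
     rk = (\<lambda>x. rk T (inv_into (carrier T) f x))\<rparr>"

lemma relabel:
  assumes T: "abstract_polytope n T" and inj: "inj_on f (carrier T)"
  shows "order_iso T (relabel f T) f" "abstract_polytope n (relabel f T)"
proof -
  interpret T: abstract_polytope n T by fact
  have [simp]: "carrier (relabel f T) = f ` carrier T" "eq (relabel f T) = (=)"
    "rk (relabel f T) x = rk T (inv_into (carrier T) f x)"
    "x \<sqsubseteq>\<^bsub>relabel f T\<^esub> y \<longleftrightarrow> inv_into (carrier T) f x \<sqsubseteq>\<^bsub>T\<^esub> inv_into (carrier T) f y" for x y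
    unfolding relabel_def by simp_all
  have [simp]: "inv_into (carrier T) f (f x) = x" if "x \<in> carrier T" for x
    by (rule inv_into_f_f[OF inj that])
  have po: "partial_order (relabel f T)"
  proof (intro partial_order.intro weak_partial_order.intro equivalence.intro weak_partial_order_axioms.intro partial_order_axioms.intro)
    show "eq (relabel f T) = (=)" by simp
    show "x .=\<^bsub>relabel f T\<^esub> y" if xy: "x \<sqsubseteq>\<^bsub>relabel f T\<^esub> y" "y \<sqsubseteq>\<^bsub>relabel f T\<^esub> x"
      "x \<in> carrier (relabel f T)" "y \<in> carrier (relabel f T)" for x y
    proof -
      obtain a b where "a \<in> carrier T" "x = f a" "b \<in> carrier T" "y = f b" using xy(3,4) by auto
      moreover from this have "a = b" using xy(1,2) by (intro T.le_antisym) auto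
      ultimately show ?thesis by simp
    qed
    show "x \<sqsubseteq>\<^bsub>relabel f T\<^esub> z" if xyz: "x \<sqsubseteq>\<^bsub>relabel f T\<^esub> y" "y \<sqsubseteq>\<^bsub>relabel f T\<^esub> z"
      "x \<in> carrier (relabel f T)" "y \<in> carrier (relabel f T)" "z \<in> carrier (relabel f T)" for x y z
    proof -
      obtain a b c where "a \<in> carrier T" "x = f a" "b \<in> carrier T" "y = f b" "c \<in> carrier T" "z = f c"
        using xyz(3-5) by auto
      moreover from this have "a \<sqsubseteq>\<^bsub>T\<^esub> c" using xyz(1,2) by (intro T.le_trans[of a b c]) auto
      ultimately show ?thesis by simp
    qed
  qed auto
  show iso: "order_iso T (relabel f T) f"
    unfolding order_iso_def order_emb_def bij_betw_def
    using inj T.weak_partial_order_axioms partial_order.axioms(1)[OF po] by auto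
  show "abstract_polytope n (relabel f T)"
    by (rule abstract_polytope_transport[OF iso T po]) simp
qed

lemma (in abstract_polytope) countable_carrier: "countable (carrier T)"
proof -
  obtain \<Phi> where \<Phi>: "flag T \<Phi>" by (rule ex_flag)
  have "carrier T \<subseteq> range (\<lambda>(w, k). face T (walk T \<Phi> w) k)"
  proof
    fix x assume "x \<in> carrier T"
    then obtain \<Psi> where \<Psi>: "flag T \<Psi>" "x \<in> \<Psi>" using flag_ex by blast
    obtain w where w: "set w \<subseteq> {0..<n}" "walk T \<Phi> w = \<Psi>" by (rule walk_connected[OF \<Phi> \<Psi>(1)])
    have "x = face T (walk T \<Phi> w) (rk T x)" using face_eqI[OF \<Psi> HOL.refl] w(2) by simp
    then show "x \<in> range (\<lambda>(w, k). face T (walk T \<Phi> w) k)" by (intro image_eqI[of _ _ "(w, rk T x)"]) auto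
  qed
  moreover have "countable (range (\<lambda>(w :: int list, k :: int). face T (walk T \<Phi> w) k))" by simp
  ultimately show ?thesis by (rule countable_subset)
qed

text \<open>The countably many words over the ranks reach all flags from a given one, so a polytope of finite rank is countable.\<close>

lemma nat_copy:
  assumes "abstract_polytope n T"
  obtains T' :: "nat ranked_order" and f where "abstract_polytope n T'" "order_iso T T' f"
  using relabel[OF assms inj_on_to_nat_on[OF abstract_polytope.countable_carrier[OF assms]]] that by blast

section \<open>Maps that respect ridges\<close>

text \<open>Paths without backtracking have images without backtracking as soon as \<open>f\<close> separates the ridges of each
facet; injectivity on all ridges is not assumed, as it may fail for coverings a priori.\<close>

lemma treelike_pullback:
  assumes facet: "\<And>G. G \<in> faces_of_rank (n - 1) T \<Longrightarrow> f G \<in> faces_of_rank (n - 1) T'"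
    and cross: "\<And>R G H. cross n T R G H \<Longrightarrow> cross n T' (f R) (f G) (f H)"
    and inj: "\<And>R R' G H H'. \<lbrakk>cross n T R G H; cross n T R' G H'; f R = f R'\<rbrakk> \<Longrightarrow> R = R'"
    and "treelike n T'"
  shows "treelike n T"
proof -
  note path = ridge_path_map[of n T f T', OF facet cross]
  have dist: "\<lbrakk>ridge_path n T G Rs H; distinct_adj Rs\<rbrakk> \<Longrightarrow> distinct_adj (map f Rs)" for G Rs H
  proof (induction Rs arbitrary: G)
    case (Cons R Rs)
    then obtain M where M: "cross n T R G M" "ridge_path n T M Rs H" by auto
    have IH: "distinct_adj (map f Rs)" using Cons.IH[OF M(2)] distinct_adj_ConsD[OF Cons.prems(2)] by simp
    show ?case
    proof (cases Rs)
      case (Cons R' Rs')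
      then obtain M' where M': "cross n T R' M M'" using M(2) by auto
      have "cross n T R M G" using M(1) unfolding cross_def by auto
      then have "f R \<noteq> f R'" using inj[OF _ M'] \<open>distinct_adj (R # Rs)\<close> Cons by auto
      then show ?thesis using IH Cons by simp
    qed simp
  qed simp
  show ?thesis
    unfolding treelike_def
  proof (intro allI impI notI)
    fix G Rs H assume "ridge_path n T G Rs H" "Rs \<noteq> []" "distinct_adj Rs" "G = H"
    then show False using path[of G Rs H] dist[of G Rs H] assms(4) unfolding treelike_def by auto
  qed
qed

lemma order_iso_treelike:
  assumes iso: "order_iso T T' f" "abstract_polytope n T" "abstract_polytope n T'" and tree: "treelike n T'"
  shows "treelike n T"
proof (rule treelike_pullback[OF _ _ _ tree])
  show "R = R'" if "cross n T R G H" "cross n T R' G H'" "f R = f R'" for R R' G H H'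
    using inj_onD[OF order_isoD(2)[OF iso(1)] that(3)] that(1,2) unfolding cross_def faces_of_rank_def by blast
qed (use order_iso_faces_of_rank[OF iso] order_iso_cross[OF iso] in auto)

section \<open>Coloured tree-like polytopes are alternating semiregular\<close>

lemma facet_relators:
  assumes T: "abstract_polytope (d + 1) T" and \<Phi>: "flag T \<Phi>" "G \<in> \<Phi>" "rk T G = d"
    and P: "regular_polytope d P" "isomorphic (lower_section T G) P" "flag P \<Psi>"
  shows "regular_polytope d (lower_section T G)" "relators d T \<Phi> = relators d P \<Psi>"
proof -
  interpret T: abstract_polytope "d + 1" T by fact
  interpret P: abstract_polytope d P using P(1) unfolding regular_polytope_def polytope_iff by simp
  have G: "G \<in> carrier T" by (rule T.flag_carrier[OF \<Phi>(1,2)])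
  obtain f where f: "order_iso P (lower_section T G) f"
    using isomorphic_sym[OF P(2)] unfolding isomorphic_iff by blast
  have gr: "graded_poset d (lower_section T G)" using T.lower_section_graded[OF G] \<Phi>(3) by simp
  have L: "abstract_polytope d (lower_section T G)"
    by (rule abstract_polytope_transport[OF f P.abstract_polytope_axioms T.lower_section_po])
      (rule order_iso_rk[OF f P.graded_poset_axioms gr])
  show "regular_polytope d (lower_section T G)" by (rule regular_isomorphic[OF P(2) L P(1)])
  have "relators d (lower_section T G) {x \<in> \<Phi>. x \<sqsubseteq>\<^bsub>T\<^esub> G} = relators d T \<Phi>"
    using T.relators_facet[OF G _ _ \<Phi>(1,2)] \<Phi>(3) L by simp
  then show "relators d T \<Phi> = relators d P \<Psi>"
    using relators_isomorphic_regular[OF P(2) L P(1) T.flag_below_facet[OF \<Phi>(1,2)] P(3)] by simp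
qed

text \<open>The two kinds of facets are given as colours, because \<open>P\<close> and \<open>Q\<close> may be isomorphic.\<close>

locale coloured =
  fixes d :: int and P :: "'p ranked_order" and Q :: "'q ranked_order" and T :: "'a ranked_order"
    and col :: "'a \<Rightarrow> bool" and \<Phi>P :: "'p set" and \<Phi>Q :: "'q set"
  assumes d: "1 \<le> d" and P: "regular_polytope d P" and Q: "regular_polytope d Q"
    and T: "abstract_polytope (d + 1) T" and tree: "treelike (d + 1) T"
    and facets: "G \<in> faces_of_rank d T \<Longrightarrow>
      (if col G then isomorphic (lower_section T G) P else isomorphic (lower_section T G) Q)"
    and alternate: "cross (d + 1) T R G H \<Longrightarrow> col G \<noteq> col H"
    and \<Phi>P: "flag P \<Phi>P" and \<Phi>Q: "flag Q \<Phi>Q"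
begin

interpretation T: abstract_polytope "d + 1" T by (rule T)

lemma facet_of_flag:
  assumes "flag T \<Phi>"
  shows "face T \<Phi> d \<in> \<Phi>" "rk T (face T \<Phi> d) = d" "face T \<Phi> d \<in> faces_of_rank d T"
  using T.face_in[OF assms, of d] T.rk_face[OF assms, of d] T.face_carrier[OF assms, of d] d
  unfolding faces_of_rank_def by auto

lemma relators_col:
  assumes "flag T \<Phi>"
  shows "relators d T \<Phi> = (if col (face T \<Phi> d) then relators d P \<Phi>P else relators d Q \<Phi>Q)"
  using facets[OF facet_of_flag(3)[OF assms]] facet_relators(2)[OF T assms facet_of_flag(1,2)[OF assms] P _ \<Phi>P]
    facet_relators(2)[OF T assms facet_of_flag(1,2)[OF assms] Q _ \<Phi>Q] by auto

lemma facet_regular: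
  assumes "G \<in> faces_of_rank d T"
  shows "regular_polytope d (lower_section T G)"
proof -
  have G: "G \<in> carrier T" "rk T G = d" using assms unfolding faces_of_rank_def by auto
  obtain \<Phi> where \<Phi>: "flag T \<Phi>" "G \<in> \<Phi>" using T.flag_ex[OF G(1)] by blast
  show ?thesis
    using facets[OF assms] facet_relators(1)[OF T \<Phi> G(2) P _ \<Phi>P] facet_relators(1)[OF T \<Phi> G(2) Q _ \<Phi>Q]
    by (auto split: if_splits)
qed

lemma cross_flag:
  assumes "flag T \<Phi>"
  shows "cross (d + 1) T (face T \<Phi> (d - 1)) (face T \<Phi> d) (face T (flip T d \<Phi>) d)"
  using T.cross_flip[OF assms] d by simp

lemma tree_polytope: "tree_polytope (d + 1) T (relators d P \<Phi>P) (relators d Q \<Phi>Q)"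
proof (intro tree_polytope.intro tree_polytope_axioms.intro T tree)
  show "2 \<le> d + 1" using d by simp
  show "relators (d + 1 - 1) T (flip T i \<Phi>) = relators (d + 1 - 1) T \<Phi>"
    if "flag T \<Phi>" "0 \<le> i" "i < d + 1 - 1" for \<Phi> i
    using relators_col[OF that(1)] relators_col[OF T.flag_flip[OF that(1,2)]] T.face_flip[OF that(1,2), of d] that d
    by simp
  show "{relators (d + 1 - 1) T \<Phi>, relators (d + 1 - 1) T (flip T (d + 1 - 1) \<Phi>)} = {relators d P \<Phi>P, relators d Q \<Phi>Q}"
    if "flag T \<Phi>" for \<Phi>
  proof -
    have "flag T (flip T d \<Phi>)" using T.flag_flip[OF that, of d] d by simp
    then show ?thesis
      using relators_col[OF that] relators_col[of "flip T d \<Phi>"] alternate[OF cross_flag[OF that]] by auto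
  qed
qed

interpretation T: tree_polytope "d + 1" T "relators d P \<Phi>P" "relators d Q \<Phi>Q"
  by (rule tree_polytope)

lemma aut_of_col:
  assumes "flag T \<Phi>" "flag T \<Psi>" "col (face T \<Phi> d) = col (face T \<Psi> d) \<or> isomorphic P Q"
  shows "\<exists>f\<in>carrier (Aut T). f ` \<Phi> = \<Psi>"
proof (rule T.aut_of_same_kind[OF assms(1,2)])
  have "relators d P \<Phi>P = relators d Q \<Phi>Q" if "isomorphic P Q"
  proof (rule relators_isomorphic_regular[OF that _ Q \<Phi>P \<Phi>Q])
    show "abstract_polytope d P" using P unfolding regular_polytope_def polytope_iff by simp
  qed
  then show "relators (d + 1 - 1) T \<Phi> = relators (d + 1 - 1) T \<Psi>"
    using relators_col[OF assms(1)] relators_col[OF assms(2)] assms(3) by auto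
qed

text \<open>Of the two flags that differ in their facet only, one has the required colour, and both have the same
vertex.\<close>

lemma vertex_transitive:
  assumes "v \<in> faces_of_rank 0 T" "w \<in> faces_of_rank 0 T"
  shows "\<exists>f\<in>carrier (Aut T). f v = w"
proof -
  have c: "v \<in> carrier T" "rk T v = 0" "w \<in> carrier T" "rk T w = 0"
    using assms unfolding faces_of_rank_def by auto
  obtain \<Phi> where \<Phi>: "flag T \<Phi>" "v \<in> \<Phi>" using T.flag_ex[OF c(1)] by blast
  obtain \<Psi> where \<Psi>: "flag T \<Psi>" "w \<in> \<Psi>" using T.flag_ex[OF c(3)] by blast
  let ?\<Psi> = "flip T d \<Psi>"
  have fl: "flag T ?\<Psi>" using T.flag_flip[OF \<Psi>(1), of d] d by simp
  have w: "face T \<Psi> 0 = w" "face T ?\<Psi> 0 = w"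
    using T.face_eqI[OF \<Psi> c(4)] T.face_flip[OF \<Psi>(1), of d 0] d by auto
  have "col (face T \<Psi> d) \<noteq> col (face T ?\<Psi> d)" by (rule alternate[OF cross_flag[OF \<Psi>(1)]])
  then obtain \<Theta> where \<Theta>: "flag T \<Theta>" "face T \<Theta> 0 = w" "col (face T \<Phi> d) = col (face T \<Theta> d)"
    using \<Psi>(1) fl w by metis
  obtain f where f: "f \<in> carrier (Aut T)" "f ` \<Phi> = \<Theta>" using aut_of_col[OF \<Phi>(1) \<Theta>(1)] \<Theta>(3) by blast
  have "face T (f ` \<Phi>) 0 = f (face T \<Phi> 0)" using T.aut_face[OF f(1) \<Phi>(1), of 0] d by simp
  then have "f v = w" using T.face_eqI[OF \<Phi> c(2)] f(2) \<Theta>(2) by simp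
  then show ?thesis using f(1) by blast
qed

lemma semiregular: "semiregular_polytope (d + 1) T"
  unfolding semiregular_polytope_def polytope_iff using T facet_regular vertex_transitive by simp

text \<open>Adjacent facets have different colours before and after \<open>f\<close>, so whether \<open>f\<close> preserves the colour is
the same for all facets.\<close>

lemma aut_col:
  assumes f: "f \<in> carrier (Aut T)" and G: "G \<in> faces_of_rank d T" and H: "H \<in> faces_of_rank d T"
    and eq: "col (f G) = col G"
  shows "col (f H) = col H"
proof -
  obtain Rs where "ridge_path (d + 1) T G Rs H"
    by (rule T.ridge_path_ex[of G H]) (use G H d in auto)
  then show ?thesis
    using eq
  proof (induction Rs arbitrary: G)
    case (Cons R Rs)
    then obtain M where M: "cross (d + 1) T R G M" "ridge_path (d + 1) T M Rs H" by auto
    have "col (f M) = col M"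
      using alternate[OF M(1)] alternate[OF T.aut_cross[OF f M(1)]] Cons.prems(2) by blast
    then show ?case by (rule Cons.IH[OF M(2)])
  qed simp
qed

lemma facets_alternateI:
  assumes "\<And>G H. \<lbrakk>G \<in> faces_of_rank d T; H \<in> faces_of_rank d T; col G; \<not> col H\<rbrakk> \<Longrightarrow> G \<in> A \<and> H \<in> B"
  shows "facets_alternate (d + 1) T A B"
  unfolding facets_alternate_def
proof (intro ballI impI)
  fix F R G H
  assume *: "R \<in> faces_of_rank (d + 1 - 2) T" "G \<in> faces_of_rank (d + 1 - 1) T" "H \<in> faces_of_rank (d + 1 - 1) T"
    "F \<sqsubseteq>\<^bsub>T\<^esub> R \<and> R \<sqsubseteq>\<^bsub>T\<^esub> G \<and> R \<sqsubseteq>\<^bsub>T\<^esub> H \<and> G \<noteq> H"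
  then have "cross (d + 1) T R G H" unfolding cross_def by simp
  then have "col G \<noteq> col H" by (rule alternate)
  then show "G \<in> A \<and> H \<in> B \<or> G \<in> B \<and> H \<in> A" using assms * by auto
qed

text \<open>The subgroup is the stabiliser of the colouring. It has index two, since for isomorphic \<open>P\<close> and \<open>Q\<close>
all flags are equivalent and some automorphism swaps the colours.\<close>

lemma two_colour_classes:
  assumes PQ: "isomorphic P Q"
  shows "\<exists>N A B. subgroup N (Aut T) \<and> card (rcosets\<^bsub>Aut T\<^esub> N) = 2 \<and>
    orbits (Aut T\<lparr>carrier := N\<rparr>) (faces_of_rank (d + 1 - 1) T) (\<lambda>f. f) = {A, B} \<and> A \<noteq> B \<and>
    facets_alternate (d + 1) T A B"
proof -
  interpret A: group "Aut T" by (rule group_Aut[OF T.po])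
  define N where "N = {f \<in> carrier (Aut T). \<forall>G\<in>faces_of_rank d T. col (f G) = col G}"
  define A where "A = {G \<in> faces_of_rank d T. col G}"
  define B where "B = {G \<in> faces_of_rank d T. \<not> col G}"
  obtain \<Phi> where \<Phi>: "flag T \<Phi>" by (rule T.ex_flag)
  have fl: "flag T (flip T d \<Phi>)" using T.flag_flip[OF \<Phi>, of d] d by simp
  have facet_c: "G \<in> carrier T" if "G \<in> faces_of_rank d T" for G using that unfolding faces_of_rank_def by simp
  have app: "(f \<otimes>\<^bsub>Aut T\<^esub> g) G = f (g G)" if "f \<in> carrier (Aut T)" "g \<in> carrier (Aut T)" "G \<in> faces_of_rank d T" for f g G
    using aut_mult[OF that(1,2)] facet_c[OF that(3)] by (simp add: compose_def)
  have inv_app: "f ((inv\<^bsub>Aut T\<^esub> f) G) = G" if "f \<in> carrier (Aut T)" "G \<in> faces_of_rank d T" for f G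
    using app[OF that(1) A.inv_closed[OF that(1)] that(2)] A.r_inv[OF that(1)] facet_c[OF that(2)] by (simp add: aut_one)
  have sub: "subgroup N (Aut T)"
  proof (rule A.subgroupI)
    show "N \<subseteq> carrier (Aut T)" unfolding N_def by blast
    have "\<one>\<^bsub>Aut T\<^esub> \<in> N" unfolding N_def using A.one_closed facet_c by (simp add: aut_one)
    then show "N \<noteq> {}" by blast
    show "inv\<^bsub>Aut T\<^esub> f \<in> N" if "f \<in> N" for f
    proof -
      have f: "f \<in> carrier (Aut T)" "\<And>G. G \<in> faces_of_rank d T \<Longrightarrow> col (f G) = col G" using that unfolding N_def by auto
      have "col ((inv\<^bsub>Aut T\<^esub> f) G) = col G" if "G \<in> faces_of_rank d T" for G
        using f(2)[OF T.aut_faces_of_rank[OF A.inv_closed[OF f(1)] that]] inv_app[OF f(1) that] by simp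
      then show ?thesis unfolding N_def using f(1) by simp
    qed
    show "f \<otimes>\<^bsub>Aut T\<^esub> g \<in> N" if "f \<in> N" "g \<in> N" for f g
      using that app T.aut_faces_of_rank unfolding N_def by auto
  qed
  obtain s where s: "s \<in> carrier (Aut T)" "s ` \<Phi> = flip T d \<Phi>" using aut_of_col[OF \<Phi> fl] PQ by blast
  have s_face: "s (face T \<Phi> d) = face T (flip T d \<Phi>) d" using T.aut_face[OF s(1) \<Phi>, of d] s(2) d by simp
  have s_flip: "col (s G) \<noteq> col G" if "G \<in> faces_of_rank d T" for G
    using aut_col[OF s(1) that facet_of_flag(3)[OF \<Phi>]] alternate[OF cross_flag[OF \<Phi>]] s_face by metis
  then have "s \<notin> N" unfolding N_def using facet_of_flag(3)[OF \<Phi>] by blast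
  have cosets: "N #>\<^bsub>Aut T\<^esub> f = (if f \<in> N then N else N #>\<^bsub>Aut T\<^esub> s)" if f: "f \<in> carrier (Aut T)" for f
  proof (cases "f \<in> N")
    case True
    then show ?thesis using A.coset_join2[OF f sub] by simp
  next
    case False
    then obtain G where G: "G \<in> faces_of_rank d T" "col (f G) \<noteq> col G" using f unfolding N_def by blast
    then have flip: "col (f H) \<noteq> col H" if "H \<in> faces_of_rank d T" for H using aut_col[OF f that G(1)] by blast
    let ?i = "inv\<^bsub>Aut T\<^esub> s"
    have i: "?i \<in> carrier (Aut T)" using s(1) by simp
    have "col ((f \<otimes>\<^bsub>Aut T\<^esub> ?i) H) = col H" if H: "H \<in> faces_of_rank d T" for H
      using app[OF f i H] flip[OF T.aut_faces_of_rank[OF i H]] s_flip[OF T.aut_faces_of_rank[OF i H]] inv_app[OF s(1) H] by simp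
    then have "f \<otimes>\<^bsub>Aut T\<^esub> ?i \<in> N" unfolding N_def using f i by simp
    moreover have "f = (f \<otimes>\<^bsub>Aut T\<^esub> ?i) \<otimes>\<^bsub>Aut T\<^esub> s" using A.m_assoc[OF f i s(1)] f s(1) by simp
    ultimately have "f \<in> N #>\<^bsub>Aut T\<^esub> s" unfolding r_coset_def by blast
    then show ?thesis using A.repr_independence[OF _ s(1) sub] False by simp
  qed
  have "rcosets\<^bsub>Aut T\<^esub> N = {N, N #>\<^bsub>Aut T\<^esub> s}"
  proof (intro equalityI subsetI)
    fix C assume "C \<in> rcosets\<^bsub>Aut T\<^esub> N"
    then obtain f where "f \<in> carrier (Aut T)" "C = N #>\<^bsub>Aut T\<^esub> f" unfolding RCOSETS_def by blast
    then show "C \<in> {N, N #>\<^bsub>Aut T\<^esub> s}" using cosets by auto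
  next
    fix C assume "C \<in> {N, N #>\<^bsub>Aut T\<^esub> s}"
    moreover have "N = N #>\<^bsub>Aut T\<^esub> \<one>\<^bsub>Aut T\<^esub>" using cosets[OF A.one_closed] subgroup.one_closed[OF sub] by simp
    ultimately show "C \<in> rcosets\<^bsub>Aut T\<^esub> N" unfolding RCOSETS_def using s(1) A.one_closed by blast
  qed
  moreover have "N \<noteq> N #>\<^bsub>Aut T\<^esub> s" using A.rcos_self[OF s(1) sub] \<open>s \<notin> N\<close> by blast
  ultimately have card: "card (rcosets\<^bsub>Aut T\<^esub> N) = 2" by simp
  have orbit: "orbit (Aut T\<lparr>carrier := N\<rparr>) (\<lambda>f. f) G = {H \<in> faces_of_rank d T. col H = col G}"
    if G: "G \<in> faces_of_rank d T" for G
  proof (intro equalityI subsetI)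
    fix H assume "H \<in> orbit (Aut T\<lparr>carrier := N\<rparr>) (\<lambda>f. f) G"
    then obtain f where "f \<in> N" "H = f G" unfolding orbit_def by auto
    then show "H \<in> {H \<in> faces_of_rank d T. col H = col G}" using G T.aut_faces_of_rank unfolding N_def by auto
  next
    fix H assume "H \<in> {H \<in> faces_of_rank d T. col H = col G}"
    then have H: "H \<in> faces_of_rank d T" "col H = col G" by auto
    obtain \<Psi> where \<Psi>: "flag T \<Psi>" "G \<in> \<Psi>" using T.flag_ex[OF facet_c[OF G]] by blast
    obtain \<Theta> where \<Theta>: "flag T \<Theta>" "H \<in> \<Theta>" using T.flag_ex[OF facet_c[OF H(1)]] by blast
    have f: "face T \<Psi> d = G" "face T \<Theta> d = H"
      using T.face_eqI[OF \<Psi>] T.face_eqI[OF \<Theta>] G H(1) unfolding faces_of_rank_def by auto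
    obtain h where h: "h \<in> carrier (Aut T)" "h ` \<Psi> = \<Theta>" using aut_of_col[OF \<Psi>(1) \<Theta>(1)] H(2) f by metis
    have hG: "h G = H" using T.aut_face[OF h(1) \<Psi>(1), of d] f h(2) d by simp
    then have "h \<in> N" unfolding N_def using h(1) aut_col[OF h(1) G] H(2) by blast
    then show "H \<in> orbit (Aut T\<lparr>carrier := N\<rparr>) (\<lambda>f. f) G" unfolding orbit_def using hG by auto
  qed
  let ?G = "face T \<Phi> d" and ?H = "face T (flip T d \<Phi>) d"
  have GH: "?G \<in> faces_of_rank d T" "?H \<in> faces_of_rank d T" "col ?G \<noteq> col ?H"
    using facet_of_flag(3)[OF \<Phi>] facet_of_flag(3)[OF fl] alternate[OF cross_flag[OF \<Phi>]] by auto
  have AB: "{H \<in> faces_of_rank d T. col H = col G} = (if col G then A else B)" for G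
    unfolding A_def B_def by auto
  have "orbits (Aut T\<lparr>carrier := N\<rparr>) (faces_of_rank d T) (\<lambda>f. f) = {A, B}"
  proof (intro equalityI subsetI)
    fix O' assume "O' \<in> orbits (Aut T\<lparr>carrier := N\<rparr>) (faces_of_rank d T) (\<lambda>f. f)"
    then obtain G where "G \<in> faces_of_rank d T" "O' = orbit (Aut T\<lparr>carrier := N\<rparr>) (\<lambda>f. f) G"
      unfolding orbits_def by blast
    then have "O' = (if col G then A else B)" using orbit[of G] AB[of G] by simp
    then show "O' \<in> {A, B}" by simp
  next
    fix O' assume "O' \<in> {A, B}"
    then have "\<exists>G\<in>{?G, ?H}. O' = (if col G then A else B)" using GH(3) by auto
    then obtain G where "G \<in> {?G, ?H}" "O' = (if col G then A else B)" by blast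
    then have "G \<in> faces_of_rank d T" "O' = orbit (Aut T\<lparr>carrier := N\<rparr>) (\<lambda>f. f) G"
      using GH(1,2) orbit[of G] AB[of G] by auto
    then show "O' \<in> orbits (Aut T\<lparr>carrier := N\<rparr>) (faces_of_rank d T) (\<lambda>f. f)" unfolding orbits_def by blast
  qed
  moreover have "A \<noteq> B" using GH unfolding A_def B_def by blast
  moreover have "facets_alternate (d + 1) T A B"
    by (rule facets_alternateI) (auto simp: A_def B_def)
  ultimately have "subgroup N (Aut T) \<and> card (rcosets\<^bsub>Aut T\<^esub> N) = 2 \<and>
    orbits (Aut T\<lparr>carrier := N\<rparr>) (faces_of_rank (d + 1 - 1) T) (\<lambda>f. f) = {A, B} \<and> A \<noteq> B \<and>
    facets_alternate (d + 1) T A B"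
    using sub card by simp
  then show ?thesis by (intro exI)
qed

theorem alternating_semiregular: "alternating_semiregular (d + 1) P Q T"
proof -
  have "faces_of_rank d T \<subseteq> facets_of_kind (d + 1) T P \<union> facets_of_kind (d + 1) T Q"
  proof
    fix G assume G: "G \<in> faces_of_rank d T"
    show "G \<in> facets_of_kind (d + 1) T P \<union> facets_of_kind (d + 1) T Q"
      using facets[OF G] G unfolding facets_of_kind_def by (cases "col G") auto
  qed
  moreover have "facets_of_kind (d + 1) T P \<union> facets_of_kind (d + 1) T Q \<subseteq> faces_of_rank d T"
    unfolding facets_of_kind_def by auto
  moreover have "facets_alternate (d + 1) T (facets_of_kind (d + 1) T P) (facets_of_kind (d + 1) T Q)"
    by (rule facets_alternateI) (use facets in \<open>fastforce simp: facets_of_kind_def\<close>)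
  ultimately show ?thesis
    unfolding alternating_semiregular_def using semiregular two_colour_classes by auto
qed

end

section \<open>Universal alternating semiregular polytopes\<close>

text \<open>The flags \<open>\<Phi>P\<close> and \<open>\<Phi>Q\<close> only serve to name the relators of the regular polytopes \<open>P\<close> and \<open>Q\<close>.\<close>

locale alternating_pair =
  fixes d :: int and P :: "'p ranked_order" and Q :: "'q ranked_order" and \<Phi>P :: "'p set" and \<Phi>Q :: "'q set"
  assumes d: "1 \<le> d" and P: "regular_polytope d P" and Q: "regular_polytope d Q"
    and \<Phi>P: "flag P \<Phi>P" and \<Phi>Q: "flag Q \<Phi>Q"
begin

lemma alternating_polytope:
  assumes "alternating_semiregular (d + 1) P Q U"
  shows "abstract_polytope (d + 1) U"
  using assms unfolding alternating_semiregular_def semiregular_polytope_def polytope_iff by blast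

lemma alternating_relators:
  assumes U: "alternating_semiregular (d + 1) P Q U" and \<Phi>: "flag U \<Phi>"
  shows "{relators d U \<Phi>, relators d U (flip U d \<Phi>)} = {relators d P \<Phi>P, relators d Q \<Phi>Q}"
    and "\<lbrakk>0 \<le> i; i < d\<rbrakk> \<Longrightarrow> relators d U (flip U i \<Phi>) = relators d U \<Phi>"
proof -
  have poly: "abstract_polytope (d + 1) U" by (rule alternating_polytope[OF U])
  interpret U: abstract_polytope "d + 1" U by (rule poly)
  have kinds: "faces_of_rank d U = facets_of_kind (d + 1) U P \<union> facets_of_kind (d + 1) U Q"
    using U unfolding alternating_semiregular_def by simp
  have kindP: "relators d U \<Psi> = relators d P \<Phi>P" if "flag U \<Psi>" "G \<in> \<Psi>" "G \<in> facets_of_kind (d + 1) U P" for \<Psi> G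
    using facet_relators(2)[OF poly that(1,2) _ P _ \<Phi>P] that(3) unfolding facets_of_kind_def faces_of_rank_def by simp
  have kindQ: "relators d U \<Psi> = relators d Q \<Phi>Q" if "flag U \<Psi>" "G \<in> \<Psi>" "G \<in> facets_of_kind (d + 1) U Q" for \<Psi> G
    using facet_relators(2)[OF poly that(1,2) _ Q _ \<Phi>Q] that(3) unfolding facets_of_kind_def faces_of_rank_def by simp
  have face: "face U \<Psi> k \<in> \<Psi>" "face U \<Psi> k \<in> faces_of_rank k U" if "flag U \<Psi>" "-1 \<le> k" "k \<le> d + 1" for \<Psi> k
    using U.face_in[OF that] U.face_carrier[OF that] U.rk_face[OF that] unfolding faces_of_rank_def by auto
  let ?G = "face U \<Phi> d"
  have G: "?G \<in> \<Phi>" "?G \<in> faces_of_rank d U" using face[OF \<Phi>, of d] d by auto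
  show "relators d U (flip U i \<Phi>) = relators d U \<Phi>" if i: "0 \<le> i" "i < d"
  proof -
    have fl: "flag U (flip U i \<Phi>)" using U.flag_flip[OF \<Phi>, of i] i by simp
    have "face U (flip U i \<Phi>) d = ?G" using U.face_flip[OF \<Phi>, of i d] i d by simp
    then have "?G \<in> flip U i \<Phi>" using face(1)[OF fl, of d] d by simp
    then show ?thesis using kinds G kindP[OF \<Phi> G(1)] kindQ[OF \<Phi> G(1)] kindP[OF fl] kindQ[OF fl] by auto
  qed
  let ?\<Psi> = "flip U d \<Phi>" and ?H = "face U (flip U d \<Phi>) d"
  have fl: "flag U ?\<Psi>" using U.flag_flip[OF \<Phi>, of d] d by simp
  have H: "?H \<in> ?\<Psi>" "?H \<in> faces_of_rank d U" using face[OF fl, of d] d by auto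
  show "{relators d U \<Phi>, relators d U ?\<Psi>} = {relators d P \<Phi>P, relators d Q \<Phi>Q}"
  proof (cases "isomorphic P Q")
    case True
    then have "relators d P \<Phi>P = relators d Q \<Phi>Q"
      by (rule relators_isomorphic_regular[OF _ _ Q \<Phi>P \<Phi>Q]) (use P in \<open>simp add: regular_polytope_def polytope_iff\<close>)
    then show ?thesis
      using kinds G H kindP[OF \<Phi> G(1)] kindQ[OF \<Phi> G(1)] kindP[OF fl H(1)] kindQ[OF fl H(1)] by auto
  next
    case False
    then have alt: "facets_alternate (d + 1) U (facets_of_kind (d + 1) U P) (facets_of_kind (d + 1) U Q)"
      using U unfolding alternating_semiregular_def by simp
    have "cross (d + 1) U (face U \<Phi> (d - 1)) ?G ?H" using U.cross_flip[OF \<Phi>] d by simp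
    then have c: "face U \<Phi> (d - 1) \<sqsubseteq>\<^bsub>U\<^esub> ?G" "face U \<Phi> (d - 1) \<sqsubseteq>\<^bsub>U\<^esub> ?H" "?G \<noteq> ?H" unfolding cross_def by auto
    have "face U \<Phi> (d - 2) \<in> faces_of_rank (d + 1 - 3) U" "face U \<Phi> (d - 1) \<in> faces_of_rank (d + 1 - 2) U"
      "face U \<Phi> (d - 2) \<sqsubseteq>\<^bsub>U\<^esub> face U \<Phi> (d - 1)"
      using face(2)[OF \<Phi>, of "d - 2"] face(2)[OF \<Phi>, of "d - 1"] U.face_le[OF \<Phi>, of "d - 2" "d - 1"] d by auto
    then have "?G \<in> facets_of_kind (d + 1) U P \<and> ?H \<in> facets_of_kind (d + 1) U Q \<or>
        ?G \<in> facets_of_kind (d + 1) U Q \<and> ?H \<in> facets_of_kind (d + 1) U P"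
      using alt c G(2) H(2) unfolding facets_alternate_def by simp
    then show ?thesis
      using kindP[OF \<Phi> G(1)] kindQ[OF \<Phi> G(1)] kindP[OF fl H(1)] kindQ[OF fl H(1)] by auto
  qed
qed

text \<open>The crucial point is that a covering cannot identify two ridges of a facet. At a flag and at its neighbour
across a ridge, the covering maps the two sets of relators into the corresponding sets for the
image, and both pairs consist of the relators of \<open>P\<close> and of \<open>Q\<close>. If the
relators at the flag and at its image were different, those of \<open>P\<close> and \<open>Q\<close> would include each
other; so they are equal, and the restriction to each facet is injective.\<close>

lemma treelike_covering:
  assumes U: "alternating_semiregular (d + 1) P Q U" and S: "alternating_semiregular (d + 1) P Q S"
    and cov: "covering U S \<phi>" and tree: "treelike (d + 1) S"
  shows "treelike (d + 1) U"
proof -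
  interpret U: abstract_polytope "d + 1" U by (rule alternating_polytope[OF U])
  interpret S: abstract_polytope "d + 1" S by (rule alternating_polytope[OF S])
  have adj: "adjacent_flags S (\<phi> ` \<Phi>) (\<phi> ` flip U i \<Phi>)" if "flag U \<Phi>" "0 \<le> i" "i < d + 1" for \<Phi> i
    using cov U.adjacent_flip[OF that] unfolding covering_def by blast
  interpret \<phi>: flag_morphism "d + 1" U S \<phi>
  proof
    show "rk S (\<phi> x) = rk U x" if "x \<in> carrier U" for x using cov that unfolding covering_def by blast
    show "flag S (\<phi> ` \<Phi>)" if "flag U \<Phi>" for \<Phi>
      using adj[OF that, of 0] d unfolding adjacent_flags_def by simp
    show "\<phi> ` flip U i \<Phi> \<noteq> \<phi> ` \<Phi>" if "flag U \<Phi>" "0 \<le> i" "i < d + 1" for \<Phi> i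
      using adj[OF that] unfolding adjacent_flags_def by auto
  qed
  have same_relators: "relators d U \<Phi> = relators d S (\<phi> ` \<Phi>)" if \<Phi>: "flag U \<Phi>" for \<Phi>
  proof -
    have fl: "flag U (flip U d \<Phi>)" using U.flag_flip[OF \<Phi>, of d] d by simp
    have sub: "relators d U \<Phi> \<subseteq> relators d S (\<phi> ` \<Phi>)" by (rule \<phi>.relators_mono[OF \<Phi>]) simp
    have sub': "relators d U (flip U d \<Phi>) \<subseteq> relators d S (flip S d (\<phi> ` \<Phi>))"
      using \<phi>.relators_mono[OF fl, of d] \<phi>.image_flip[OF \<Phi>, of d] d by simp
    show ?thesis
      using alternating_relators(1)[OF U \<Phi>] alternating_relators(1)[OF S \<phi>.flag_image[OF \<Phi>]] sub sub'
      by (metis doubleton_eq_iff subset_antisym)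
  qed
  show ?thesis
  proof (rule treelike_pullback[OF _ _ _ tree])
    show "\<phi> G \<in> faces_of_rank (d + 1 - 1) S" if "G \<in> faces_of_rank (d + 1 - 1) U" for G
      using that cov unfolding covering_def faces_of_rank_def by auto
  next
    fix R G H assume c: "cross (d + 1) U R G H"
    then have RG: "R \<in> carrier U" "G \<in> carrier U" "R \<sqsubseteq>\<^bsub>U\<^esub> G" "rk U R = d - 1" "rk U G = d"
      unfolding cross_def faces_of_rank_def by auto
    obtain \<Phi> where \<Phi>: "flag U \<Phi>" "R \<in> \<Phi>" "G \<in> \<Phi>" using U.flag_ex2[OF RG(1-3)] by blast
    have f: "face U \<Phi> (d - 1) = R" "face U \<Phi> d = G"
      using U.face_eqI[OF \<Phi>(1,2) RG(4)] U.face_eqI[OF \<Phi>(1,3) RG(5)] by auto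
    have "cross (d + 1) U R G (face U (flip U d \<Phi>) d)" using U.cross_flip[OF \<Phi>(1)] d f by simp
    then have H: "face U (flip U d \<Phi>) d = H" using U.cross_unique[OF _ c] d by simp
    have fl: "flag U (flip U d \<Phi>)" using U.flag_flip[OF \<Phi>(1), of d] d by simp
    have "cross (d + 1) S (face S (\<phi> ` \<Phi>) (d - 1)) (face S (\<phi> ` \<Phi>) d) (face S (flip S d (\<phi> ` \<Phi>)) d)"
      using S.cross_flip[OF \<phi>.flag_image[OF \<Phi>(1)]] d by simp
    then show "cross (d + 1) S (\<phi> R) (\<phi> G) (\<phi> H)"
      using \<phi>.face_image[OF \<Phi>(1), of "d - 1"] \<phi>.face_image[OF \<Phi>(1), of d] \<phi>.face_image[OF fl, of d]
        \<phi>.image_flip[OF \<Phi>(1), of d] f H d by simp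
  next
    fix R R' G H H' assume "cross (d + 1) U R G H" "cross (d + 1) U R' G H'" and eq: "\<phi> R = \<phi> R'"
    then have RG: "R \<in> carrier U" "G \<in> carrier U" "R \<sqsubseteq>\<^bsub>U\<^esub> G" "rk U R = d - 1" "rk U G = d"
      "R' \<in> carrier U" "R' \<sqsubseteq>\<^bsub>U\<^esub> G" "rk U R' = d - 1"
      unfolding cross_def faces_of_rank_def by auto
    obtain \<Phi> where \<Phi>: "flag U \<Phi>" "R \<in> \<Phi>" "G \<in> \<Phi>" using U.flag_ex2[OF RG(1-3)] by blast
    obtain \<Psi> where \<Psi>: "flag U \<Psi>" "R' \<in> \<Psi>" "G \<in> \<Psi>" using U.flag_ex2[OF RG(6,2,7)] by blast
    have f: "face U \<Phi> (d - 1) = R" "face U \<Phi> d = G" "face U \<Psi> (d - 1) = R'" "face U \<Psi> d = G"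
      using U.face_eqI[OF \<Phi>(1,2) RG(4)] U.face_eqI[OF \<Phi>(1,3) RG(5)]
        U.face_eqI[OF \<Psi>(1,2) RG(8)] U.face_eqI[OF \<Psi>(1,3) RG(5)] by auto
    have low: "set w \<subseteq> {0..<d}" if "set w \<subseteq> {0..<d + 1}" "d \<notin> set w" for w :: "int list"
      using letters_below[OF that(1)] that(2) by simp
    obtain w where w: "set w \<subseteq> {0..<d + 1}" "walk U \<Phi> w = \<Psi>" "\<forall>i\<in>set w. face U \<Phi> i \<noteq> face U \<Psi> i"
      by (rule U.walk_connected[OF \<Phi>(1) \<Psi>(1)])
    have w_low: "set w \<subseteq> {0..<d}" by (rule low[OF w(1)]) (use w(3) f in auto)
    note fS = \<phi>.flag_image[OF \<Phi>(1)] \<phi>.flag_image[OF \<Psi>(1)]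
    obtain v where v: "set v \<subseteq> {0..<d + 1}" "walk S (\<phi> ` \<Phi>) v = \<phi> ` \<Psi>"
      "\<forall>i\<in>set v. face S (\<phi> ` \<Phi>) i \<noteq> face S (\<phi> ` \<Psi>) i"
      by (rule S.walk_connected[OF fS])
    have "face S (\<phi> ` \<Phi>) (d - 1) = face S (\<phi> ` \<Psi>) (d - 1)" "face S (\<phi> ` \<Phi>) d = face S (\<phi> ` \<Psi>) d"
      using \<phi>.face_image[OF \<Phi>(1), of "d - 1"] \<phi>.face_image[OF \<Phi>(1), of d]
        \<phi>.face_image[OF \<Psi>(1), of "d - 1"] \<phi>.face_image[OF \<Psi>(1), of d] f eq d by simp_all
    then have nv: "d \<notin> set v" "d - 1 \<notin> set v" using v(3) by auto
    have v_low: "set v \<subseteq> {0..<d}" by (rule low[OF v(1) nv(1)])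
    have "walk S (\<phi> ` \<Phi>) w = \<phi> ` \<Psi>" using \<phi>.image_walk[OF \<Phi>(1) w(1)] w(2) by simp
    then have "walk S (\<phi> ` \<Phi>) (w @ rev v) = \<phi> ` \<Phi>" using S.walk_rev[OF fS(1) v(1)] v(2) by simp
    then have "w @ rev v \<in> relators d U \<Phi>"
      unfolding same_relators[OF \<Phi>(1)] unfolding relators_def using w_low v_low by simp
    then have "walk U \<Psi> (rev v) = \<Phi>" using w(2) unfolding relators_def by simp
    moreover have "face U (walk U \<Psi> (rev v)) (d - 1) = face U \<Psi> (d - 1)"
      by (rule U.face_walk[OF \<Psi>(1)]) (use v(1) nv d in auto)
    ultimately show "R = R'" using f by simp
  qed
qed

end

lemma order_iso_facets:
  assumes iso: "order_iso T T' f" and T: "abstract_polytope n T" and T': "abstract_polytope n T'"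
    and K: "\<forall>F\<in>faces_of_rank k T. isomorphic (lower_section T F) K" and F: "F \<in> faces_of_rank k T'"
  shows "isomorphic (lower_section T' F) K"
proof (rule isomorphic_trans)
  interpret T: abstract_polytope n T by fact
  interpret T': abstract_polytope n T' by fact
  let ?g = "inv_into (carrier T) f"
  have g: "order_iso T' T ?g" by (rule order_iso_inv[OF iso])
  show "isomorphic (lower_section T' F) (lower_section T (?g F))"
    unfolding isomorphic_iff using T'.order_iso_lower_section[OF g T.graded_poset_axioms] F
    unfolding faces_of_rank_def by blast
  show "isomorphic (lower_section T (?g F)) K"
    using K order_iso_faces_of_rank[OF g T' T F] by blast
qed

text \<open>Any two facets of \<open>P\<close> and \<open>Q\<close> are isomorphic via \<open>K\<close>, so the copies can be glued. The polytope is
moved to \<^typ>\<open>nat\<close> to match the quantifier in \<^const>\<open>universal_alternating_semiregular\<close>.\<close>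

lemma treelike_alternating_ex:
  assumes d: "1 \<le> d" and P: "regular_polytope d P" and Q: "regular_polytope d Q"
    and KP: "\<forall>F\<in>faces_of_rank (d - 1) P. isomorphic (lower_section P F) K"
    and KQ: "\<forall>F\<in>faces_of_rank (d - 1) Q. isomorphic (lower_section Q F) K"
  obtains S :: "nat ranked_order" where "alternating_semiregular (d + 1) P Q S" "treelike (d + 1) S"
proof -
  have PQ: "abstract_polytope d P" "abstract_polytope d Q"
    using P Q unfolding regular_polytope_def polytope_iff by auto
  interpret P: abstract_polytope d P by (rule PQ(1))
  interpret Q: abstract_polytope d Q by (rule PQ(2))
  obtain P' :: "nat ranked_order" and p where P': "abstract_polytope d P'" "order_iso P P' p" by (rule nat_copy[OF PQ(1)])
  obtain Q' :: "nat ranked_order" and q where Q': "abstract_polytope d Q'" "order_iso Q Q' q" by (rule nat_copy[OF PQ(2)])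
  interpret P': abstract_polytope d P' by (rule P'(1))
  interpret Q': abstract_polytope d Q' by (rule Q'(1))
  note KP' = order_iso_facets[OF P'(2) PQ(1) P'(1) KP]
  note KQ' = order_iso_facets[OF Q'(2) PQ(2) Q'(1) KQ]
  define X where "X = (\<lambda>k. if k then P' else Q')"
  have X: "abstract_polytope d (X k)" for k unfolding X_def using P'(1) Q'(1) by simp
  have facet: "\<exists>F. F \<in> faces_of_rank (d - 1) (X k)" for k
  proof -
    interpret X: abstract_polytope d "X k" by (rule X)
    obtain \<Phi> where \<Phi>: "flag (X k) \<Phi>" by (rule X.ex_flag)
    then show ?thesis
      using X.face_carrier[OF \<Phi>, of "d - 1"] X.rk_face[OF \<Phi>, of "d - 1"] d unfolding faces_of_rank_def by auto
  qed
  define B where "B = (\<lambda>k. SOME F. F \<in> faces_of_rank (d - 1) (X k))"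
  have B: "B k \<in> faces_of_rank (d - 1) (X k)" for k unfolding B_def using facet by (rule someI_ex)
  have K: "isomorphic (lower_section (X k) F) K" if "F \<in> faces_of_rank (d - 1) (X k)" for k F
    using that KP' KQ' unfolding X_def by (cases k) auto
  define u where "u = (\<lambda>k F. SOME f. order_iso (lower_section (X (\<not> k)) (B (\<not> k))) (lower_section (X k) F) f)"
  have u: "order_iso (lower_section (X (\<not> k)) (B (\<not> k))) (lower_section (X k) F) (u k F)"
    if F: "F \<in> faces_of_rank (d - 1) (X k)" for k F
  proof -
    have "isomorphic (lower_section (X (\<not> k)) (B (\<not> k))) (lower_section (X k) F)"
      by (rule isomorphic_trans[OF K[OF B] isomorphic_sym[OF K[OF F]]])
    then show ?thesis unfolding u_def isomorphic_iff by (rule someI_ex)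
  qed
  interpret gluing d X B u by (rule gluing.intro) (use d X B u in auto)
  have "inj_on (to_nat :: (nat list \<times> nat) option \<Rightarrow> nat) (carrier Z)" by (rule inj_on_subset[OF inj_to_nat]) simp
  then obtain S :: "nat ranked_order" and f where S: "abstract_polytope (d + 1) S" "order_iso Z S f"
    using relabel[OF Z.abstract_polytope_axioms] by blast
  interpret S: abstract_polytope "d + 1" S by (rule S(1))
  let ?g = "inv_into (carrier Z) f"
  have g: "order_iso S Z ?g" by (rule order_iso_inv[OF S(2)])
  have tree: "treelike (d + 1) S"
    by (rule order_iso_treelike[OF g S(1) Z.abstract_polytope_axioms treelike_Z])
  define col where "col = (\<lambda>G. kind (fst (the (?g G))))"
  have col: "col G = kind \<tau>" if "?g G = node_facet \<tau>" for G \<tau> unfolding col_def that node_facet_eq by simp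
  obtain \<Phi>P where \<Phi>P: "flag P \<Phi>P" by (rule P.ex_flag)
  obtain \<Phi>Q where \<Phi>Q: "flag Q \<Phi>Q" by (rule Q.ex_flag)
  have "coloured d P Q S col \<Phi>P \<Phi>Q"
  proof (intro coloured.intro d P Q S(1) tree \<Phi>P \<Phi>Q)
    fix G assume G: "G \<in> faces_of_rank d S"
    then have "?g G \<in> faces_of_rank d Z" by (rule order_iso_faces_of_rank[OF g S(1) Z.abstract_polytope_axioms])
    then obtain \<tau> where \<tau>: "node \<tau>" "?g G = node_facet \<tau>"
      using rk_d_node_facet[of "?g G"] unfolding faces_of_rank_def by blast
    have "isomorphic (lower_section S G) (lower_section Z (node_facet \<tau>))"
      using S.order_iso_lower_section[OF g Z.graded_poset_axioms, of G] G \<tau>(2)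
      unfolding faces_of_rank_def isomorphic_iff by auto
    moreover have "isomorphic (lower_section Z (node_facet \<tau>)) (X (kind \<tau>))"
      by (rule isomorphic_sym) (use facet_Z_iso[OF \<tau>(1)] in \<open>auto simp: isomorphic_iff\<close>)
    ultimately have iso: "isomorphic (lower_section S G) (X (kind \<tau>))" by (rule isomorphic_trans)
    have orig: "isomorphic P' P" "isomorphic Q' Q"
      using order_iso_inv[OF P'(2)] order_iso_inv[OF Q'(2)] unfolding isomorphic_iff by blast+
    show "if col G then isomorphic (lower_section S G) P else isomorphic (lower_section S G) Q"
    proof (cases "kind \<tau>")
      case True
      then show ?thesis using isomorphic_trans[OF _ orig(1)] iso col[OF \<tau>(2)] unfolding X_def by simp
    next
      case False
      then show ?thesis using isomorphic_trans[OF _ orig(2)] iso col[OF \<tau>(2)] unfolding X_def by simp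
    qed
  next
    fix R G H assume "cross (d + 1) S R G H"
    then have "cross (d + 1) Z (?g R) (?g G) (?g H)" by (rule order_iso_cross[OF g S(1) Z.abstract_polytope_axioms])
    then obtain \<sigma> F where "?g G = node_facet \<sigma> \<and> ?g H = node_facet (F # \<sigma>) \<or> ?g G = node_facet (F # \<sigma>) \<and> ?g H = node_facet \<sigma>"
      by (rule cross_Z) blast
    then show "col G \<noteq> col H" using col by auto
  qed
  then have "alternating_semiregular (d + 1) P Q S" by (rule coloured.alternating_semiregular)
  then show ?thesis using that tree by blast
qed

theorem theorem7p3:
  fixes d :: int
    and P :: "'p ranked_order" and Q :: "'q ranked_order"
    and K :: "'k ranked_order" and U :: "'u ranked_order"
  assumes "d \<ge> 1"
    and "regular_polytope d P" and "regular_polytope d Q" and "regular_polytope (d - 1) K"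
    and "\<forall>F\<in>faces_of_rank (d - 1) P. isomorphic (lower_section P F) K"
    and "\<forall>F\<in>faces_of_rank (d - 1) Q. isomorphic (lower_section Q F) K"
    and "finite_2_group (Aut P) \<or> infinite_2_group (Aut P)"
    and "finite_2_group (Aut Q) \<or> infinite_2_group (Aut Q)"
    and "universal_alternating_semiregular (d + 1) P Q U"
  shows "infinite_2_group (Aut U)"
proof -
  interpret P: abstract_polytope d P using assms(2) unfolding regular_polytope_def polytope_iff by simp
  interpret Q: abstract_polytope d Q using assms(3) unfolding regular_polytope_def polytope_iff by simp
  obtain \<Phi>P where \<Phi>P: "flag P \<Phi>P" by (rule P.ex_flag)
  obtain \<Phi>Q where \<Phi>Q: "flag Q \<Phi>Q" by (rule Q.ex_flag)
  interpret alternating_pair d P Q \<Phi>P \<Phi>Q by (intro alternating_pair.intro assms(1-3) \<Phi>P \<Phi>Q)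
  have U: "alternating_semiregular (d + 1) P Q U"
    and universal: "\<And>S :: nat ranked_order. alternating_semiregular (d + 1) P Q S \<Longrightarrow> \<exists>\<phi>. covering U S \<phi>"
    using assms(9) unfolding universal_alternating_semiregular_def by auto
  obtain S :: "nat ranked_order" where S: "alternating_semiregular (d + 1) P Q S" "treelike (d + 1) S"
    by (rule treelike_alternating_ex[OF assms(1-3,5,6)])
  obtain \<phi> where "covering U S \<phi>" using universal[OF S(1)] by blast
  then have tree: "treelike (d + 1) U" by (rule treelike_covering[OF U S(1) _ S(2)])
  interpret U: tree_polytope "d + 1" U "relators d P \<Phi>P" "relators d Q \<Phi>Q"
  proof (intro tree_polytope.intro tree_polytope_axioms.intro alternating_polytope[OF U] tree)
    show "2 \<le> d + 1" using assms(1) by simp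
  qed (use alternating_relators[OF U] in auto)
  have "two_torsion (d + 1 - 1) (relators d P \<Phi>P)" "two_torsion (d + 1 - 1) (relators d Q \<Phi>Q)"
    using P.two_torsion_relators[OF assms(2,7) \<Phi>P] Q.two_torsion_relators[OF assms(3,8) \<Phi>Q] by simp_all
  then show ?thesis by (rule U.infinite_2_group_Aut)
qed

end
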